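(* Let $\varepsilon>0$. For an odd prime $p$ and an integer $\ell\ge 1$ put $S_\ell(p):=\sum_{n\le \ell}\left(\frac{n}{p}\right)$, where $\left(\frac{\cdot}{p}\right)$ is the Legendre symbol, and define $$f_\varepsilon(p):=\min\{\ell\ge 1:\ S_\ell(p)<\varepsilon\ell\}.$$ Then there exists a constant $c_\varepsilon\in(0,\infty)$ such that, as $x\to\infty$, $$\sum_{p\le x} f_\varepsilon(p)\sim c_\varepsilon\,\frac{x}{\log x},$$ where the sum runs over odd primes $p\le x$.
   Context: $f\sim g$ means $f(x)/g(x)\to 1$ as $x\to\infty$. *)

theory Defs
  imports "HOL-Number_Theory.Number_Theory" "HOL-Library.Landau_Symbols"
begin

definition legendre_sum :: "nat \<Rightarrow> nat \<Rightarrow> int" where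
  "legendre_sum p l = (\<Sum>n=1..l. Legendre (int n) (int p))"

definition f_eps :: "real \<Rightarrow> nat \<Rightarrow> nat" where
  "f_eps \<epsilon> p = (LEAST l. l \<ge> 1 \<and> real_of_int (legendre_sum p l) < \<epsilon> * real l)"

end

(*
  A prime p has f(p) > l exactly when S_m(p) >= eps m for all 1 <= m <= l, a condition on the Legendre
  symbols (q/p) of the primes q <= l only. Expanding its indicator in products of these symbols and
  applying the prime number theorem twisted by real characters (n/.) shows that the set of such p has a
  relative density d_l; the constant is c = sum of all d_l, and the theorem follows by dominated
  convergence once the number of p <= x with f(p) > l is bounded by O(l^(-3/2) x / log x) uniformly.

  The twisted prime number theorem comes from Newman's contour argument, with non-vanishing on Re s = 1
  from 3 + 4 cos + cos 2 >= 0 and, at s = 1, from Monsky's Lambert series. The uniform bound rests on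
  even moments of S_l(p): a product of 2k numbers <= l is a square for only O(l^(k+1/2)) tuples, and
  for a non-square n the symbol (n/m) has bounded partial sums in m. For l <= (log x)^(1/6) primes are
  majorised by Selberg's Lambda_2 = Lambda log + Lambda * Lambda, which saves the factor log x; for
  l <= x^(1/24) all integers m <= x may be used with a higher moment. Beyond that, a duality argument
  leaves only O(x^(1/48)) primes, each with f(p) <= p^(3/4) by an averaged Polya-Vinogradov estimate.
*)

theory Submission
  imports Defs "HOL-Number_Theory.Prime_Powers" "HOL-Computational_Algebra.Squarefree"
    "HOL-Computational_Algebra.Nth_Powers" "HOL-Complex_Analysis.Complex_Analysis"
    "HOL-Real_Asymp.Real_Asymp"
begin

section \<open>Dirichlet convolution and real characters\<close>

text \<open>The prime number theorem proved here carries no uniformity in the character: it yields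
  each density, but no bound that can be summed over l. The uniform bound therefore rests on
  estimates that are explicit in the conductor. Selberg's function is mu convolved with log^2, so
  its sums twisted by a character with partial sums at most q are O(q M), without a logarithm. The
  exponents come from one count: the 2k-th moment gives the relative frequency l^(k+1/2) / l^(2k) =
  l^(1/2-k), provided the error l^(4k) of the non-square tuples is absorbed. k = 1 is not summable
  over l; k = 2 gives l^(-3/2), with the error absorbed for l^6 <= log x. With the trivial weight
  the factor log x < l^6 has to be paid for, which k = 8 does: l^(-15/2) l^6 = l^(-3/2), and 4k = 8
  + 24 explains the limit l^24 <= x. For l near x^(1/24), k = 96 makes l^k of order x^4, far above
  the period p q <= x^2 of a product of two symbols; the remaining sqrt l is at most x^(1/48), and
  1/48 + 3/4 < 1 makes this range negligible.\<close>

definition dconv :: "(nat \<Rightarrow> real) \<Rightarrow> (nat \<Rightarrow> real) \<Rightarrow> nat \<Rightarrow> real" where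
  "dconv f g n = (\<Sum>d | d dvd n. f d * g (n div d))"

definition moebius :: "nat \<Rightarrow> real" where
  "moebius n = (if squarefree n then (-1) ^ card (prime_factors n) else 0)"

lemma moebius_1 [simp]: "moebius (Suc 0) = 1"
  by (simp add: moebius_def)

lemma abs_moebius_le: "\<bar>moebius n\<bar> \<le> 1"
  by (simp add: moebius_def)

lemma moebius_prime_mult:
  assumes "prime p" "\<not> p dvd d"
  shows "moebius (p * d) = - moebius d"
proof (cases "squarefree d")
  case True
  hence d0: "d \<noteq> 0" by (metis not_squarefree_0)
  have cop: "coprime p d" using assms by (simp add: prime_imp_coprime)
  have "squarefree (p * d)" using True cop assms(1) by (simp add: squarefree_mult_coprime squarefree_prime)
  moreover have "prime_factors (p * d) = insert p (prime_factors d)"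
    using d0 assms by (subst prime_factors_product) (auto simp: prime_factorization_prime)
  moreover have "p \<notin> prime_factors d" using assms by (auto simp: in_prime_factors_iff)
  ultimately show ?thesis using True by (simp add: moebius_def)
next
  case False
  hence "\<not> squarefree (p * d)" using squarefree_multD(2) by blast
  with False show ?thesis by (simp add: moebius_def)
qed

text \<open>Only squarefree divisors count. For a prime p dividing n they fall into the set A of
  those prime to p and its image under d -> p d, on which \<open>moebius\<close> has the opposite
  sign.\<close>

lemma sum_moebius:
  assumes "n > 0"
  shows "(\<Sum>d | d dvd n. moebius d) = (if n = 1 then 1 else 0)"
proof (cases "n = 1")
  case False
  then obtain p where p: "prime p" "p dvd n" using prime_factor_nat by blast
  define A where "A = {d. d dvd n \<and> \<not> p dvd d \<and> squarefree d}"
  define B where "B = {d. d dvd n \<and> p dvd d \<and> squarefree d}"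
  have fin: "finite {d. d dvd n}" using assms by (simp add: finite_divisors_nat)
  have finAB: "finite A" "finite B" unfolding A_def B_def by (rule finite_subset[OF _ fin]; auto)+
  have "(\<Sum>d | d dvd n. moebius d) = (\<Sum>d\<in>A \<union> B. moebius d)"
    by (intro sum.mono_neutral_right fin) (auto simp: A_def B_def moebius_def)
  also have "\<dots> = (\<Sum>d\<in>A. moebius d) + (\<Sum>d\<in>B. moebius d)"
    by (intro sum.union_disjoint finAB) (auto simp: A_def B_def)
  also have "B = (\<lambda>d. p * d) ` A"
  proof (intro equalityI subsetI)
    fix d assume "d \<in> B"
    hence d: "d dvd n" "p dvd d" "squarefree d" by (auto simp: B_def)
    from d(2) obtain e where e: "d = p * e" by blast
    have "\<not> p dvd e"
    proof
      assume "p dvd e"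
      hence "p ^ 2 dvd d" by (auto simp: e power2_eq_square)
      with d(3) have "p dvd 1" by (auto simp: squarefree_def)
      with p(1) show False by auto
    qed
    moreover have "e dvd n" using d(1) e by (metis dvd_mult_right)
    moreover have "squarefree e" using d(3) e squarefree_multD(2) by blast
    ultimately show "d \<in> (\<lambda>d. p * d) ` A" using e by (auto simp: A_def)
  next
    fix d assume "d \<in> (\<lambda>d. p * d) ` A"
    then obtain e where e: "d = p * e" "e dvd n" "\<not> p dvd e" "squarefree e" by (auto simp: A_def)
    have "coprime p e" using e p by (simp add: prime_imp_coprime)
    thus "d \<in> B" using e p by (auto simp: B_def divides_mult squarefree_mult_coprime squarefree_prime)
  qed
  also have "(\<Sum>d\<in>(\<lambda>d. p * d) ` A. moebius d) = (\<Sum>d\<in>A. moebius (p * d))"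
    using p by (subst sum.reindex) (auto simp: inj_on_def dest: prime_gt_0_nat)
  also have "\<dots> = - (\<Sum>d\<in>A. moebius d)"
    unfolding sum_negf [symmetric] by (intro sum.cong refl moebius_prime_mult p) (auto simp: A_def)
  finally show ?thesis using False by simp
qed simp

lemma bij_betw_divisor_pairs:
  "bij_betw (\<lambda>(n, d). (d, n div d)) (SIGMA n:{1..}. {d. d dvd n}) ({1::nat..} \<times> {1..})"
proof (rule bij_betwI[where g = "\<lambda>(d, e). (d * e, d)"])
  show "(\<lambda>(n, d). (d, n div d)) \<in> (SIGMA n:{1::nat..}. {d. d dvd n}) \<rightarrow> {1..} \<times> {1..}"
  proof
    fix x assume "x \<in> (SIGMA n:{1::nat..}. {d. d dvd n})"
    then obtain n d where x: "x = (n, d)" "n \<ge> 1" "d dvd n" by auto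
    then obtain e where "n = d * e" by blast
    with x show "(case x of (n, d) \<Rightarrow> (d, n div d)) \<in> {1..} \<times> {1..}" by (cases "d = 0") auto
  qed
qed auto

text \<open>Both sides run over the pairs (d, m) with d m <= N; the right-hand side orders them by
  d.\<close>

lemma sum_dconv:
  "(\<Sum>n=1..N. dconv f g n) = (\<Sum>d=1..N. f d * (\<Sum>m=1..N div d. g m))"
proof -
  have "(\<Sum>n=1..N. dconv f g n) = (\<Sum>(n,d)\<in>(SIGMA n:{1..N}. {d. d dvd n}). f d * g (n div d))"
    unfolding dconv_def by (rule sum.Sigma) (auto simp: finite_divisors_nat)
  also have "\<dots> = (\<Sum>(d,m)\<in>(SIGMA d:{1..N}. {1..N div d}). f d * g m)"
  proof (rule sum.reindex_bij_witness[where j = "\<lambda>(n, d). (d, n div d)" and i = "\<lambda>(d, m). (d * m, d)"])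
    fix x assume "x \<in> (SIGMA n:{1..N}. {d. d dvd n})"
    then obtain n d where x: "x = (n, d)" "1 \<le> n" "n \<le> N" "d dvd n" by auto
    hence "d > 0" "d \<le> n" using dvd_imp_le[of d n] by (auto intro!: Nat.gr0I)
    moreover have "n div d \<le> N div d" using x by (simp add: div_le_mono)
    moreover have "n div d \<ge> 1" using x \<open>d > 0\<close> \<open>d \<le> n\<close> by (simp add: div_greater_zero_iff Suc_le_eq)
    ultimately show "(case x of (n, d) \<Rightarrow> (d, n div d)) \<in> (SIGMA d:{1..N}. {1..N div d})" using x by auto
  next
    fix x assume "x \<in> (SIGMA d:{1..N}. {1..N div d})"
    then obtain d m where x: "x = (d, m)" "1 \<le> d" "d \<le> N" "1 \<le> m" "m \<le> N div d" by auto
    hence "m * d \<le> N" by (simp add: less_eq_div_iff_mult_less_eq)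
    thus "(case x of (d, m) \<Rightarrow> (d * m, d)) \<in> (SIGMA n:{1..N}. {d. d dvd n})" using x by (auto simp: mult.commute)
  qed auto
  also have "\<dots> = (\<Sum>d=1..N. \<Sum>m=1..N div d. f d * g m)"
    by (rule sum.Sigma [symmetric]) auto
  finally show ?thesis by (simp add: sum_distrib_left)
qed

lemma dconv_commute: "n > 0 \<Longrightarrow> dconv f g n = dconv g f n"
  unfolding dconv_def
  by (rule sum.reindex_bij_witness[where i = "\<lambda>d. n div d" and j = "\<lambda>d. n div d"])
     (auto simp: div_div_eq_right dvd_div_eq_mult)

text \<open>No cancellation is built in, so that the constant function 1 on the positive integers is
  an instance too; bounded partial sums are added in \<open>quad_char\<close>. The three possible
  values are what makes the divisor sums of \<open>chi\<close> non-negative.\<close>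

locale real_cm =
  fixes chi :: "nat \<Rightarrow> real"
  assumes chi_0 [simp]: "chi 0 = 0" and chi_1 [simp]: "chi (Suc 0) = 1"
    and chi_mult: "chi (m * n) = chi m * chi n"
    and chi_vals: "chi n \<in> {-1, 0, 1}"
begin

lemma abs_chi_le: "\<bar>chi n\<bar> \<le> 1"
  using chi_vals[of n] by auto

text \<open>Complete multiplicativity takes chi(d) chi(n/d) = chi(n) out of the sum, so that
  untwisted convolution identities carry over to \<open>chi\<close>.\<close>

lemma dconv_moebius_chi: "n > 0 \<Longrightarrow> dconv (\<lambda>d. moebius d * chi d) chi n = (if n = 1 then 1 else 0)"
proof -
  assume n: "n > 0"
  have "dconv (\<lambda>d. moebius d * chi d) chi n = (\<Sum>d | d dvd n. chi n * moebius d)"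
    unfolding dconv_def by (intro sum.cong refl) (auto simp: chi_mult [symmetric] mult_ac)
  also have "\<dots> = chi n * (if n = 1 then 1 else 0)"
    using sum_moebius[OF n] by (simp add: sum_distrib_left [symmetric])
  finally show ?thesis by simp
qed

lemma dconv_mangoldt_chi: "n > 0 \<Longrightarrow> dconv (\<lambda>d. chi d * mangoldt d) chi n = chi n * ln (real n)"
proof -
  assume n: "n > 0"
  have "dconv (\<lambda>d. chi d * mangoldt d) chi n = (\<Sum>d | d dvd n. chi n * mangoldt d)"
    unfolding dconv_def by (intro sum.cong refl) (auto simp: chi_mult [symmetric] mult_ac)
  also have "\<dots> = chi n * ln (real n)"
    using mangoldt_sum[of n, where ?'a = real] n by (simp add: sum_distrib_left [symmetric])
  finally show ?thesis .
qed

lemma sum_divisors_chi_coprime: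
  assumes "coprime a b"
  shows "(\<Sum>d | d dvd a * b. chi d) = (\<Sum>d | d dvd a. chi d) * (\<Sum>d | d dvd b. chi d)"
proof -
  define A where "A = {d. d dvd a}"
  define B where "B = {d. d dvd b}"
  have inj: "inj_on (\<lambda>(x, y). x * y) (A \<times> B)"
  proof (rule inj_onI)
    fix u v assume uv: "u \<in> A \<times> B" "v \<in> A \<times> B" "(case u of (x, y) \<Rightarrow> x * y) = (case v of (x, y) \<Rightarrow> x * y)"
    obtain x y x' y' where e: "u = (x, y)" "v = (x', y')" by (cases u, cases v)
    have d: "x dvd a" "x' dvd a" "y dvd b" "y' dvd b" "x * y = x' * y'" using uv by (auto simp: e A_def B_def)
    have cop: "coprime x y'" "coprime x' y" "coprime y x'" "coprime y' x"
      using d assms by (meson coprime_divisors coprime_commute)+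
    have "x dvd x' * y'" "x' dvd x * y" "y dvd x' * y'" "y' dvd x * y" using d(5) by (metis dvd_triv_left dvd_triv_right)+
    hence "x dvd x'" "x' dvd x" "y dvd y'" "y' dvd y"
      using cop by (simp_all add: coprime_dvd_mult_left_iff coprime_dvd_mult_right_iff)
    thus "u = v" by (simp add: e dvd_antisym)
  qed
  have img: "{d. d dvd a * b} = (\<lambda>(x, y). x * y) ` (A \<times> B)"
    by (force simp: A_def B_def intro: mult_dvd_mono dest: division_decomp)
  have "(\<Sum>d | d dvd a * b. chi d) = (\<Sum>(x,y)\<in>A \<times> B. chi x * chi y)"
    unfolding img by (subst sum.reindex[OF inj]) (simp add: case_prod_unfold chi_mult)
  also have "\<dots> = (\<Sum>x\<in>A. chi x) * (\<Sum>y\<in>B. chi y)"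
    by (simp add: sum_product sum.cartesian_product)
  finally show ?thesis by (simp add: A_def B_def)
qed

lemma chi_power: "chi (n ^ k) = chi n ^ k"
  by (induction k) (auto simp: chi_mult)

lemma sum_divisors_chi_prime_power:
  assumes "prime p"
  shows "(\<Sum>d | d dvd p ^ k. chi d) \<ge> (if even k then 1 else 0)"
proof -
  have "{d. d dvd p ^ k} = (\<lambda>i. p ^ i) ` {..k}"
    using divides_primepow_nat[OF assms] by auto
  moreover have "inj_on (\<lambda>i. p ^ i) {..k}"
    using prime_gt_1_nat[OF assms] by (auto simp: inj_on_def)
  ultimately have "(\<Sum>d | d dvd p ^ k. chi d) = (\<Sum>i\<le>k. chi p ^ i)"
    by (simp add: sum.reindex chi_power)
  moreover have "(\<Sum>i\<le>k. (-1::real) ^ i) = (if even k then 1 else 0)"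
    by (induction k) auto
  moreover have "(\<Sum>i\<le>k. (0::real) ^ i) = 1"
    by (induction k) auto
  ultimately show ?thesis using chi_vals[of p] by auto
qed

text \<open>The divisor sum is multiplicative. At p^k it is 1 + chi(p) + ... + chi(p)^k, which is
  never negative and vanishes only for chi(p) = -1 with k odd, so at a square every local factor is
  at least 1. These lower bounds make a Lambert series unbounded in the proof that L(1, chi) is not
  0.\<close>

lemma sum_divisors_chi_nonneg:
  assumes "n > 0"
  shows "(\<Sum>d | d dvd n. chi d) \<ge> 0 \<and> ((\<exists>m. n = m\<^sup>2) \<longrightarrow> (\<Sum>d | d dvd n. chi d) \<ge> 1)"
  using assms
proof (induction n rule: less_induct)
  case (less n)
  show ?case
  proof (cases "n = 1")
    case False
    then obtain p where p: "prime p" "p dvd n" using prime_factor_nat by blast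
    define k where "k = multiplicity p n"
    obtain y where y: "n = p ^ k * y" "\<not> p dvd y"
      using multiplicity_decompose'[of n p] not_prime_unit[of p] p(1) less.prems unfolding k_def by blast
    have k0: "k > 0" using p less.prems by (simp add: k_def prime_multiplicity_gt_zero_iff)
    have y0: "y > 0" using y less.prems by (auto intro: Nat.gr0I)
    have "p ^ k > 1" using prime_gt_1_nat[OF p(1)] k0 by (rule one_less_power)
    hence "y < n" using y(1) y0 by simp
    note IH = less.IH[OF this y0]
    have "coprime (p ^ k) y" using p y by (simp add: prime_imp_coprime)
    hence eq: "(\<Sum>d | d dvd n. chi d) = (\<Sum>d | d dvd p ^ k. chi d) * (\<Sum>d | d dvd y. chi d)"
      unfolding y(1) by (rule sum_divisors_chi_coprime)
    note pk = sum_divisors_chi_prime_power[OF p(1), of k]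
    have "(\<Sum>d | d dvd n. chi d) \<ge> 0"
      unfolding eq using IH pk by (intro mult_nonneg_nonneg) (auto split: if_splits)
    moreover have "(\<Sum>d | d dvd n. chi d) \<ge> 1" if "n = m\<^sup>2" for m
    proof -
      have m0: "m > 0" using that less.prems by (auto intro: Nat.gr0I)
      have k: "k = 2 * multiplicity p m"
        using p m0 by (simp add: k_def that prime_elem_multiplicity_power_distrib)
      obtain z where z: "m = p ^ multiplicity p m * z"
        using multiplicity_dvd[of p m] by blast
      have "n = (p ^ multiplicity p m * z)\<^sup>2" using arg_cong[OF z, of "\<lambda>x. x\<^sup>2"] that by metis
      also have "\<dots> = p ^ k * z\<^sup>2" by (simp add: k power_mult_distrib power_mult [symmetric] mult.commute)
      finally have "p ^ k * y = p ^ k * z\<^sup>2" using y(1) by simp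
      hence "y = z\<^sup>2" using p(1) by auto
      hence "(\<Sum>d | d dvd y. chi d) \<ge> 1" using IH by blast
      moreover have "(\<Sum>d | d dvd p ^ k. chi d) \<ge> 1" using pk k by simp
      ultimately show ?thesis unfolding eq
        using mult_mono[of 1 "\<Sum>d | d dvd p ^ k. chi d" 1 "\<Sum>d | d dvd y. chi d"] by simp
    qed
    ultimately show ?thesis by blast
  qed auto
qed

end

section \<open>The Jacobi symbol as a real character\<close>

lemma Legendre_values: "Legendre a p \<in> {-1, 0, 1}"
  by (simp add: Legendre_def)

text \<open>By Euler's criterion both sides are congruent modulo p, and they differ by at most 2 <
  p.\<close>

lemma Legendre_mult:
  assumes p: "prime p" "p > 2"
  shows "Legendre (a * b) (int p) = Legendre a (int p) * Legendre b (int p)"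
proof -
  have "[Legendre a p * Legendre b p = a ^ ((p - 1) div 2) * b ^ ((p - 1) div 2)] (mod p)"
    by (intro cong_mult euler_criterion p)
  moreover have "[Legendre (a * b) p = (a * b) ^ ((p - 1) div 2)] (mod p)"
    by (rule euler_criterion[OF p])
  ultimately have "[Legendre (a * b) p = Legendre a p * Legendre b p] (mod p)"
    by (metis Cong.cong_def power_mult_distrib)
  hence d: "int p dvd Legendre (a * b) p - Legendre a p * Legendre b p" by (simp add: cong_iff_dvd_diff)
  have "\<bar>Legendre (a * b) p - Legendre a p * Legendre b p\<bar> \<le> 2"
    using Legendre_values[of "a * b" p] Legendre_values[of a p] Legendre_values[of b p] by auto
  with dvd_imp_le_int[OF _ d] p have "Legendre (a * b) p - Legendre a p * Legendre b p = 0"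
    by (cases "Legendre (a * b) p - Legendre a p * Legendre b p = 0") auto
  thus ?thesis by simp
qed

lemma Legendre_mod: "[a = b] (mod p) \<Longrightarrow> Legendre a p = Legendre b p"
  unfolding Legendre_def QuadRes_def Cong.cong_def by simp

lemma Legendre_1: "prime p \<Longrightarrow> Legendre 1 (int p) = 1"
  unfolding Legendre_def QuadRes_def
  by (auto simp: cong_0_iff prime_gt_1_nat intro: exI[of _ 1])

lemma Legendre_eq_0_iff: "Legendre a p = 0 \<longleftrightarrow> p dvd a"
  by (simp add: Legendre_def cong_0_iff)

text \<open>Gauss's lemma with a = 2. For h = (p - 1) / 2 the residues 2 x exceeding h are those
  with h div 2 < x <= h, so the sign is (-1)^(h - h div 2), which depends on p modulo 8.\<close>

lemma Legendre_2:
  assumes p: "prime p" "p > 2"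
  shows "Legendre 2 (int p) = (if p mod 8 = 1 \<or> p mod 8 = 7 then 1 else -1)"
proof -
  have odd: "odd p" using p prime_odd_nat by auto
  interpret G: GAUSS p 2
    by unfold_locales (use p odd in \<open>auto simp: cong_0_iff zdvd_not_zless\<close>)
  define h where "h = (p - 1) div 2"
  have h: "(int p - 1) div 2 = int h" "p = 2 * h + 1"
    using odd p by (auto simp: h_def elim!: oddE)
  have "G.E = (\<lambda>x. int (2 * x)) ` {h div 2 + 1..h}"
  proof -
    have A: "G.A = int ` {1..h}"
      unfolding G.A_def h(1) image_int_atLeastAtMost by auto
    have "G.C = (\<lambda>x. int (2 * x)) ` {1..h}"
      unfolding G.C_def G.B_def A image_image
    proof (rule image_cong[OF refl])
      fix x assume "x \<in> {1..h}"
      hence "int (2 * x) < int p" unfolding h(2) by simp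
      thus "int x * 2 mod int p = int (2 * x)" by simp
    qed
    moreover have "2 * x > h \<longleftrightarrow> x \<ge> h div 2 + 1" for x by presburger
    ultimately show ?thesis unfolding G.E_def h(1) by auto
  qed
  hence "card G.E = card {h div 2 + 1..h}" by (simp add: card_image inj_on_def)
  hence "card G.E = h - h div 2" by simp
  hence L: "Legendre 2 p = (-1) ^ (h - h div 2)" using G.gauss_lemma by simp
  have "even (h - h div 2) \<longleftrightarrow> p mod 8 = 1 \<or> p mod 8 = 7"
    unfolding h(2) by presburger
  thus ?thesis unfolding L by simp
qed

text \<open>The symbol (q/m) for a prime q and odd m, written through reciprocity as a function of
  m: (m/q) with the reciprocity sign, or the explicit values for q = 2. The value 0 at even m keeps
  it completely multiplicative in m and gives the uniform period 8 q.\<close>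

definition qchar :: "nat \<Rightarrow> nat \<Rightarrow> real" where
  "qchar q m = (if even m then 0
     else if q = 2 then (if m mod 8 = 1 \<or> m mod 8 = 7 then 1 else -1)
     else (if q mod 4 = 3 \<and> m mod 4 = 3 then -1 else 1) * of_int (Legendre (int m) (int q)))"

lemma qchar_values: "qchar q m \<in> {-1, 0, 1}"
  using Legendre_values[of "int m" "int q"] by (auto simp: qchar_def)

lemma qchar_1: "prime q \<Longrightarrow> qchar q (Suc 0) = 1"
  using Legendre_1[of q] by (simp add: qchar_def)

lemma qchar_mult:
  assumes "prime q"
  shows "qchar q (m * n) = qchar q m * qchar q n"
proof (cases "even m \<or> even n")
  case False
  hence odd: "odd m" "odd n" by auto
  have m: "m mod 4 = 1 \<or> m mod 4 = 3" "n mod 4 = 1 \<or> n mod 4 = 3" using odd by presburger+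
  have m8: "m mod 8 \<in> {1,3,5,7}" "n mod 8 \<in> {1,3,5,7}" using odd by (auto, presburger+)
  have mn4: "(m * n) mod 4 = ((m mod 4) * (n mod 4)) mod 4" by (simp add: mod_mult_eq)
  have mn8: "(m * n) mod 8 = ((m mod 8) * (n mod 8)) mod 8" by (simp add: mod_mult_eq)
  show ?thesis
  proof (cases "q = 2")
    case True
    thus ?thesis using odd m8 unfolding qchar_def mn8 by auto
  next
    case False
    hence "q > 2" using prime_ge_2_nat[OF assms] by simp
    from Legendre_mult[OF assms this, of "int m" "int n"] False show ?thesis
      using odd m unfolding qchar_def mn4 by auto
  qed
qed (auto simp: qchar_def)

lemma qchar_period: "qchar q (m + 8 * q * k) = qchar q m"
proof -
  define x where "x = m + 8 * q * k"
  have "Legendre (int x) (int q) = Legendre (int m) (int q)"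
    by (rule Legendre_mod) (simp add: cong_iff_dvd_diff x_def)
  moreover have "x mod 4 = m mod 4"
  proof -
    have "x = m + (2 * q * k) * 4" by (simp add: x_def)
    thus ?thesis by (simp only: mod_mult_self1)
  qed
  moreover have "x mod 8 = m mod 8"
  proof -
    have "x = m + (q * k) * 8" by (simp add: x_def)
    thus ?thesis by (simp only: mod_mult_self1)
  qed
  moreover have "even x \<longleftrightarrow> even m" by (simp add: x_def)
  ultimately show ?thesis unfolding x_def [symmetric] qchar_def by simp
qed

lemma qchar_eq_0: "prime q \<Longrightarrow> q dvd m \<Longrightarrow> qchar q m = 0"
  by (auto simp: qchar_def Legendre_eq_0_iff)

text \<open>Quadratic reciprocity: the symbol (q/p) with varying modulus p becomes a fixed periodic
  function evaluated at p, to which Dirichlet series apply.\<close>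

lemma qchar_prime:
  assumes q: "prime q" and p: "prime p" "p > 2"
  shows "qchar q p = of_int (Legendre (int q) (int p))"
proof -
  have oddp: "odd p" using p prime_odd_nat by auto
  consider "q = 2" | "q = p" | "q > 2" "q \<noteq> p" using prime_ge_2_nat[OF q] by linarith
  thus ?thesis
  proof cases
    case 1
    thus ?thesis using Legendre_2[OF p] oddp by (simp add: qchar_def)
  next
    case 2
    thus ?thesis using p q by (simp add: qchar_eq_0 Legendre_eq_0_iff)
  next
    case 3
    have oddq: "odd q" using q 3 prime_odd_nat by auto
    define e where "e = (p - 1) div 2 * ((q - 1) div 2)"
    have R: "Legendre p q * Legendre q p = (-1) ^ e"
      unfolding e_def by (rule Quadratic_Reciprocity) (use p q 3 in auto)
    have par: "odd e \<longleftrightarrow> p mod 4 = 3 \<and> q mod 4 = 3"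
    proof -
      have "odd ((p - 1) div 2) \<longleftrightarrow> p mod 4 = 3" "odd ((q - 1) div 2) \<longleftrightarrow> q mod 4 = 3"
        using oddp oddq by presburger+
      thus ?thesis by (simp add: e_def)
    qed
    have "Legendre (int p) (int q) * Legendre (int p) (int q) = 1"
      using R Legendre_values[of p q] Legendre_values[of q p] by auto
    hence "Legendre (int q) (int p) = Legendre (int p) (int q) * (-1) ^ e"
      using R by (metis mult.assoc mult.left_neutral)
    also have "(-1 :: int) ^ e = (if p mod 4 = 3 \<and> q mod 4 = 3 then -1 else 1)"
      using par by auto
    finally show ?thesis using 3 oddp by (auto simp: qchar_def)
  qed
qed

text \<open>The Jacobi symbol (n/m) as a function of m, extended multiplicatively in n. The empty
  product makes it constantly 1 for n = 1, also at m = 0 and at even m; hence the restriction to n >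
  1 where a character is wanted.\<close>

definition jac :: "nat \<Rightarrow> nat \<Rightarrow> real" where
  "jac n m = (\<Prod>q\<in>#prime_factorization n. qchar q m)"

lemma jac_1_left [simp]: "jac (Suc 0) m = 1"
  by (simp add: jac_def)

lemma jac_mult_left: "a > 0 \<Longrightarrow> b > 0 \<Longrightarrow> jac (a * b) m = jac a m * jac b m"
  by (simp add: jac_def prime_factorization_mult)

lemma jac_prime_left: "prime q \<Longrightarrow> jac q m = qchar q m"
  by (simp add: jac_def prime_factorization_prime)

lemma jac_power_left: "a > 0 \<Longrightarrow> jac (a ^ k) m = jac a m ^ k"
  by (induction k) (auto simp: jac_mult_left)

lemma jac_prod_left: "(\<And>i. i \<in> A \<Longrightarrow> f i > 0) \<Longrightarrow> jac (\<Prod>i\<in>A. f i) m = (\<Prod>i\<in>A. jac (f i) m)"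
  by (induction A rule: infinite_finite_induct) (auto simp: jac_mult_left prod_pos)

lemma jac_values: "jac n m \<in> {-1, 0, 1}"
proof -
  have "(\<Prod>q\<in>#M. qchar q m) \<in> {-1, 0, 1}" for M
  proof (induction M)
    case (add q M)
    thus ?case using qchar_values[of q m] by auto
  qed auto
  thus ?thesis by (simp add: jac_def)
qed

lemma jac_Legendre:
  assumes "prime p" "p > 2" "n > 0"
  shows "jac n p = of_int (Legendre (int n) (int p))"
proof -
  have "(\<Prod>q\<in>#M. qchar q p) = of_int (Legendre (int (\<Prod>\<^sub># M)) (int p))" if "\<And>q. q \<in># M \<Longrightarrow> prime q" for M
    using that
  proof (induction M)
    case empty
    thus ?case using Legendre_1[OF assms(1)] by simp
  next
    case (add q M)
    thus ?case using Legendre_mult[OF assms(1,2), of "int q" "int (\<Prod>\<^sub># M)"] qchar_prime[of q p] assms by simp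
  qed
  from this[OF in_prime_factors_imp_prime] show ?thesis
    using assms(3) by (simp add: jac_def prod_mset_prime_factorization_nat)
qed

lemma jac_mult_right: "jac n (a * b) = jac n a * jac n b"
proof -
  have "(\<Prod>q\<in>#M. qchar q (a * b)) = (\<Prod>q\<in>#M. qchar q a) * (\<Prod>q\<in>#M. qchar q b)" if "\<And>q. q \<in># M \<Longrightarrow> prime q" for M
    using that by (induction M) (auto simp: qchar_mult)
  from this[OF in_prime_factors_imp_prime] show ?thesis by (simp add: jac_def)
qed

lemma jac_1_right: "jac n (Suc 0) = 1"
proof -
  have "(\<Prod>q\<in>#M. qchar q (Suc 0)) = 1" if "\<And>q. q \<in># M \<Longrightarrow> prime q" for M
    using that by (induction M) (auto simp: qchar_1)
  from this[OF in_prime_factors_imp_prime] show ?thesis by (simp add: jac_def)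
qed

lemma jac_eq_prod_1: "(\<And>q. prime q \<Longrightarrow> q dvd n \<Longrightarrow> qchar q m = 1) \<Longrightarrow> jac n m = 1"
  unfolding jac_def by (intro prod_mset.neutral) (auto simp: in_prime_factors_iff)

lemma jac_eq_0:
  assumes "n > 0" "prime q" "q dvd n" "qchar q m = 0"
  shows "jac n m = 0"
proof -
  obtain k where "n = q * k" using assms by blast
  thus ?thesis using assms by (simp add: jac_mult_left jac_prime_left prime_gt_0_nat)
qed

lemma jac_period: "jac n (m + 8 * n) = jac n m"
proof -
  have "(\<Prod>q\<in>#M. qchar q (m + 8 * n)) = (\<Prod>q\<in>#M. qchar q m)" if "\<And>q. q \<in># M \<Longrightarrow> q dvd n" for M
    using that
  proof (induction M)
    case (add q M)
    obtain k where k: "n = q * k" using add.prems[of q] by auto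
    have "qchar q (m + 8 * n) = qchar q m" using qchar_period[of q m k] by (simp add: k mult_ac)
    with add show ?case by simp
  qed auto
  from this[OF in_prime_factors_imp_dvd] show ?thesis by (simp add: jac_def)
qed

text \<open>If every class were a square, squaring would map the nonzero residues onto themselves,
  hence injectively; but 1 and p - 1 have the same square.\<close>

lemma exists_nonresidue:
  assumes p: "prime p" "p > 2"
  shows "\<exists>a::nat. Legendre (int a) (int p) = -1"
proof (rule ccontr)
  assume no: "\<not> ?thesis"
  define f where "f = (\<lambda>x::nat. x\<^sup>2 mod p)"
  define A where "A = {1..<p}"
  have "A \<subseteq> f ` A"
  proof
    fix a assume a: "a \<in> A"
    hence "\<not> int p dvd int a" by (auto simp: A_def dest: dvd_imp_le)
    hence "QuadRes p a" using no by (auto simp: Legendre_def cong_0_iff split: if_splits)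
    then obtain y where y: "[y\<^sup>2 = int a] (mod p)" by (auto simp: QuadRes_def)
    define x where "x = nat (y mod int p)"
    have x: "int x = y mod int p" using p by (simp add: x_def)
    have "[int (x\<^sup>2) = int a] (mod p)"
      using y by (simp add: x power_mod Cong.cong_def)
    hence "[x\<^sup>2 = a] (mod p)" by (simp only: cong_int_iff)
    hence fx: "f x = a" using a by (simp add: f_def Cong.cong_def A_def)
    moreover have "x < p" using p x by (metis of_nat_0_less_iff of_nat_less_iff pos_mod_bound prime_gt_0_nat)
    moreover have "x \<noteq> 0" using fx a by (auto simp: f_def A_def intro!: Nat.gr0I)
    ultimately show "a \<in> f ` A" by (auto simp: A_def intro!: image_eqI[of _ _ x])
  qed
  moreover have fin: "finite A" by (simp add: A_def)
  ultimately have "card A \<le> card (f ` A)" by (intro card_mono) auto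
  hence "inj_on f A" using card_image_le[OF fin, of f] fin by (intro eq_card_imp_inj_on) auto
  moreover have "f 1 = f (p - 1)"
  proof -
    have "[(int p - 1)\<^sup>2 = 1] (mod p)" by (simp add: cong_iff_dvd_diff power2_eq_square algebra_simps)
    hence "[int ((p - 1)\<^sup>2) = int 1] (mod p)" using p by (simp add: of_nat_diff)
    hence "[(p - 1)\<^sup>2 = 1] (mod p)" by (simp only: cong_int_iff)
    thus ?thesis by (simp add: f_def Cong.cong_def)
  qed
  moreover have "1 \<in> A" "p - 1 \<in> A" using p by (auto simp: A_def)
  ultimately have "1 = p - 1" by (auto dest: inj_onD)
  with p show False by simp
qed

text \<open>A non-square n has a prime q of odd multiplicity. The Chinese remainder theorem gives u
  with (q/u) = -1 whose symbols at all other primes of n are 1. This is what separates non-square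
  from square products in every later count.\<close>

lemma exists_jac_minus_1:
  assumes n: "n > 0" and nsq: "\<not> is_nth_power 2 n"
  shows "\<exists>u. jac n u = -1"
proof -
  obtain q where q: "prime q" "odd (multiplicity q n)"
    using nsq is_nth_power_conv_multiplicity_nat[of 2 n] n by auto
  define v where "v = multiplicity q n"
  have "\<not> is_unit q" using not_prime_unit[of q] q(1) by blast
  then obtain n' where n': "n = q ^ v * n'" "\<not> q dvd n'"
    using multiplicity_decompose'[of n q] n unfolding v_def by blast
  have n'0: "n' > 0" using n' n by (auto intro: Nat.gr0I)
  have main: "jac n u = -1" if "qchar q u = -1" "\<And>r. prime r \<Longrightarrow> r dvd n' \<Longrightarrow> qchar r u = 1" for u
  proof -
    have "jac (q ^ v * n') u = qchar q u ^ v * jac n' u"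
      using q n'0 by (simp add: jac_mult_left jac_power_left jac_prime_left prime_gt_0_nat)
    moreover have "jac n' u = 1" by (rule jac_eq_prod_1) (rule that(2))
    moreover have "odd v" using q(2) by (simp add: v_def)
    ultimately show ?thesis using that(1) n'(1) by simp
  qed
  have one: "qchar r u = 1" if r: "prime r" and u: "[u = 1] (mod r)" "u mod 4 = 1" "r \<noteq> 2" for r u
  proof -
    have "Legendre (int u) (int r) = Legendre 1 (int r)"
      by (rule Legendre_mod) (use u(1) in \<open>simp flip: cong_int_iff\<close>)
    moreover have "odd u" using u(2) by presburger
    ultimately show ?thesis using u Legendre_1[OF r] by (simp add: qchar_def)
  qed
  show ?thesis
  proof (cases "q = 2")
    case True
    have "coprime 8 n'"
    proof -
      have "coprime 2 n'" using n'(2) True by simp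
      hence "coprime (2 ^ 3) n'" unfolding coprime_power_left_iff by blast
      thus ?thesis by simp
    qed
    \<comment> \<open>5 modulo 8 makes (2/u) = -1, while u = 1 modulo 4 keeps the reciprocity signs
      at the odd primes trivial.\<close>
    then obtain u where u: "[u = 5] (mod 8)" "[u = 1] (mod n')"
      using binary_chinese_remainder_nat[of 8 n' 5 1] by blast
    have u8: "u mod 8 = 5" using u(1) by (simp add: Cong.cong_def)
    have u4: "u mod 4 = 1" "odd u" using u8 by presburger+
    show ?thesis
    proof (intro exI main)
      show "qchar q u = -1" using True u8 u4 by (simp add: qchar_def)
      fix r assume r: "prime r" "r dvd n'"
      show "qchar r u = 1"
        by (rule one) (use r u u4 n'(2) True cong_dvd_modulus_nat in auto)
    qed
  next
    case False
    hence q2: "q > 2" using prime_ge_2_nat[OF q(1)] by simp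
    obtain a where a: "Legendre (int a) (int q) = -1" using exists_nonresidue[OF q(1) q2] by blast
    have "coprime q 8"
    proof -
      have "odd q" using q(1) q2 prime_odd_nat by auto
      hence "coprime q 2" by simp
      hence "coprime q (2 ^ 3)" unfolding coprime_power_right_iff by blast
      thus ?thesis by simp
    qed
    hence "coprime q (8 * n')" using n'(2) q(1) by (simp add: prime_imp_coprime)
    \<comment> \<open>Congruence to 1 modulo 8 n' makes the symbols at all other primes equal to 1,
      a possible prime 2 included.\<close>
    then obtain u where u: "[u = a] (mod q)" "[u = 1] (mod (8 * n'))"
      using binary_chinese_remainder_nat[of q "8 * n'" a 1] by blast
    have "[u = 1] (mod 8)" "[u = 1] (mod n')" using u(2) by (auto intro: cong_dvd_modulus_nat)
    hence u8: "u mod 8 = 1" and un: "[u = 1] (mod n')" by (auto simp: Cong.cong_def)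
    have u4: "u mod 4 = 1" "odd u" using u8 by presburger+
    show ?thesis
    proof (intro exI main)
      have "Legendre (int u) (int q) = Legendre (int a) (int q)"
        by (rule Legendre_mod) (use u(1) in \<open>simp add: cong_int_iff\<close>)
      thus "qchar q u = -1" using False a u4 by (simp add: qchar_def)
      fix r assume r: "prime r" "r dvd n'"
      show "qchar r u = 1"
      proof (cases "r = 2")
        case True
        thus ?thesis using u8 u4 by (simp add: qchar_def)
      next
        case False
        show ?thesis by (rule one) (use r un u4 False cong_dvd_modulus_nat in auto)
      qed
    qed
  qed
qed

section \<open>Complete and partial sums of periodic functions\<close>

lemma periodic_sum_mult:
  fixes f :: "nat \<Rightarrow> real"
  assumes k: "k > 0" and per: "\<And>m. f (m + k) = f m" and cop: "coprime u k"
  shows "(\<Sum>m<k. f (u * m)) = (\<Sum>m<k. f m)"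
proof -
  have per': "f (m + k * j) = f m" for m j
  proof (induction j)
    case (Suc j)
    have "f (m + k * Suc j) = f ((m + k * j) + k)" by (simp add: algebra_simps)
    thus ?case using Suc per by simp
  qed auto
  have fm: "f (m mod k) = f m" for m using per'[of "m mod k" "m div k"] by simp
  have "bij_betw (\<lambda>m. u * m mod k) {..<k} {..<k}"
  proof (rule bij_betw_imageI)
    show inj: "inj_on (\<lambda>m. u * m mod k) {..<k}"
    proof (rule inj_onI)
      fix x y assume xy: "x \<in> {..<k}" "y \<in> {..<k}" "u * x mod k = u * y mod k"
      hence "[u * x = u * y] (mod k)" by (simp add: Cong.cong_def)
      hence "[x = y] (mod k)" using cop by (simp add: cong_mult_lcancel_nat)
      thus "x = y" using xy by (simp add: Cong.cong_def)
    qed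
    show "(\<lambda>m. u * m mod k) ` {..<k} = {..<k}"
      by (rule endo_inj_surj[OF _ _ inj]) (use k in auto)
  qed
  from sum.reindex_bij_betw[OF this, of f] show ?thesis by (simp add: fm)
qed

lemma periodic_sum_zero:
  fixes f :: "nat \<Rightarrow> real"
  assumes k: "k > 0" and per: "\<And>m. f (m + k) = f m" and mult: "\<And>m. f (u * m) = - f m" and cop: "coprime u k"
  shows "(\<Sum>m<k. f m) = 0"
  using periodic_sum_mult[where f = f, OF k per cop] by (simp add: mult sum_negf)

text \<open>Complete periods contribute 0, so only an initial piece of one period remains, and it
  has fewer than k terms.\<close>

lemma periodic_partial_sums:
  fixes f :: "nat \<Rightarrow> real"
  assumes k: "k > 0" and per: "\<And>m. f (m + k) = f m" and zero: "(\<Sum>m<k. f m) = 0" and le: "\<And>m. \<bar>f m\<bar> \<le> 1"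
  shows "\<bar>\<Sum>m<N. f m\<bar> \<le> real k"
proof (induction N rule: less_induct)
  case (less N)
  show ?case
  proof (cases "N < k")
    case True
    have "\<bar>\<Sum>m<N. f m\<bar> \<le> (\<Sum>m<N. 1)" by (rule order.trans[OF sum_abs sum_mono]) (rule le)
    thus ?thesis using True by simp
  next
    case False
    then obtain N' where N': "N = k + N'" by (metis le_Suc_ex not_less)
    have "(\<Sum>m<k + N'. f m) = (\<Sum>m<k. f m) + (\<Sum>m<N'. f (k + m))"
      by (induction N') auto
    hence "(\<Sum>m<N. f m) = (\<Sum>m<N'. f m)" using zero per by (simp add: N' add.commute)
    thus ?thesis using less.IH[of N'] k N' by simp
  qed
qed

lemma jac_real_cm: "n > 1 \<Longrightarrow> real_cm (jac n)"
proof
  assume n: "n > 1"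
  then obtain q where q: "prime q" "q dvd n" using prime_factor_nat[of n] by auto
  show "jac n 0 = 0" by (rule jac_eq_0[OF _ q]) (use n in \<open>auto simp: qchar_def\<close>)
qed (use jac_1_right jac_mult_right jac_values in auto)

lemma jac_partial_sums:
  assumes n: "n > 0" and nsq: "\<not> is_nth_power 2 n"
  shows "\<bar>\<Sum>m=1..N. jac n m\<bar> \<le> 8 * real n"
proof -
  have n1: "n > 1" using nsq n by (cases "n = 1") auto
  interpret real_cm "jac n" by (rule jac_real_cm[OF n1])
  obtain u where u: "jac n u = -1" using exists_jac_minus_1[OF assms] by blast
  \<comment> \<open>A prime dividing both u and 8 n would force \<open>jac n u = 0\<close>: through
    a vanishing factor if it divides n, and through the vanishing at even arguments if it is
    2.\<close>
  have cop: "coprime u (8 * n)"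
  proof (rule ccontr)
    assume "\<not> coprime u (8 * n)"
    hence "gcd u (8 * n) \<noteq> 1" unfolding coprime_iff_gcd_eq_1 .
    then obtain p where p': "prime p" "p dvd gcd u (8 * n)" using prime_factor_nat by blast
    have p: "prime p" "p dvd u" "p dvd 8 * n"
      using p' dvd_trans[OF p'(2) gcd_dvd1] dvd_trans[OF p'(2) gcd_dvd2] by blast+
    show False
    proof (cases "p dvd n")
      case True
      from jac_eq_0[OF n p(1) True qchar_eq_0[OF p(1,2)]] u show False by simp
    next
      case False
      hence "p dvd 2 ^ 3" using p by (simp add: prime_dvd_mult_iff)
      hence "p dvd 2" using p(1) prime_dvd_power by blast
      hence "even u" using p by (metis primes_dvd_imp_eq two_is_prime_nat)
      obtain q where q: "prime q" "q dvd n" using prime_factor_nat[of n] n1 by auto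
      from jac_eq_0[OF n q, of u] u \<open>even u\<close> show False by (simp add: qchar_def)
    qed
  qed
  have "(\<Sum>m<8 * n. jac n m) = 0"
    by (rule periodic_sum_zero[where u = u]) (use n cop u in \<open>auto simp: jac_period jac_mult_right\<close>)
  hence "\<bar>\<Sum>m<Suc N. jac n m\<bar> \<le> real (8 * n)"
    by (intro periodic_partial_sums) (use n in \<open>auto simp: jac_period abs_chi_le\<close>)
  moreover have "(\<Sum>m<Suc N. jac n m) = (\<Sum>m=1..N. jac n m)"
    by (simp add: lessThan_Suc_atMost atMost_atLeast0 sum.atLeast_Suc_atMost)
  ultimately show ?thesis by simp
qed

section \<open>Newman's Tauberian theorem\<close>

text \<open>Removing f(0) / z leaves a holomorphic function on a convex set, whose integral over the
  closed path is 0. The integral of 1 / z is computed with the branch Ln z on the right half circle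
  and Ln (-z) on h, which avoids the non-negative real axis; each gives pi i. The left path h is
  arbitrary because two choices are needed: a wedge near the imaginary axis for the limit function,
  and the other half circle for the partial sums.\<close>

lemma half_circle_cauchy_formula:
  fixes f :: "complex \<Rightarrow> complex" and R :: real
  defines "g \<equiv> part_circlepath 0 R (-(pi/2)) (pi/2)"
  assumes R: "R > 0" and U: "open U" "convex U" "f holomorphic_on U" "0 \<in> U"
    and h: "valid_path h" "pathstart h = \<i> * of_real R" "pathfinish h = - \<i> * of_real R"
    "path_image h \<subseteq> U" "path_image h \<inter> {z. Im z = 0 \<and> Re z \<ge> 0} = {}"
    and gU: "path_image g \<subseteq> U"
  shows "contour_integral g (\<lambda>z. f z / z) + contour_integral h (\<lambda>z. f z / z) = 2 * of_real pi * \<i> * f 0"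
    and "(\<lambda>z. f z / z) contour_integrable_on g" and "(\<lambda>z. f z / z) contour_integrable_on h"
proof -
  define Q where "Q = (\<lambda>z. if z = 0 then deriv f 0 else (f z - f 0) / (z - 0))"
  have Qhol: "Q holomorphic_on U"
    unfolding Q_def by (rule pole_lemma) (use U in \<open>auto simp: interior_open\<close>)
  have vg: "valid_path g" by (simp add: g_def)
  have exp_pos: "exp (\<i> * of_real pi / 2) = \<i>" "exp (- (\<i> * of_real pi / 2)) = -\<i>"
    using cis_conv_exp[of "pi/2"] cis_conv_exp[of "-pi/2"]
    by (simp_all add: complex_eq_iff)
  have gs: "pathstart g = - \<i> * of_real R" "pathfinish g = \<i> * of_real R"
    unfolding g_def by (simp_all add: exp_pos mult.commute)
  have gR: "norm z = R" "Re z \<ge> 0" if "z \<in> path_image g" for z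
  proof -
    have "- (pi/2) \<le> pi/2" by simp
    with that show "norm z = R" using R unfolding g_def
      using in_path_image_part_circlepath[of z 0 R "-(pi/2)" "pi/2"] by simp
    from that obtain x where x: "z = R * exp (\<i> * of_real x)" "- (pi/2) \<le> x" "x \<le> pi/2"
      unfolding g_def by (subst (asm) path_image_part_circlepath) auto
    have "Re z = R * cos x" by (simp add: x(1) Re_exp)
    with x R cos_ge_zero[of x] show "Re z \<ge> 0" by simp
  qed
  have g0: "0 \<notin> path_image g" using gR(1)[of 0] R by auto
  have h0: "0 \<notin> path_image h" using h(5) by auto
  have jv: "valid_path (g +++ h)" using vg h gs by (intro valid_path_join) auto
  have "(Q has_contour_integral 0) (g +++ h)"
    by (rule Cauchy_theorem_convex_simple[OF Qhol U(2) jv])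
       (use gU h gs in \<open>auto simp: path_image_join\<close>)
  hence Q0: "contour_integral (g +++ h) Q = 0" by (rule contour_integral_unique)
  have Qg: "Q contour_integrable_on g" and Qh: "Q contour_integrable_on h"
    using contour_integrable_holomorphic_simple[OF Qhol U(1)] vg h gU by auto
  have sum0: "contour_integral g Q + contour_integral h Q = 0"
    using Q0 Qg Qh vg h by simp
  have inv_g: "((\<lambda>z. 1 / z) has_contour_integral (Ln (\<i> * of_real R) - Ln (- \<i> * of_real R))) g"
  proof -
    have "((\<lambda>z. 1/z) has_contour_integral (Ln (pathfinish g) - Ln (pathstart g))) g"
    proof (rule contour_integral_primitive[of "path_image g"])
      fix z assume "z \<in> path_image g"
      with gR[of z] R have "z \<notin> \<real>\<^sub>\<le>\<^sub>0"
        by (auto simp: complex_nonpos_Reals_iff cmod_def)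
      thus "(Ln has_field_derivative 1 / z) (at z within path_image g)"
        by (auto intro!: derivative_eq_intros simp: field_simps)
    qed (use vg in auto)
    thus ?thesis by (simp add: gs)
  qed
  have inv_h: "((\<lambda>z. 1 / z) has_contour_integral (Ln (\<i> * of_real R) - Ln (- \<i> * of_real R))) h"
  proof -
    have "((\<lambda>z. 1/z) has_contour_integral (Ln (- (pathfinish h)) - Ln (- (pathstart h)))) h"
    proof (rule contour_integral_primitive[of "path_image h" "\<lambda>z. Ln (-z)"])
      fix z assume z: "z \<in> path_image h"
      have "-z \<notin> \<real>\<^sub>\<le>\<^sub>0"
        using h(5) z by (auto simp: complex_nonpos_Reals_iff)
      moreover have "z \<noteq> 0" using z h0 by auto
      ultimately show "((\<lambda>z. Ln (-z)) has_field_derivative 1 / z) (at z within path_image h)"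
        by (auto intro!: derivative_eq_intros simp: field_simps)
    qed (use h in auto)
    thus ?thesis by (simp add: h)
  qed
  have lnval: "Ln (\<i> * of_real R) - Ln (- \<i> * of_real R) = of_real pi * \<i>"
  proof -
    have 1: "Ln (\<i> * of_real R) = of_real (ln R) + Ln \<i>"
      using Ln_times_of_real[of R \<i>] R by (simp add: mult.commute Ln_of_real)
    have 2: "Ln (- \<i> * of_real R) = of_real (ln R) + Ln (-\<i>)"
      using Ln_times_of_real[of R "-\<i>"] R by (simp add: mult.commute Ln_of_real)
    show ?thesis unfolding 1 2 by simp
  qed
  have eq: "f z / z = Q z + f 0 * (1 / z)" if "z \<noteq> 0" for z
    using that by (simp add: Q_def field_simps)
  have ig: "((\<lambda>z. f z / z) has_contour_integral (contour_integral g Q + f 0 * (of_real pi * \<i>))) g"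
    by (rule has_contour_integral_eq[OF has_contour_integral_add[OF
       has_contour_integral_integral[OF Qg] has_contour_integral_lmul[OF inv_g[unfolded lnval]]]])
       (use g0 eq in \<open>metis\<close>)
  have ih: "((\<lambda>z. f z / z) has_contour_integral (contour_integral h Q + f 0 * (of_real pi * \<i>))) h"
    by (rule has_contour_integral_eq[OF has_contour_integral_add[OF
       has_contour_integral_integral[OF Qh] has_contour_integral_lmul[OF inv_h[unfolded lnval]]]])
       (use h0 eq in \<open>metis\<close>)
  show "(\<lambda>z. f z / z) contour_integrable_on g" "(\<lambda>z. f z / z) contour_integrable_on h"
    using ig ih by (auto simp: contour_integrable_on_def)
  show "contour_integral g (\<lambda>z. f z / z) + contour_integral h (\<lambda>z. f z / z) = 2 * of_real pi * \<i> * f 0"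
    unfolding contour_integral_unique[OF ig] contour_integral_unique[OF ih]
    using sum0 by (simp add: algebra_simps)
qed

text \<open>Dominated convergence: the exponential decays pointwise where Re z < 0 and has norm at
  most 1 throughout, and at the remaining points, those with Re z = 0, G vanishes.\<close>

lemma linepath_integral_tendsto_0:
  fixes G :: "complex \<Rightarrow> complex"
  assumes cont: "continuous_on (closed_segment a b) G"
    and le: "\<And>z. z \<in> closed_segment a b \<Longrightarrow> Re z \<le> 0"
    and zero: "\<And>z. z \<in> closed_segment a b \<Longrightarrow> Re z = 0 \<Longrightarrow> G z = 0"
  shows "(\<lambda>N. contour_integral (linepath a b) (\<lambda>z. G z * exp (z * of_real (ln (real N + 1))))) \<longlonglongrightarrow> 0"
proof -
  have seg: "linepath a b t \<in> closed_segment a b" if "t \<in> {0..1}" for t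
    using that linepath_in_path by auto
  have contl: "continuous_on {0..1} (\<lambda>t. G (linepath a b t))"
    by (rule continuous_on_compose2[OF cont]) (use seg in \<open>auto intro: continuous_intros\<close>)
  have contf: "continuous_on {0..1} (\<lambda>t. G (linepath a b t) * exp (linepath a b t * of_real (ln (real N + 1))) * (b - a))" for N
    by (intro continuous_intros contl)
  have eq: "contour_integral (linepath a b) (\<lambda>z. G z * exp (z * of_real (ln (real N + 1)))) =
      integral {0..1} (\<lambda>t. G (linepath a b t) * exp (linepath a b t * of_real (ln (real N + 1))) * (b - a))" for N
    by (rule contour_integral_unique, unfold has_contour_integral_linepath,
        intro integrable_integral integrable_continuous_real contf)
  have "(\<lambda>N. integral {0..1} (\<lambda>t. G (linepath a b t) * exp (linepath a b t * of_real (ln (real N + 1))) * (b - a)))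
      \<longlonglongrightarrow> integral {0..1::real} (\<lambda>t. 0 :: complex)"
  proof (rule dominated_convergence(2)[where f = "\<lambda>N t. G (linepath a b t) * exp (linepath a b t * of_real (ln (real N + 1))) * (b - a)" and g = "\<lambda>_. 0" and h = "\<lambda>t. norm (G (linepath a b t)) * norm (b - a)"])
    fix N
    show "(\<lambda>t. G (linepath a b t) * exp (linepath a b t * of_real (ln (real N + 1))) * (b - a)) integrable_on {0..1}"
      by (intro integrable_continuous_real contf)
  next
    show "(\<lambda>t. norm (G (linepath a b t)) * norm (b - a)) integrable_on {0..1}"
      by (intro integrable_continuous_real continuous_intros contl)
  next
    fix N and t :: real assume t: "t \<in> {0..1}"
    have "norm (exp (linepath a b t * of_real (ln (real N + 1)))) \<le> 1"
      using le[OF seg[OF t]] by (auto simp: mult_le_0_iff)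
    thus "norm (G (linepath a b t) * exp (linepath a b t * of_real (ln (real N + 1))) * (b - a))
       \<le> norm (G (linepath a b t)) * norm (b - a)"
      unfolding norm_mult by (intro mult_right_mono) (auto intro: mult_left_le)
  next
    fix t :: real assume t: "t \<in> {0..1}"
    define w where "w = linepath a b t"
    show "(\<lambda>N. G (linepath a b t) * exp (linepath a b t * of_real (ln (real N + 1))) * (b - a)) \<longlonglongrightarrow> 0"
    proof (cases "Re w = 0")
      case True
      thus ?thesis using zero[OF seg[OF t]] by (simp add: w_def)
    next
      case False
      hence neg: "Re w < 0" using le[OF seg[OF t]] by (simp add: w_def)
      have "(\<lambda>N. exp (Re w * ln (real N + 1))) \<longlonglongrightarrow> 0"
        using neg by real_asymp
      hence "(\<lambda>N. norm (exp (w * of_real (ln (real N + 1))))) \<longlonglongrightarrow> 0"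
        by simp
      hence "(\<lambda>N. exp (w * of_real (ln (real N + 1)))) \<longlonglongrightarrow> 0"
        by (rule tendsto_norm_zero_cancel)
      hence "(\<lambda>N. G w * exp (w * of_real (ln (real N + 1))) * (b - a)) \<longlonglongrightarrow> G w * 0 * (b - a)"
        by (intro tendsto_intros)
      thus ?thesis by (simp add: w_def)
    qed
  qed
  thus ?thesis by (simp add: eq)
qed


text \<open>Newman's contour argument for a series in place of an integral. The norm bound
  telescopes: the partial sum S_N(z) for Re z < 0 and the tail for Re z > 0 are both at most C
  (N+1)^(-Re z) / |Re z|. On |z| = R the kernel divided by z has norm (N+1)^(Re z) 2 |Re z| / R^2,
  so each half circle contributes O(1/R) uniformly in N.\<close>

theorem newman_tauberian:
  fixes u :: "nat \<Rightarrow> complex \<Rightarrow> complex" and F :: "complex \<Rightarrow> complex" and C :: real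
  assumes C: "C > 0" and u: "\<And>n. u n holomorphic_on UNIV"
    and bd: "\<And>n z. Re z \<noteq> 0 \<Longrightarrow> norm (u n z) \<le>
        C * (((real n + 1) powr (- Re z) - (real n + 2) powr (- Re z)) / Re z)"
    and V: "open V" "{z. Re z \<ge> 0} \<subseteq> V" "F holomorphic_on V"
    and F: "\<And>z. Re z > 0 \<Longrightarrow> (\<lambda>n. u n z) sums F z"
  shows "(\<lambda>n. u n 0) sums F 0"
proof -
  define S where "S = (\<lambda>N z. \<Sum>n<N. u n z)"
  have Shol: "S N holomorphic_on UNIV" for N
    unfolding S_def by (intro holomorphic_intros u)
  have head: "norm (S N z) \<le> C * ((real N + 1) powr (- Re z) / (- Re z))" if z: "Re z < 0" for N z
  proof -
    have "norm (S N z) \<le> (\<Sum>n<N. C * (((real n + 1) powr (- Re z) - (real n + 2) powr (- Re z)) / Re z))"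
      unfolding S_def by (rule sum_norm_le) (use bd z in auto)
    also have "\<dots> = C * ((\<Sum>n<N. (real n + 1) powr (- Re z) - (real (Suc n) + 1) powr (- Re z)) / Re z)"
      by (simp add: sum_distrib_left sum_divide_distrib add_ac)
    also have "(\<Sum>n<N. (real n + 1) powr (- Re z) - (real (Suc n) + 1) powr (- Re z)) = 1 - (real N + 1) powr (- Re z)"
      by (subst sum_lessThan_telescope') simp
    also have "C * ((1 - (real N + 1) powr (- Re z)) / Re z) \<le> C * ((real N + 1) powr (- Re z) / (- Re z))"
      using C z by (intro mult_left_mono) (auto simp: field_simps)
    finally show ?thesis .
  qed
  have tail: "norm (F z - S N z) \<le> C * ((real N + 1) powr (- Re z) / Re z)" if z: "Re z > 0" for N z
  proof -
    have 1: "(\<lambda>n. u (n + N) z) sums (F z - S N z)"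
      using sums_split_initial_segment[OF F[OF z], of N] by (simp add: S_def)
    have lim: "(\<lambda>n. (real (n + N) + 1) powr (- Re z)) \<longlonglongrightarrow> 0"
      using z by real_asymp
    have "(\<lambda>n. (real (n + N) + 1) powr (- Re z) - (real (Suc n + N) + 1) powr (- Re z)) sums
        ((real (0 + N) + 1) powr (- Re z) - 0)"
      by (rule telescope_sums'[OF lim])
    hence "(\<lambda>n. C * (((real (n + N) + 1) powr (- Re z) - (real (Suc n + N) + 1) powr (- Re z)) / Re z)) sums
        (C * (((real N + 1) powr (- Re z)) / Re z))"
      by (intro sums_mult sums_divide) simp
    hence 2: "(\<lambda>n. C * (((real (n + N) + 1) powr (- Re z) - (real (n + N) + 2) powr (- Re z)) / Re z)) sums
        (C * (((real N + 1) powr (- Re z)) / Re z))"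
      by (simp add: add_ac)
    have 3: "norm (u (n + N) z) \<le> C * (((real (n + N) + 1) powr (- Re z) - (real (n + N) + 2) powr (- Re z)) / Re z)" for n
      using bd[of z "n + N"] z by simp
    have 4: "summable (\<lambda>n. norm (u (n + N) z))"
      by (rule summable_comparison_test'[OF sums_summable[OF 2]]) (use 3 in auto)
    have "norm (F z - S N z) = norm (\<Sum>n. u (n + N) z)" using 1 by (simp add: sums_iff)
    also have "\<dots> \<le> (\<Sum>n. norm (u (n + N) z))" by (rule summable_norm[OF 4])
    also have "\<dots> \<le> C * ((real N + 1) powr (- Re z) / Re z)"
      using suminf_le[OF 3 4 sums_summable[OF 2]] sums_unique[OF 2] by simp
    finally show ?thesis .
  qed
  have key: "\<exists>e. e \<longlonglongrightarrow> 0 \<and> (\<forall>N. norm (F 0 - S N 0) \<le> 2 * C / R + e N)" if R: "R > 0" for R :: real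
  proof -
    \<comment> \<open>The segment of the imaginary axis is compact, so F is holomorphic on a
      rectangle that reaches a little to the left of it.\<close>
    define A where "A = (\<lambda>y. Complex 0 y) ` {- R - 1 .. R + 1}"
    have "continuous_on {- R - 1 .. R + 1} (\<lambda>y. of_real y * \<i>)" by (intro continuous_intros)
    moreover have "(\<lambda>y. of_real y * \<i>) = Complex 0" by (auto simp: complex_eq_iff)
    ultimately have "continuous_on {- R - 1 .. R + 1} (Complex 0)" by metis
    hence "compact A" unfolding A_def by (intro compact_continuous_image) auto
    moreover have "A \<subseteq> V" using V by (auto simp: A_def)
    ultimately obtain \<delta> where \<delta>: "\<delta> > 0" "(\<Union>x\<in>A. ball x \<delta>) \<subseteq> V"
      using compact_subset_open_imp_ball_epsilon_subset V(1) by metis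
    define U where "U = {z. Re z > - \<delta>} \<inter> {z. Im z < R + 1} \<inter> {z. Im z > - R - 1}"
    have Uo: "open U" unfolding U_def by (intro open_Int open_halfspace_Re_gt open_halfspace_Im_lt open_halfspace_Im_gt)
    have Uc: "convex U" unfolding U_def
      by (intro convex_Int convex_halfspace_Re_gt convex_halfspace_Im_lt convex_halfspace_Im_gt)
    have UV: "U \<subseteq> V"
    proof
      fix z assume z: "z \<in> U"
      show "z \<in> V"
      proof (cases "Re z \<ge> 0")
        case False
        have "dist (Complex 0 (Im z)) z = \<bar>Re z\<bar>" by (simp add: dist_norm cmod_def)
        hence "z \<in> ball (Complex 0 (Im z)) \<delta>" using z False by (simp add: U_def)
        moreover have "Complex 0 (Im z) \<in> A" using z by (auto simp: A_def U_def)
        ultimately show ?thesis using \<delta>(2) by blast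
      qed (use V in auto)
    qed
    define d where "d = \<delta> / 2"
    have d: "d > 0" "d < \<delta>" using \<delta> by (auto simp: d_def)
    define g where "g = part_circlepath 0 R (-(pi/2)) (pi/2)"
    define k where "k = part_circlepath 0 R (pi/2) (3 * pi/2)"
    define a where "a = \<i> * complex_of_real R"
    define b where "b = - complex_of_real d"
    define c where "c = - \<i> * complex_of_real R"
    \<comment> \<open>For F the contour closes by a wedge through -d. It meets the imaginary axis
      only at its ends, the points with z^2 = -R^2 where the kernel vanishes, so for fixed R its
      integral tends to 0 with growing N.\<close>
    define h where "h = linepath a b +++ linepath b c"
    have seg1: "Re z \<le> 0 \<and> \<bar>Im z\<bar> \<le> R \<and> Re z \<ge> - d \<and> (Re z = 0 \<longrightarrow> z = a)" if z: "z \<in> closed_segment a b" for z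
    proof -
      obtain t where t: "0 \<le> t" "t \<le> 1" "z = (1 - t) *\<^sub>R a + t *\<^sub>R b"
        using z by (auto simp: in_segment)
      have "t * d \<le> 1 * d" "(1 - t) * R \<le> 1 * R" using t d R by (intro mult_right_mono; simp)+
      moreover have "t * d \<ge> 0" "(1 - t) * R \<ge> 0" using t d R by auto
      moreover have "Re z = - (t * d)" "Im z = (1 - t) * R" by (simp_all add: t a_def b_def)
      moreover have "z = a" if "t = 0" using that t by simp
      ultimately show ?thesis using d by auto
    qed
    have seg2: "Re z \<le> 0 \<and> \<bar>Im z\<bar> \<le> R \<and> Re z \<ge> - d \<and> (Re z = 0 \<longrightarrow> z = c)" if z: "z \<in> closed_segment b c" for z
    proof -
      obtain t where t: "0 \<le> t" "t \<le> 1" "z = (1 - t) *\<^sub>R b + t *\<^sub>R c"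
        using z by (auto simp: in_segment)
      have "(1 - t) * d \<le> 1 * d" "t * R \<le> 1 * R" using t d R by (intro mult_right_mono; simp)+
      moreover have "(1 - t) * d \<ge> 0" "t * R \<ge> 0" using t d R by auto
      moreover have "Re z = - ((1 - t) * d)" "Im z = - (t * R)" by (simp_all add: t b_def c_def)
      moreover have "z = c" if "t = 1" using that t by simp
      ultimately show ?thesis using d by auto
    qed
    have ac: "Im a = R" "Im c = - R" "a \<noteq> 0" "c \<noteq> 0" "Re a = 0" "Re c = 0" using R by (auto simp: a_def c_def)
    have pih: "path_image h = closed_segment a b \<union> closed_segment b c"
      unfolding h_def by (subst path_image_join) auto
    have vh: "valid_path h" "pathstart h = a" "pathfinish h = c"
      unfolding h_def by (auto intro: valid_path_join)
    have hU: "path_image h \<subseteq> U"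
    proof
      fix z assume "z \<in> path_image h"
      with seg1[of z] seg2[of z] d show "z \<in> U" by (auto simp: pih U_def)
    qed
    have hn: "path_image h \<inter> {z. Im z = 0 \<and> Re z \<ge> 0} = {}"
    proof -
      have "\<not> (Im z = 0 \<and> Re z \<ge> 0)" if "z \<in> path_image h" for z
        using that seg1[of z] seg2[of z] ac R by (auto simp: pih)
      thus ?thesis by blast
    qed
    have gim: "norm z = R \<and> Re z \<ge> 0" if "z \<in> path_image g" for z
    proof -
      obtain x where x: "z = R * exp (\<i> * of_real x)" "- (pi/2) \<le> x" "x \<le> pi/2"
        using \<open>z \<in> path_image g\<close> unfolding g_def by (subst (asm) path_image_part_circlepath) auto
      have "Re z = R * cos x" by (simp add: x(1) Re_exp)
      with x R cos_ge_zero[of x] show ?thesis by (simp add: norm_mult)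
    qed
    have kim: "norm z = R \<and> Re z \<le> 0" if "z \<in> path_image k" for z
    proof -
      obtain x where x: "z = R * exp (\<i> * of_real x)" "pi/2 \<le> x" "x \<le> 3 * pi/2"
        using \<open>z \<in> path_image k\<close> unfolding k_def by (subst (asm) path_image_part_circlepath) auto
      have "Re z = R * cos x" by (simp add: x(1) Re_exp)
      moreover have "cos x \<le> 0" using cos_ge_zero[of "x - pi"] x by (simp add: cos_diff)
      ultimately show ?thesis using x R by (simp add: norm_mult mult_le_0_iff)
    qed
    have gU: "path_image g \<subseteq> U"
    proof
      fix z assume "z \<in> path_image g"
      with gim[of z] abs_Im_le_cmod[of z] \<delta> show "z \<in> U" by (auto simp: U_def abs_le_iff)
    qed
    \<comment> \<open>Newman's kernel: it is 1 at z = 0, and on |z| = R the factor 1 + z^2 / R^2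
      equals z times 2 Re z / R^2, which cancels the singular 1 / |Re z| of both bounds.\<close>
    define K where "K = (\<lambda>N (z::complex). exp (z * of_real (ln (real N + 1))) * (1 + z^2 / of_real R^2))"
    have Kn: "norm (K N z / z) = (real N + 1) powr (Re z) * (2 * \<bar>Re z\<bar> / R^2)" if z: "norm z = R" for N and z :: complex
    proof -
      have z0: "z \<noteq> 0" using z R by auto
      have zz: "z * cnj z = of_real (R^2)" using z complex_norm_square[of z] by simp
      have "(1 + z^2 / of_real R^2) / z = (of_real (R^2) + z^2) / (of_real (R^2) * z)"
        using R z0 by (simp add: field_simps)
      also have "\<dots> = (z * (cnj z + z)) / (of_real (R^2) * z)"
        by (subst zz [symmetric]) (simp add: algebra_simps power2_eq_square)
      also have "\<dots> = of_real (2 * Re z / R^2)"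
        using z0 complex_add_cnj[of z] by (simp add: add.commute)
      finally have "norm ((1 + z^2 / of_real R^2) / z) = 2 * \<bar>Re z\<bar> / R^2"
        by (simp only: norm_of_real) (simp add: abs_mult)
      moreover have "norm (exp (z * of_real (ln (real N + 1)))) = (real N + 1) powr (Re z)"
        by (simp add: powr_def)
      ultimately show ?thesis unfolding K_def
        by (metis (no_types, lifting) norm_mult times_divide_eq_right)
    qed
    have Khol: "K N holomorphic_on X" for N X
      unfolding K_def using R by (intro holomorphic_intros) auto
    have K0: "K N 0 = 1" for N by (simp add: K_def)
    have zU: "0 \<in> U" using R \<delta> by (simp add: U_def)
    have FU: "(\<lambda>z. F z * K N z) holomorphic_on U" for N
      using holomorphic_on_subset[OF V(3) UV] by (intro holomorphic_intros Khol)
    have SU: "(\<lambda>z. S N z * K N z) holomorphic_on UNIV" for N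
      using Shol by (intro holomorphic_intros Khol)
    note IF = half_circle_cauchy_formula[OF R Uo Uc FU zU vh(1) vh(2)[unfolded a_def] vh(3)[unfolded c_def] hU hn
        gU[unfolded g_def], folded g_def]
    have exp_neg: "exp (- (\<i> * of_real pi / 2)) = -\<i>" "exp (\<i> * of_real pi / 2) = \<i>"
        "exp (\<i> * (3 * of_real pi / 2)) = -\<i>"
      using cis_conv_exp[of "-pi/2"] cis_conv_exp[of "pi/2"] cis_conv_exp[of "3*pi/2"] cos_3over2_pi sin_3over2_pi
      by (simp_all add: complex_eq_iff)
    have k1: "valid_path k" "pathstart k = \<i> * of_real R" "pathfinish k = - \<i> * of_real R"
      unfolding k_def using exp_neg by (simp_all add: mult.commute)
    have k2: "path_image k \<inter> {z. Im z = 0 \<and> Re z \<ge> 0} = {}"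
    proof -
      have "\<not> (Im z = 0 \<and> Re z \<ge> 0)" if "z \<in> path_image k" for z
        using kim[OF that] R by (auto simp: cmod_def)
      thus ?thesis by blast
    qed
    \<comment> \<open>The partial sums are entire, so their contour may close by the other half of
      the circle, where the bound for Re z < 0 applies.\<close>
    note IS = half_circle_cauchy_formula[OF R open_UNIV convex_UNIV SU UNIV_I k1 subset_UNIV k2 subset_UNIV, folded g_def]
    define E where "E = (\<lambda>N. norm (contour_integral h (\<lambda>z. F z * K N z / z)))"
    have bound: "norm (F 0 - S N 0) \<le> 2 * C / R + E N" for N
    proof -
      have eq: "2 * of_real pi * \<i> * (F 0 - S N 0) =
          (contour_integral g (\<lambda>z. F z * K N z / z) - contour_integral g (\<lambda>z. S N z * K N z / z))
          + contour_integral h (\<lambda>z. F z * K N z / z) - contour_integral k (\<lambda>z. S N z * K N z / z)"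
        using IF(1)[of N] IS(1)[of N] by (simp add: K0 algebra_simps)
      have tri: "norm (x + y - z) \<le> norm x + norm y + norm z" for x y z :: complex
        using norm_triangle_ineq4[of "x + y" z] norm_triangle_ineq[of x y] by linarith
      have "contour_integral g (\<lambda>z. F z * K N z / z) - contour_integral g (\<lambda>z. S N z * K N z / z)
          = contour_integral g (\<lambda>z. (F z - S N z) * (K N z / z))"
        by (subst contour_integral_diff [symmetric, OF IF(2) IS(2)]) (simp add: algebra_simps diff_divide_distrib)
      moreover have "norm (contour_integral g (\<lambda>z. (F z - S N z) * (K N z / z))) \<le> (2 * C / R^2) * R * \<bar>pi/2 - (-(pi/2))\<bar>"
        unfolding g_def
      proof (rule contour_integral_bound_part_circlepath, fold g_def)
        have "(\<lambda>z. F z * K N z / z - S N z * K N z / z) contour_integrable_on g"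
          by (rule contour_integrable_diff[OF IF(2) IS(2)])
        thus "(\<lambda>z. (F z - S N z) * (K N z / z)) contour_integrable_on g"
          by (simp add: algebra_simps diff_divide_distrib)
      next
        fix z assume "z \<in> path_image g"
        hence z: "norm z = R" "Re z \<ge> 0" using gim by auto
        show "norm ((F z - S N z) * (K N z / z)) \<le> 2 * C / R^2"
        proof (cases "Re z = 0")
          case True
          show ?thesis
            unfolding norm_mult Kn[OF z(1)] using True C by simp
        next
          case False
          hence pos: "Re z > 0" using z by simp
          have "norm ((F z - S N z) * (K N z / z)) \<le>
            C * ((real N + 1) powr (- Re z) / Re z) * ((real N + 1) powr (Re z) * (2 * \<bar>Re z\<bar> / R^2))"
            unfolding norm_mult Kn[OF z(1)] by (intro mult_right_mono tail pos) auto
          also have "\<dots> = 2 * C / R^2" using pos by (simp add: powr_minus field_simps)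
          finally show ?thesis .
        qed
      qed (use C R in auto)
      moreover have "norm (contour_integral k (\<lambda>z. S N z * K N z / z)) \<le> (2 * C / R^2) * R * \<bar>3*pi/2 - pi/2\<bar>"
        unfolding k_def
      proof (rule contour_integral_bound_part_circlepath, fold k_def)
        show "(\<lambda>z. S N z * K N z / z) contour_integrable_on k" by (rule IS(3))
      next
        fix z assume "z \<in> path_image k"
        hence z: "norm z = R" "Re z \<le> 0" using kim by auto
        show "norm (S N z * K N z / z) \<le> 2 * C / R^2"
        proof (cases "Re z = 0")
          case True
          have "norm (S N z * (K N z / z)) \<le> 2 * C / R^2"
            unfolding norm_mult Kn[OF z(1)] using True C by simp
          thus ?thesis by simp
        next
          case False
          hence neg: "Re z < 0" using z by simp
          have "norm (S N z * (K N z / z)) \<le>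
            C * ((real N + 1) powr (- Re z) / (- Re z)) * ((real N + 1) powr (Re z) * (2 * \<bar>Re z\<bar> / R^2))"
            unfolding norm_mult Kn[OF z(1)] by (intro mult_right_mono head neg) auto
          also have "\<dots> = 2 * C / R^2" using neg by (simp add: powr_minus field_simps)
          finally show ?thesis by simp
        qed
      qed (use C R in auto)
      ultimately have "norm (2 * of_real pi * \<i> * (F 0 - S N 0)) \<le> 2 * C / R^2 * R * pi + E N + 2 * C / R^2 * R * pi"
        using tri[of "contour_integral g (\<lambda>z. F z * K N z / z) - contour_integral g (\<lambda>z. S N z * K N z / z)"
            "contour_integral h (\<lambda>z. F z * K N z / z)" "contour_integral k (\<lambda>z. S N z * K N z / z)"]
        unfolding eq E_def by simp
      also have "\<dots> = 2 * pi * (2 * C / R) + E N" using R by (simp add: power2_eq_square)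
      finally have "2 * pi * norm (F 0 - S N 0) \<le> 2 * pi * (2 * C / R) + E N"
        by (simp add: norm_mult)
      also have "E N \<le> 2 * pi * E N"
        using mult_right_mono[of 1 "2 * pi" "E N"] pi_gt3 by (simp add: E_def)
      finally have "2 * pi * norm (F 0 - S N 0) \<le> 2 * pi * (2 * C / R + E N)" by (simp add: algebra_simps)
      thus ?thesis by simp
    qed
    have lim: "E \<longlonglongrightarrow> 0"
    proof -
      define G where "G = (\<lambda>z. F z * (1 + z^2 / of_real R^2) / z)"
      have FK: "(\<lambda>z. F z * K N z / z) = (\<lambda>z. G z * exp (z * of_real (ln (real N + 1))))" for N
        by (simp add: G_def K_def fun_eq_iff)
      have F_cont: "continuous_on (path_image h) F"
        using holomorphic_on_imp_continuous_on[OF V(3)] hU UV continuous_on_subset by blast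
      have h0: "0 \<notin> path_image h" using hn by auto
      have G_cont: "continuous_on (path_image h) G"
        unfolding G_def using R h0 by (intro continuous_intros F_cont) auto
      have aa: "G a = 0" "G c = 0" using R by (auto simp: G_def a_def c_def power_mult_distrib)
      have 1: "(\<lambda>N. contour_integral (linepath a b) (\<lambda>z. G z * exp (z * of_real (ln (real N + 1))))) \<longlonglongrightarrow> 0"
        by (rule linepath_integral_tendsto_0)
           (use G_cont seg1 aa in \<open>auto simp: pih intro: continuous_on_subset\<close>)
      have 2: "(\<lambda>N. contour_integral (linepath b c) (\<lambda>z. G z * exp (z * of_real (ln (real N + 1))))) \<longlonglongrightarrow> 0"
        by (rule linepath_integral_tendsto_0)
           (use G_cont seg2 aa in \<open>auto simp: pih intro: continuous_on_subset\<close>)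
      have Gc: "continuous_on (closed_segment a b) G" "continuous_on (closed_segment b c) G"
        using G_cont by (auto simp: pih intro: continuous_on_subset)
      have split: "contour_integral h (\<lambda>z. G z * exp (z * of_real (ln (real N + 1)))) =
          contour_integral (linepath a b) (\<lambda>z. G z * exp (z * of_real (ln (real N + 1)))) +
          contour_integral (linepath b c) (\<lambda>z. G z * exp (z * of_real (ln (real N + 1))))" for N
        unfolding h_def
        by (rule contour_integral_join) (auto intro!: contour_integrable_continuous_linepath continuous_intros Gc)
      show ?thesis unfolding E_def FK split
        using tendsto_norm[OF tendsto_add[OF 1 2]] by simp
    qed
    show ?thesis using bound lim by blast
  qed
  have "(\<lambda>N. S N 0) \<longlonglongrightarrow> F 0"
  proof (rule LIMSEQ_I)
    fix r :: real assume r: "r > 0"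
    define R where "R = 4 * C / r"
    have R: "R > 0" using C r by (simp add: R_def)
    obtain e where e: "e \<longlonglongrightarrow> 0" "\<And>N. norm (F 0 - S N 0) \<le> 2 * C / R + e N" using key[OF R] by blast
    have "2 * C / R = r / 2" using C r by (simp add: R_def)
    moreover obtain n0 where "\<And>n. n \<ge> n0 \<Longrightarrow> norm (e n - 0) < r / 2"
      using LIMSEQ_D[OF e(1), of "r/2"] r by auto
    ultimately have "norm (S N 0 - F 0) < r" if "N \<ge> n0" for N
      using e(2)[of N] that by (fastforce simp: norm_minus_commute)
    thus "\<exists>no. \<forall>n\<ge>no. norm (S n 0 - F 0) < r" by blast
  qed
  thus ?thesis by (simp add: sums_def S_def)
qed

section \<open>The functions n^(-s), their differences, and a Tauberian theorem for Dirichlet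
  series\<close>

definition npow :: "nat \<Rightarrow> complex \<Rightarrow> complex" where
  "npow n s = exp (- s * of_real (ln (real n)))"

lemma npow_holomorphic [holomorphic_intros]:
  "f holomorphic_on A \<Longrightarrow> (\<lambda>s. npow n (f s)) holomorphic_on A"
  unfolding npow_def by (intro holomorphic_intros)

lemma norm_npow: "n > 0 \<Longrightarrow> norm (npow n s) = real n powr (- Re s)"
  by (simp add: npow_def powr_def)

lemma npow_1 [simp]: "npow (Suc 0) s = 1" "npow 1 s = 1"
  by (simp_all add: npow_def)

lemma npow_0_right [simp]: "npow n 0 = 1"
  by (simp add: npow_def)

lemma npow_at_1: "n > 0 \<Longrightarrow> npow n 1 = of_real (1 / real n)"
  by (simp add: npow_def exp_minus exp_of_real divide_inverse)

lemma npow_mult: "m > 0 \<Longrightarrow> n > 0 \<Longrightarrow> npow (m * n) s = npow m s * npow n s"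
  by (simp add: npow_def ln_mult exp_add [symmetric] algebra_simps)

text \<open>The integral of x^(-s-1) over n <= x <= n + 1. It appears with argument s in partial
  summation, and with s - 1 when n^(-s) is compared with an integral; there the value filled in at 0
  is the one at s = 1.\<close>

definition npow_diff :: "nat \<Rightarrow> complex \<Rightarrow> complex" where
  "npow_diff n s = (if s = 0 then of_real (ln (real n + 1) - ln (real n))
     else (npow n s - npow (Suc n) s) / s)"

lemma npow_diff_holomorphic_aux: "npow_diff n holomorphic_on UNIV"
proof -
  define f where "f = (\<lambda>s. npow n s - npow (Suc n) s)"
  have f: "f holomorphic_on UNIV" unfolding f_def by (intro holomorphic_intros)
  have "(f has_field_derivative of_real (ln (real n + 1) - ln (real n))) (at 0)"
    unfolding f_def npow_def by (auto intro!: derivative_eq_intros simp: algebra_simps)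
  hence "deriv f 0 = of_real (ln (real n + 1) - ln (real n))" by (rule DERIV_imp_deriv)
  hence "npow_diff n = (\<lambda>z. if z = 0 then deriv f 0 else (f z - f 0) / (z - 0))"
    by (auto simp: npow_diff_def f_def fun_eq_iff)
  thus ?thesis using pole_lemma[OF f, of 0] by simp
qed

lemma npow_diff_holomorphic [holomorphic_intros]:
  "f holomorphic_on A \<Longrightarrow> (\<lambda>s. npow_diff n (f s)) holomorphic_on A"
  using holomorphic_on_compose_gen[of f A "npow_diff n" UNIV] npow_diff_holomorphic_aux[of n] by (simp add: o_def)

lemma npow_diff_eq: "s * npow_diff n s = npow n s - npow (Suc n) s"
  by (simp add: npow_diff_def)

lemma npow_diff_has_integral:
  assumes "n > 0"
  shows "((\<lambda>u. exp (- s * of_real u)) has_integral npow_diff n s) {ln (real n)..ln (real n + 1)}"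
proof (cases "s = 0")
  case True
  have "((\<lambda>u. 1 :: complex) has_integral (ln (real n + 1) - ln (real n)) *\<^sub>R 1) {ln (real n)..ln (real n + 1)}"
    using assms by (intro has_integral_const_real[THEN has_integral_eq_rhs]) auto
  with True show ?thesis by (simp add: npow_diff_def scaleR_conv_of_real)
next
  case False
  have "((\<lambda>u. exp (- s * of_real u)) has_integral
      (- exp (- s * of_real (ln (real n + 1))) / s - (- exp (- s * of_real (ln (real n))) / s)))
      {ln (real n)..ln (real n + 1)}"
  proof (rule fundamental_theorem_of_calculus)
    show "ln (real n) \<le> ln (real n + 1)" using assms by simp
    show "((\<lambda>u. - exp (- s * of_real u) / s) has_vector_derivative exp (- s * of_real x))
         (at x within {ln (real n)..ln (real n + 1)})" for x
    proof -
      have "((\<lambda>u. - exp (- s * u) / s) has_field_derivative exp (- s * of_real x)) (at (of_real x))"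
        using False by (auto intro!: derivative_eq_intros)
      thus ?thesis using has_vector_derivative_real_field has_vector_derivative_at_within by blast
    qed
  qed
  moreover have "- exp (- s * of_real (ln (real n + 1))) / s - (- exp (- s * of_real (ln (real n))) / s) = npow_diff n s"
    using False by (simp add: npow_diff_def npow_def field_simps)
  ultimately show ?thesis by simp
qed

text \<open>With x = e^u the integrand has norm e^(-(Re s - 1) u) e^(-u), and e^(-u) <= 1/n on the
  interval. For s = 1 + z this is the telescoping difference that \<open>newman_tauberian\<close>
  asks for, once coefficients of size O(n) have cancelled the factor 1/n.\<close>

lemma norm_npow_diff_le:
  assumes n: "n > 0" and x: "Re s \<noteq> 1"
  shows "norm (npow_diff n s) \<le> ((real n powr (1 - Re s) - (real n + 1) powr (1 - Re s)) / (Re s - 1)) / real n"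
proof -
  define y where "y = Re s - 1"
  have y: "y \<noteq> 0" using x by (simp add: y_def)
  let ?I = "{ln (real n)..ln (real n + 1)}"
  have "((\<lambda>u. exp (- y * u) / real n) has_integral
      (- exp (- y * ln (real n + 1)) / y / real n - (- exp (- y * ln (real n)) / y / real n))) ?I"
    by (rule fundamental_theorem_of_calculus)
       (use n y in \<open>auto intro!: derivative_eq_intros simp flip: has_real_derivative_iff_has_vector_derivative\<close>)
  moreover have "- exp (- y * ln (real n + 1)) / y / real n - (- exp (- y * ln (real n)) / y / real n)
     = ((real n powr (1 - Re s) - (real n + 1) powr (1 - Re s)) / (Re s - 1)) / real n"
    using n by (simp add: powr_def y_def diff_divide_distrib)
  ultimately have g: "((\<lambda>u. exp (- y * u) / real n) has_integral
      ((real n powr (1 - Re s) - (real n + 1) powr (1 - Re s)) / (Re s - 1)) / real n) ?I" by simp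
  note f = npow_diff_has_integral[OF n, of s]
  have le: "norm (exp (- s * of_real u)) \<le> exp (- y * u) / real n" if "u \<in> ?I" for u
  proof -
    have "norm (exp (- s * of_real u)) = exp (- y * u) * exp (- u)"
      by (simp add: y_def exp_add [symmetric] algebra_simps)
    also have "exp (- u) \<le> exp (- ln (real n))" using that by simp
    also have "exp (- ln (real n)) = 1 / real n" using n by (simp add: exp_minus inverse_eq_divide)
    finally show ?thesis by simp
  qed
  show ?thesis
    using integral_norm_bound_integral[OF has_integral_integrable[OF f] has_integral_integrable[OF g] le]
    by (simp only: integral_unique[OF f] integral_unique[OF g])
qed

text \<open>If A n were at least (1 + eta) n, monotonicity would keep the differences A (m + 1) - (m
  + 1) above eta n / 2 for k further indices, eta n / 8 <= k <= eta n / 4. With denominators at most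
  4 n^2 such a block of the series reaches eta^2 / 64, against Cauchy's criterion. Too small an A n
  is excluded by the block before n.\<close>

lemma mono_tauberian:
  fixes A :: "nat \<Rightarrow> real"
  assumes mono: "mono A"
    and summ: "summable (\<lambda>n. (A (n + 1) - (real n + 1)) / ((real n + 1) * (real n + 2)))"
  shows "(\<lambda>n. A n / real n) \<longlonglongrightarrow> 1"
proof (rule LIMSEQ_I)
  fix r :: real assume "r > 0"
  define \<eta> where "\<eta> = min r 1"
  have \<eta>: "\<eta> > 0" "\<eta> \<le> 1" "\<eta> \<le> r" using \<open>r > 0\<close> by (auto simp: \<eta>_def)
  define b where "b = (\<lambda>n. (A (n + 1) - (real n + 1)) / ((real n + 1) * (real n + 2)))"
  have "\<forall>e>0. \<exists>N. \<forall>m\<ge>N. \<forall>n. norm (sum b {m..<n}) < e"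
    using summ unfolding b_def summable_Cauchy by blast
  then obtain N where N: "\<And>m n. m \<ge> N \<Longrightarrow> \<bar>sum b {m..<n}\<bar> < \<eta>\<^sup>2 / 64"
    using \<eta> by (metis real_norm_def divide_pos_pos zero_less_numeral zero_less_power)
  define M where "M = max (2 * N + 2) (nat \<lceil>8 / \<eta>\<rceil>)"
  have main: "\<bar>A n - real n\<bar> < \<eta> * real n" if n: "n \<ge> M" for n
  proof -
    define k where "k = nat \<lfloor>\<eta> * real n / 4\<rfloor>"
    have n1: "n \<ge> 2 * N + 2" and n2: "real n \<ge> 8 / \<eta>" using n unfolding M_def by linarith+
    have n3: "\<eta> * real n \<ge> 8" using n2 \<eta> by (simp add: field_simps)
    have k1: "real k \<le> \<eta> * real n / 4" unfolding k_def using n3 by linarith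
    have k2: "real k \<ge> \<eta> * real n / 8" unfolding k_def using n3 by linarith
    have "\<eta> * real n / 4 \<le> real n / 4" using mult_right_mono[OF \<eta>(2), of "real n"] by simp
    hence k3: "4 * k \<le> n" using k1 by linarith
    have npos: "real n > 0" using n1 by simp
    have kb: "\<eta>\<^sup>2 / 64 \<le> real k * (\<eta> / (8 * real n))"
    proof -
      have "\<eta>\<^sup>2 / 64 = (\<eta> * real n / 8) * (\<eta> / (8 * real n))" using npos by (simp add: field_simps power2_eq_square)
      also have "\<dots> \<le> real k * (\<eta> / (8 * real n))" using k2 \<eta> by (intro mult_right_mono) auto
      finally show ?thesis .
    qed
    have den: "(real m + 1) * (real m + 2) \<le> 4 * (real n)\<^sup>2" if "4 * (m + 1) \<le> 5 * n" for m
    proof -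
      have "real (4 * (m + 1)) \<le> real (5 * n)" using that by (simp only: of_nat_le_iff)
      moreover have "real n \<ge> 2" using n1 by simp
      ultimately have "real m + 1 \<le> 2 * real n" "real m + 2 \<le> 2 * real n" by simp_all
      hence "(real m + 1) * (real m + 2) \<le> (2 * real n) * (2 * real n)" by (intro mult_mono) auto
      thus ?thesis by (simp add: power2_eq_square)
    qed
    have qq: "\<eta> * real n / 2 / (4 * (real n)\<^sup>2) = \<eta> / (8 * real n)"
      using npos by (simp add: power2_eq_square)
    have up: "A n < (1 + \<eta>) * real n"
    proof (rule ccontr)
      assume "\<not> ?thesis"
      hence A': "A n \<ge> real n + \<eta> * real n" by (simp add: ring_distribs)
      have "real k * (\<eta> / (8 * real n)) = (\<Sum>m\<in>{n..<n+k}. \<eta> / (8 * real n))" by simp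
      also have "\<dots> \<le> sum b {n..<n+k}"
      proof (rule sum_mono)
        fix m assume m: "m \<in> {n..<n+k}"
        have "A n \<le> A (m + 1)" using m by (intro monoD[OF mono]) auto
        moreover have "real m + 1 \<le> real n + real k" using m by auto
        ultimately have ge: "\<eta> * real n / 2 \<le> A (m + 1) - (real m + 1)" using A' k1 n3 by linarith
        have nn: "0 \<le> A (m + 1) - (real m + 1)" using ge n3 by linarith
        have d: "(real m + 1) * (real m + 2) \<le> 4 * (real n)\<^sup>2" using m k3 by (intro den) auto
        have "0 < (real m + 1) * (real m + 2)" by simp
        from frac_le[OF nn ge this d] have "\<eta> * real n / 2 / (4 * (real n)\<^sup>2) \<le> b m"
          unfolding b_def .
        thus "\<eta> / (8 * real n) \<le> b m" unfolding qq .
      qed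
      finally have fin: "real k * (\<eta> / (8 * real n)) \<le> sum b {n..<n+k}" .
      have "n \<ge> N" using n1 by simp
      from N[OF this, of "n + k"] show False using fin kb by linarith
    qed
    have lo: "A n > (1 - \<eta>) * real n"
    proof (rule ccontr)
      assume "\<not> ?thesis"
      hence A': "A n \<le> real n - \<eta> * real n" by (simp add: ring_distribs)
      have "real k * (\<eta> / (8 * real n)) = (\<Sum>m\<in>{n-k..<n}. \<eta> / (8 * real n))" using k3 by simp
      also have "\<dots> \<le> (\<Sum>m\<in>{n-k..<n}. - b m)"
      proof (rule sum_mono)
        fix m assume m: "m \<in> {n-k..<n}"
        have "A (m + 1) \<le> A n" using m by (intro monoD[OF mono]) auto
        moreover have "real m + 1 \<ge> real n - real k" using m k3 by auto
        ultimately have ge: "\<eta> * real n / 2 \<le> (real m + 1) - A (m + 1)" using A' k1 n3 by linarith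
        have nn: "0 \<le> (real m + 1) - A (m + 1)" using ge n3 by linarith
        have d: "(real m + 1) * (real m + 2) \<le> 4 * (real n)\<^sup>2" using m k3 by (intro den) auto
        have "0 < (real m + 1) * (real m + 2)" by simp
        from frac_le[OF nn ge this d] have "\<eta> * real n / 2 / (4 * (real n)\<^sup>2) \<le> ((real m + 1) - A (m + 1)) / ((real m + 1) * (real m + 2))"
          .
        also have "\<dots> = - b m" unfolding b_def by (simp add: minus_divide_left)
        finally show "\<eta> / (8 * real n) \<le> - b m" unfolding qq .
      qed
      finally have "real k * (\<eta> / (8 * real n)) \<le> - sum b {n-k..<n}" by (simp only: sum_negf)
      hence "\<eta>\<^sup>2 / 64 \<le> - sum b {n-k..<n}" using kb by linarith
      moreover have "n - k \<ge> N" using k3 n1 by linarith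
      ultimately show False using N[of "n - k" n] by linarith
    qed
    show ?thesis using up lo by (simp add: algebra_simps abs_less_iff)
  qed
  show "\<exists>no. \<forall>n\<ge>no. norm (A n / real n - 1) < r"
  proof (intro exI allI impI)
    fix n assume n: "n \<ge> M"
    hence "n > 0" by (simp add: M_def)
    hence "norm (A n / real n - 1) = \<bar>A n - real n\<bar> / real n" by (simp add: field_simps abs_divide)
    also have "\<dots> < \<eta>" using main[OF n] \<open>n > 0\<close> by (simp add: field_simps)
    finally show "norm (A n / real n - 1) < r" using \<eta> by simp
  qed
qed

text \<open>Partial summation writes the series of (a n - 1) n^(-s) as s times that of E n
  \<open>npow_diff n s\<close>, where E N is the partial sum of a minus N; the linear bound for the
  partial sums gives |E N| <= (C + 1) N. Newman's theorem then yields convergence at s = 1, that is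
  of the sum of E n / (n (n + 1)), and monotonicity turns this into an asymptotic.\<close>

theorem dirichlet_series_tauberian:
  fixes a :: "nat \<Rightarrow> real" and H :: "complex \<Rightarrow> complex" and C :: real
  assumes nonneg: "\<And>n. a n \<ge> 0" and C: "C > 0" and le: "\<And>N. (\<Sum>n=1..N. a n) \<le> C * real N"
    and V: "open V" "{s. Re s \<ge> 1} \<subseteq> V" "H holomorphic_on V"
    and H: "\<And>s. Re s > 1 \<Longrightarrow> (\<lambda>n. of_real (a (Suc n) - 1) * npow (Suc n) s) sums H s"
  shows "(\<lambda>N. (\<Sum>n=1..N. a n) / real N) \<longlonglongrightarrow> 1"
proof -
  define A where "A = (\<lambda>N. \<Sum>n=1..N. a n)"
  define E where "E = (\<lambda>N. A N - real N)"
  have A0: "A N \<ge> 0" for N unfolding A_def by (intro sum_nonneg nonneg)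
  have Ebd: "\<bar>E N\<bar> \<le> (C + 1) * real N" for N
    using A0[of N] le[of N] C unfolding E_def A_def by (simp add: abs_le_iff algebra_simps)
  define u where "u = (\<lambda>n z. of_real (E (Suc n)) * npow_diff (Suc n) (1 + z))"
  define V' where "V' = {z. 1 + z \<in> V} \<inter> {z. 1 + z \<noteq> 0}"
  define F where "F = (\<lambda>z. H (1 + z) / (1 + z))"
  have abel: "(\<Sum>n<N. of_real (a (Suc n) - 1) * npow (Suc n) s) =
      (\<Sum>n<N. of_real (E (Suc n)) * (npow (Suc n) s - npow (Suc (Suc n)) s)) + of_real (E N) * npow (Suc N) s" for N s
    by (induction N) (auto simp: E_def A_def algebra_simps)
  have "(\<lambda>n. u n 0) sums F 0"
  proof (rule newman_tauberian[of "C + 1" u V' F])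
    show "u n holomorphic_on UNIV" for n unfolding u_def by (intro holomorphic_intros)
    show "open V'" unfolding V'_def
    proof (intro open_Int open_Collect_neq continuous_intros)
      have "{z. 1 + z \<in> V} = (\<lambda>z. 1 + z) -` V" by auto
      thus "open {z. 1 + z \<in> V}" by (auto intro!: open_vimage V(1) continuous_intros)
    qed
    show "{z. 0 \<le> Re z} \<subseteq> V'"
    proof
      fix z :: complex assume "z \<in> {z. 0 \<le> Re z}"
      hence "Re (1 + z) \<ge> 1" by simp
      moreover from this have "1 + z \<noteq> 0" by (metis not_one_le_zero zero_complex.simps(1))
      ultimately show "z \<in> V'" using V(2) by (auto simp: V'_def)
    qed
    have "(\<lambda>z. H (1 + z)) holomorphic_on V'"
    proof -
      have "(H \<circ> (\<lambda>z. 1 + z)) holomorphic_on V'"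
        by (rule holomorphic_on_compose_gen[OF _ V(3)]) (auto simp: V'_def intro!: holomorphic_intros)
      thus ?thesis by (simp add: o_def)
    qed
    thus "F holomorphic_on V'" unfolding F_def by (intro holomorphic_intros) (auto simp: V'_def)
    show "norm (u n z) \<le> (C + 1) * (((real n + 1) powr (- Re z) - (real n + 2) powr (- Re z)) / Re z)"
      if "Re z \<noteq> 0" for n z
    proof -
      have "norm (u n z) = \<bar>E (Suc n)\<bar> * norm (npow_diff (Suc n) (1 + z))" by (simp add: u_def norm_mult)
      also have "\<dots> \<le> ((C + 1) * real (Suc n)) * ((((real n + 1) powr (- Re z) - (real n + 2) powr (- Re z)) / Re z) / real (Suc n))"
        using norm_npow_diff_le[of "Suc n" "1 + z"] that C
        by (intro mult_mono Ebd) (auto simp: add_ac)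
      also have "\<dots> = (C + 1) * (((real n + 1) powr (- Re z) - (real n + 2) powr (- Re z)) / Re z)"
        using that by (simp add: divide_simps)
      finally show ?thesis .
    qed
    show "(\<lambda>n. u n z) sums F z" if z: "Re z > 0" for z
    proof -
      define s where "s = 1 + z"
      have s: "Re s > 1" "s \<noteq> 0" using z by (auto simp: s_def complex_eq_iff)
      have "(\<lambda>N. real N * (real N + 1) powr (- Re s)) \<longlonglongrightarrow> 0" using s by real_asymp
      hence "(\<lambda>N. (C + 1) * (real N * (real N + 1) powr (- Re s))) \<longlonglongrightarrow> (C + 1) * 0" by (intro tendsto_intros)
      hence lim0: "(\<lambda>N. (C + 1) * (real N * (real N + 1) powr (- Re s))) \<longlonglongrightarrow> 0" by simp
      have "(\<lambda>N. of_real (E N) * npow (Suc N) s) \<longlonglongrightarrow> 0"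
      proof (rule Lim_null_comparison[OF _ lim0], intro always_eventually allI)
        fix N
        show "norm (of_real (E N) * npow (Suc N) s) \<le> (C + 1) * (real N * (real N + 1) powr (- Re s))"
          using mult_right_mono[OF Ebd[of N], of "(real N + 1) powr (- Re s)"]
          by (simp add: norm_mult norm_npow add_ac mult_ac)
      qed
      from tendsto_diff[OF H[OF s(1), unfolded sums_def abel] this]
      have "(\<lambda>n. of_real (E (Suc n)) * (npow (Suc n) s - npow (Suc (Suc n)) s)) sums H s"
        by (simp add: sums_def)
      hence "(\<lambda>n. of_real (E (Suc n)) * (npow (Suc n) s - npow (Suc (Suc n)) s) / s) sums (H s / s)"
        by (rule sums_divide)
      moreover have "of_real (E (Suc n)) * (npow (Suc n) s - npow (Suc (Suc n)) s) / s = u n z" for n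
        unfolding npow_diff_eq [symmetric] u_def s_def [symmetric] using s by simp
      ultimately show ?thesis by (simp add: F_def s_def)
    qed
  qed (use C in auto)
  hence "summable (\<lambda>n. Re (u n 0))" using sums_Re sums_summable by blast
  moreover have "Re (u n 0) = (A (n + 1) - (real n + 1)) / ((real n + 1) * (real n + 2))" for n
  proof -
    have 1: "npow_diff (Suc n) 1 = npow (Suc n) 1 - npow (Suc (Suc n)) 1"
      by (simp add: npow_diff_def)
    have 2: "npow (Suc n) 1 = of_real (1 / (real n + 1))" "npow (Suc (Suc n)) 1 = of_real (1 / (real n + 2))"
      by (simp_all only: npow_at_1[OF zero_less_Suc] of_nat_Suc add_ac) (simp_all add: add_ac)
    have "u n 0 = of_real (E (Suc n) * (1 / (real n + 1) - 1 / (real n + 2)))"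
      unfolding u_def add_0_right 1 2 of_real_mult of_real_diff ..
    also have "1 / (real n + 1) - 1 / (real n + 2) = 1 / ((real n + 1) * (real n + 2))"
      by (simp add: field_simps)
    finally show ?thesis by (simp add: E_def add_ac)
  qed
  ultimately have "summable (\<lambda>n. (A (n + 1) - (real n + 1)) / ((real n + 1) * (real n + 2)))" by simp
  moreover have "mono A" unfolding A_def by (intro monoI sum_mono2) (auto intro: nonneg)
  ultimately show ?thesis using mono_tauberian[of A] by (simp add: A_def)
qed

section \<open>Dirichlet series and the twisted prime number theorem\<close>

text \<open>Local majorants give locally uniform convergence, so the sum may also be differentiated
  termwise.\<close>

lemma holomorphic_series:
  fixes f :: "nat \<Rightarrow> complex \<Rightarrow> complex"
  assumes S: "open S" and hol: "\<And>n. f n holomorphic_on S"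
    and bd: "\<And>x. x \<in> S \<Longrightarrow> \<exists>d>0. \<exists>h::nat\<Rightarrow>real. summable h \<and> (\<forall>n. \<forall>y\<in>ball x d \<inter> S. norm (f n y) \<le> h n)"
  shows "(\<lambda>s. \<Sum>n. f n s) holomorphic_on S"
    and "\<And>s. s \<in> S \<Longrightarrow> (\<lambda>n. f n s) sums (\<Sum>n. f n s)"
    and "\<And>s. s \<in> S \<Longrightarrow> (\<lambda>n. deriv (f n) s) sums deriv (\<lambda>s. \<Sum>n. f n s) s"
proof -
  have "\<exists>g g'. \<forall>x \<in> S. ((\<lambda>n. f n x) sums g x) \<and> ((\<lambda>n. deriv (f n) x) sums g' x) \<and> (g has_field_derivative g' x) (at x)"
  proof (rule series_and_derivative_comparison_complex[OF S])
    show "(f n has_field_derivative deriv (f n) x) (at x)" if "x \<in> S" for n x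
      using hol S that holomorphic_derivI by blast
    fix x assume x: "x \<in> S"
    obtain d h where dh: "d > 0" "summable h" "\<And>n y. y \<in> ball x d \<inter> S \<Longrightarrow> norm (f n y) \<le> h n"
      using bd[OF x] by metis
    have h0: "h n \<ge> 0" for n
      using dh(3)[of x n] dh(1) x norm_ge_zero order_trans by (metis IntI centre_in_ball)
    show "\<exists>d h. 0 < d \<and> summable h \<and> range h \<subseteq> \<real>\<^sub>\<ge>\<^sub>0 \<and> (\<forall>\<^sub>F n in sequentially. \<forall>y\<in>ball x d \<inter> S. cmod(f n y) \<le> cmod (h n))"
      using dh h0 by (intro exI[of _ d] exI[of _ "\<lambda>n. complex_of_real (h n)"]) (auto simp: summable_of_real)
  qed
  then obtain g g' where g: "\<And>x. x \<in> S \<Longrightarrow> (\<lambda>n. f n x) sums g x"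
    "\<And>x. x \<in> S \<Longrightarrow> (\<lambda>n. deriv (f n) x) sums g' x"
    "\<And>x. x \<in> S \<Longrightarrow> (g has_field_derivative g' x) (at x)" by blast
  have eq: "(\<Sum>n. f n x) = g x" if "x \<in> S" for x using g(1)[OF that] by (simp add: sums_iff)
  show sums: "(\<lambda>n. f n s) sums (\<Sum>n. f n s)" if "s \<in> S" for s using g(1)[OF that] eq[OF that] by simp
  have der: "((\<lambda>s. \<Sum>n. f n s) has_field_derivative g' x) (at x)" if x: "x \<in> S" for x
    by (rule has_field_derivative_transform_within_open[OF g(3)[OF x] S x]) (simp add: eq)
  thus "(\<lambda>s. \<Sum>n. f n s) holomorphic_on S" using S by (auto simp: holomorphic_on_open)
  show "(\<lambda>n. deriv (f n) s) sums deriv (\<lambda>s. \<Sum>n. f n s) s" if "s \<in> S" for s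
    using g(2)[OF that] DERIV_imp_deriv[OF der[OF that]] by simp
qed

section \<open>Absolutely convergent Dirichlet series\<close>

definition ds :: "(nat \<Rightarrow> real) \<Rightarrow> complex \<Rightarrow> complex" where
  "ds f s = (\<Sum>n. of_real (f (Suc n)) * npow (Suc n) s)"

text \<open>One growth class that covers bounded coefficients and von Mangoldt's function and still
  gives absolute convergence for Re s > 1.\<close>

definition log_bounded :: "(nat \<Rightarrow> real) \<Rightarrow> bool" where
  "log_bounded f \<longleftrightarrow> (\<exists>K. \<forall>n>0. \<bar>f n\<bar> \<le> K * (1 + ln (real n)))"

lemma log_boundedI: "(\<And>n. n > 0 \<Longrightarrow> \<bar>f n\<bar> \<le> K * (1 + ln (real n))) \<Longrightarrow> log_bounded f"
  unfolding log_bounded_def by blast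

lemma log_bounded_bounded:
  assumes "\<And>n. \<bar>f n\<bar> \<le> 1"
  shows "log_bounded f"
proof (rule log_boundedI[where K = 1])
  fix n :: nat assume "n > 0"
  hence "ln (real n) \<ge> 0" by simp
  with assms[of n] show "\<bar>f n\<bar> \<le> 1 * (1 + ln (real n))" by simp
qed

lemma log_bounded_mangoldt:
  assumes "\<And>n. \<bar>f n\<bar> \<le> 1"
  shows "log_bounded (\<lambda>n. f n * mangoldt n)"
proof (rule log_boundedI[where K = 1])
  fix n :: nat assume n: "n > 0"
  have "\<bar>f n * mangoldt n\<bar> \<le> 1 * mangoldt n"
    unfolding abs_mult abs_mangoldt by (intro mult_right_mono assms mangoldt_nonneg)
  also have "\<dots> \<le> ln (real n)" using mangoldt_le[OF n] by simp
  finally show "\<bar>f n * mangoldt n\<bar> \<le> 1 * (1 + ln (real n))" by simp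
qed

lemma ds_abs_summable:
  assumes "log_bounded f" "Re s > 1"
  shows "summable (\<lambda>n. norm (of_real (f (Suc n)) * npow (Suc n) s))"
proof -
  obtain K where K: "\<And>n. n > 0 \<Longrightarrow> \<bar>f n\<bar> \<le> K * (1 + ln (real n))"
    using assms(1) by (auto simp: log_bounded_def)
  obtain e where e: "e > 0" "Re s = 1 + 2 * e"
    using assms(2) by (intro that[of "(Re s - 1) / 2"]) (auto simp: field_simps)
  have "summable (\<lambda>n. K * ((1 + ln (real n + 1)) * (real n + 1) powr (- Re s)))"
  proof (intro summable_mult, rule summable_comparison_test_bigo)
    show "summable (\<lambda>n. norm (real n powr (-(1 + e))))"
      using e by (simp add: summable_real_powr_iff)
    show "(\<lambda>n. (1 + ln (real n + 1)) * (real n + 1) powr (- Re s)) \<in> O(\<lambda>n. real n powr (-(1 + e)))"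
      unfolding e(2) using e(1) by real_asymp
  qed
  thus ?thesis
  proof (rule summable_comparison_test'[where N = 0])
    fix n
    have "norm (norm (of_real (f (Suc n)) * npow (Suc n) s)) = \<bar>f (Suc n)\<bar> * (real n + 1) powr (- Re s)"
      by (simp add: norm_mult norm_npow add_ac)
    also have "\<dots> \<le> (K * (1 + ln (real n + 1))) * (real n + 1) powr (- Re s)"
      using K[of "Suc n"] by (intro mult_right_mono) (auto simp: add_ac)
    finally show "norm (norm (of_real (f (Suc n)) * npow (Suc n) s)) \<le> K * ((1 + ln (real n + 1)) * (real n + 1) powr (- Re s))"
      by (simp add: mult_ac)
  qed
qed

lemma ds_sums: "log_bounded f \<Longrightarrow> Re s > 1 \<Longrightarrow> (\<lambda>n. of_real (f (Suc n)) * npow (Suc n) s) sums ds f s"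
  unfolding ds_def by (rule summable_sums, rule summable_norm_cancel, rule ds_abs_summable)

lemma ds_holomorphic:
  assumes "\<And>n. \<bar>f n\<bar> \<le> 1"
  shows "ds f holomorphic_on {s. Re s > 1}"
    and "Re s > 1 \<Longrightarrow> deriv (ds f) s = - ds (\<lambda>n. f n * ln (real n)) s"
proof -
  have op: "open {s. Re s > 1}" by (rule open_halfspace_Re_gt)
  have hol: "(\<lambda>s. of_real (f (Suc n)) * npow (Suc n) s) holomorphic_on {s. Re s > 1}" for n
    by (intro holomorphic_intros)
  have bd: "\<exists>d>0. \<exists>h::nat\<Rightarrow>real. summable h \<and> (\<forall>n. \<forall>y\<in>ball x d \<inter> {s. Re s > 1}. norm (of_real (f (Suc n)) * npow (Suc n) y) \<le> h n)"
    if x: "x \<in> {s. Re s > 1}" for x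
  proof -
    define d where "d = (Re x - 1) / 2"
    define h where "h = (\<lambda>n. (real n + 1) powr (-(1 + d)))"
    have d: "d > 0" using x by (simp add: d_def)
    have "summable h" unfolding h_def using d summable_real_powr_iff[of "-(1+d)"]
      by (subst (asm) summable_Suc_iff [symmetric]) (simp add: add_ac)
    moreover have "norm (of_real (f (Suc n)) * npow (Suc n) y) \<le> h n" if y: "y \<in> ball x d \<inter> {s. Re s > 1}" for n y
    proof -
      have "\<bar>Re (x - y)\<bar> < d" using y abs_Re_le_cmod[of "x - y"] by (auto simp: dist_norm)
      moreover have "Re x = 1 + 2 * d" by (simp add: d_def field_simps)
      ultimately have "Re y \<ge> 1 + d" unfolding minus_complex.simps abs_less_iff by linarith
      hence "(real n + 1) powr (- Re y) \<le> h n" unfolding h_def by (intro powr_mono) auto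
      moreover have "norm (of_real (f (Suc n)) * npow (Suc n) y) \<le> 1 * (real n + 1) powr (- Re y)"
        unfolding norm_mult using assms[of "Suc n"] by (intro mult_mono) (auto simp: norm_npow add_ac)
      ultimately show ?thesis by simp
    qed
    ultimately show ?thesis using d by blast
  qed
  note * = holomorphic_series[OF op hol bd]
  show "ds f holomorphic_on {s. Re s > 1}" using *(1) unfolding ds_def .
  assume s: "Re s > 1"
  have "(\<lambda>n. deriv (\<lambda>s. of_real (f (Suc n)) * npow (Suc n) s) s) sums deriv (ds f) s"
    using *(3)[of s] s unfolding ds_def by simp
  moreover have "deriv (\<lambda>s. of_real (f (Suc n)) * npow (Suc n) s) s = - (of_real (f (Suc n) * ln (real (Suc n))) * npow (Suc n) s)" for n
    unfolding npow_def by (rule DERIV_imp_deriv) (auto intro!: derivative_eq_intros)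
  ultimately have "(\<lambda>n. - (of_real (f (Suc n) * ln (real (Suc n))) * npow (Suc n) s)) sums deriv (ds f) s"
    by simp
  from sums_minus[OF this] have "(\<lambda>n. of_real (f (Suc n) * ln (real (Suc n))) * npow (Suc n) s) sums (- deriv (ds f) s)"
    by simp
  thus "deriv (ds f) s = - ds (\<lambda>n. f n * ln (real n)) s" unfolding ds_def by (simp add: sums_iff)
qed

lemma has_sum_divisor_pairs:
  fixes F :: "nat \<times> nat \<Rightarrow> 'a :: banach"
  assumes "(F has_sum S) ({1..} \<times> {1..})"
  shows "((\<lambda>n. \<Sum>d | d dvd n. F (d, n div d)) has_sum S) {1..}"
proof (rule has_sum_SigmaD[where B = "\<lambda>n. {d. d dvd n}" and f = "\<lambda>(n, d). F (d, n div d)"])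
  show "((\<lambda>(n, d). F (d, n div d)) has_sum S) (SIGMA n:{1..}. {d. d dvd n})"
    using has_sum_reindex_bij_betw[OF bij_betw_divisor_pairs, of F S] assms by (simp add: case_prod_unfold)
  show "((\<lambda>d. case (n, d) of (n, d) \<Rightarrow> F (d, n div d)) has_sum (\<Sum>d | d dvd n. F (d, n div d))) {d. d dvd n}"
    if "n \<in> {1..}" for n
    using that by (intro has_sum_finiteI) (auto simp: finite_divisors_nat)
qed

lemma bij_betw_Suc_atLeast_1: "bij_betw Suc UNIV {1..}"
  by (rule bij_betwI[where g = "\<lambda>n. n - 1"]) auto

lemma has_sum_imp_sums_Suc:
  fixes f :: "nat \<Rightarrow> 'a :: real_normed_vector"
  shows "(f has_sum S) {1..} \<Longrightarrow> (\<lambda>n. f (Suc n)) sums S"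
  using has_sum_reindex_bij_betw[OF bij_betw_Suc_atLeast_1, of f S] has_sum_imp_sums by blast

lemma norm_summable_imp_has_sum_Suc:
  fixes f :: "nat \<Rightarrow> 'a :: banach"
  assumes "summable (\<lambda>n. norm (f (Suc n)))"
  shows "(f has_sum (\<Sum>n. f (Suc n))) {1..}"
  using norm_summable_imp_has_sum[OF assms summable_sums[OF summable_norm_cancel[OF assms]]]
    has_sum_reindex_bij_betw[OF bij_betw_Suc_atLeast_1, of f] by blast

lemma has_sum_product_pairs:
  fixes f g :: "nat \<Rightarrow> complex"
  assumes "summable (\<lambda>n. norm (f (Suc n)))" "summable (\<lambda>n. norm (g (Suc n)))"
  shows "((\<lambda>(d, e). f d * g e) has_sum ((\<Sum>n. f (Suc n)) * (\<Sum>n. g (Suc n)))) ({1..} \<times> {1..})"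
proof (rule has_sum_SigmaI)
  note F = norm_summable_imp_has_sum_Suc[OF assms(1)]
  note G = norm_summable_imp_has_sum_Suc[OF assms(2)]
  show "((\<lambda>e. case (d, e) of (d, e) \<Rightarrow> f d * g e) has_sum (f d * (\<Sum>n. g (Suc n)))) {1..}" for d
    using has_sum_cmult_right[OF G, of "f d"] by simp
  show "((\<lambda>d. f d * (\<Sum>n. g (Suc n))) has_sum ((\<Sum>n. f (Suc n)) * (\<Sum>n. g (Suc n)))) {1..}"
    by (rule has_sum_cmult_left[OF F])
  have f': "((\<lambda>n. norm (f n)) has_sum (\<Sum>n. norm (f (Suc n)))) {1..}"
    using norm_summable_imp_has_sum_Suc[of "\<lambda>n. norm (f n)"] assms(1) by simp
  have g': "((\<lambda>n. norm (g n)) has_sum (\<Sum>n. norm (g (Suc n)))) {1..}"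
    using norm_summable_imp_has_sum_Suc[of "\<lambda>n. norm (g n)"] assms(2) by simp
  have "(\<lambda>x. norm (case x of (d, e) \<Rightarrow> f d * g e)) summable_on ({1..} \<times> {1..})"
  proof (rule summable_on_SigmaI)
    show "((\<lambda>e. norm (case (d, e) of (d, e) \<Rightarrow> f d * g e)) has_sum (norm (f d) * (\<Sum>n. norm (g (Suc n))))) {1..}" for d
      using has_sum_cmult_right[OF g', of "norm (f d)"] by (simp add: norm_mult)
    show "(\<lambda>d. norm (f d) * (\<Sum>n. norm (g (Suc n)))) summable_on {1..}"
      using has_sum_cmult_left[OF f'] by (auto simp: summable_on_def)
  qed auto
  thus "(\<lambda>(d, e). f d * g e) summable_on ({1..} \<times> {1..})" by (rule abs_summable_summable)
qed

text \<open>Absolute convergence allows the double series to be regrouped by the product n = d e;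
  convergence of the series of the convolution comes out of this as well.\<close>

lemma ds_mult:
  assumes "log_bounded f" "log_bounded g" "Re s > 1"
  shows "ds f s * ds g s = ds (dconv f g) s"
proof -
  have "((\<lambda>(d, e). (of_real (f d) * npow d s) * (of_real (g e) * npow e s)) has_sum (ds f s * ds g s)) ({1..} \<times> {1..})"
    using has_sum_product_pairs[of "\<lambda>d. of_real (f d) * npow d s" "\<lambda>d. of_real (g d) * npow d s"]
      ds_abs_summable assms by (simp add: ds_def)
  from has_sum_imp_sums_Suc[OF has_sum_divisor_pairs[OF this]]
  have "(\<lambda>n. \<Sum>d | d dvd Suc n. (of_real (f d) * npow d s) * (of_real (g (Suc n div d)) * npow (Suc n div d) s))
      sums (ds f s * ds g s)" by simp
  moreover have "(\<Sum>d | d dvd Suc n. (of_real (f d) * npow d s) * (of_real (g (Suc n div d)) * npow (Suc n div d) s)) =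
      of_real (dconv f g (Suc n)) * npow (Suc n) s" for n
  proof -
    have "npow d s * npow (Suc n div d) s = npow (Suc n) s" if "d dvd Suc n" for d
    proof -
      have "d > 0" "Suc n div d > 0" using that by (auto intro!: Nat.gr0I simp: dvd_div_eq_0_iff)
      from npow_mult[OF this, of s] that show ?thesis by simp
    qed
    thus ?thesis unfolding dconv_def of_real_sum sum_distrib_right
      by (intro sum.cong refl) (simp add: mult_ac)
  qed
  ultimately show ?thesis unfolding ds_def by (simp add: sums_iff)
qed

lemma ds_cong: "(\<And>n. n > 0 \<Longrightarrow> f n = g n) \<Longrightarrow> ds f s = ds g s"
  unfolding ds_def by simp

lemma ds_unit: "ds (\<lambda>n. if n = 1 then 1 else 0) s = 1"
proof -
  have "(\<lambda>n. of_real (if Suc n = 1 then 1 else 0) * npow (Suc n) s) sums (\<Sum>n\<in>{0}. of_real (if Suc n = 1 then 1 else 0) * npow (Suc n) s)"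
    by (rule sums_finite) auto
  thus ?thesis by (simp add: ds_def sums_iff)
qed

context real_cm
begin

text \<open>Moebius inversion exhibits an inverse, the series with coefficients
  \<open>moebius d * chi d\<close>.\<close>

lemma ds_chi_nonzero:
  assumes "Re s > 1"
  shows "ds chi s \<noteq> 0"
proof -
  have 1: "log_bounded (\<lambda>d. moebius d * chi d)"
    using abs_moebius_le abs_chi_le by (intro log_bounded_bounded) (simp add: abs_mult mult_le_one)
  have "ds (\<lambda>d. moebius d * chi d) s * ds chi s = ds (dconv (\<lambda>d. moebius d * chi d) chi) s"
    by (rule ds_mult[OF 1 log_bounded_bounded[OF abs_chi_le] assms])
  also have "\<dots> = 1"
    using ds_cong[OF dconv_moebius_chi] ds_unit by simp
  finally show ?thesis by auto
qed

text \<open>The identity that chi Lambda convolved with chi is chi log, with the logarithm produced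
  by termwise differentiation.\<close>

lemma ds_chi_mangoldt:
  assumes "Re s > 1"
  shows "ds (\<lambda>n. chi n * mangoldt n) s = - deriv (ds chi) s / ds chi s"
proof -
  have "ds (\<lambda>d. chi d * mangoldt d) s * ds chi s = ds (dconv (\<lambda>d. chi d * mangoldt d) chi) s"
    by (rule ds_mult[OF log_bounded_mangoldt[OF abs_chi_le] log_bounded_bounded[OF abs_chi_le] assms])
  also have "\<dots> = ds (\<lambda>n. chi n * ln (real n)) s" by (rule ds_cong) (rule dconv_mangoldt_chi)
  also have "\<dots> = - deriv (ds chi) s" using ds_holomorphic(2)[OF abs_chi_le assms] by simp
  finally show ?thesis using ds_chi_nonzero[OF assms] by (simp add: field_simps)
qed

end

section \<open>Continuation of zeta and of L-functions to Re s > 0\<close>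

lemma ln_Suc_diff_le: "n > 0 \<Longrightarrow> ln (real n + 1) - ln (real n) \<le> 1 / real n"
  using ln_diff_le[of "real n + 1" "real n"] by simp

lemma npow_interval_integral_bound:
  fixes f :: "real \<Rightarrow> complex"
  assumes "n > 0" "(f has_integral I) {ln (real n)..ln (real n + 1)}" "B \<ge> 0"
    and "\<And>u. u \<in> {ln (real n)..ln (real n + 1)} \<Longrightarrow> norm (f u) \<le> B"
  shows "norm I \<le> B / real n"
proof -
  have le: "ln (real n) \<le> ln (real n + 1)" using assms(1) by simp
  have "norm I \<le> B * measure lborel {ln (real n)..ln (real n + 1)}"
    using has_integral_bound[of B f I "ln (real n)" "ln (real n + 1)"] assms by (simp add: cbox_interval)
  also have "measure lborel {ln (real n)..ln (real n + 1)} = ln (real n + 1) - ln (real n)" using le by simp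
  also have "B * (ln (real n + 1) - ln (real n)) \<le> B * (1 / real n)"
    using assms by (intro mult_left_mono ln_Suc_diff_le)
  finally show ?thesis by simp
qed

lemma norm_exp_le_npow:
  assumes "n > 0" "Re s \<ge> 0" "u \<ge> ln (real n)"
  shows "norm (exp (- s * of_real u)) \<le> real n powr (- Re s)"
  using assms by (simp add: powr_def mult_left_mono)

lemma norm_npow_diff_le':
  assumes "n > 0" "Re s \<ge> 0"
  shows "norm (npow_diff n s) \<le> real n powr (- Re s) / real n"
  by (rule npow_interval_integral_bound[OF assms(1) npow_diff_has_integral[OF assms(1)]])
     (use norm_exp_le_npow assms in auto)

text \<open>\<open>npow_diff n (s - 1)\<close> is the integral of x^(-s) over [n, n + 1]. With x =
  e^u the difference is the integral of (n^(-s) - e^(-s u)) e^u; the mean value inequality bounds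
  the first factor by |s| n^(-Re s) / n, and e^u is at most 2 n. The gain of 1/n gives convergence
  down to Re s > 0.\<close>

lemma norm_zeta_term_le:
  assumes n: "n > 0" and s: "Re s \<ge> 0"
  shows "norm (npow n s - npow_diff n (s - 1)) \<le> 2 * norm s * real n powr (- Re s) / real n"
proof (rule npow_interval_integral_bound[OF n])
  let ?I = "{ln (real n)..ln (real n + 1)}"
  have "((\<lambda>u. exp (- (-1) * of_real u) :: complex) has_integral npow_diff n (-1)) ?I"
    by (rule npow_diff_has_integral[OF n])
  moreover have "npow_diff n (-1) = 1"
    using n by (simp add: npow_diff_def npow_def exp_of_real)
  ultimately have "((\<lambda>u. exp (of_real u) :: complex) has_integral 1) ?I" by simp
  from has_integral_diff[OF has_integral_mult_right[OF this, of "npow n s"] npow_diff_has_integral[OF n, of "s - 1"]]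
  have "((\<lambda>u. npow n s * exp (of_real u) - exp (- (s - 1) * of_real u)) has_integral (npow n s - npow_diff n (s - 1))) ?I"
    by simp
  moreover have "npow n s * exp (of_real u) - exp (- (s - 1) * of_real u) = (npow n s - exp (- s * of_real u)) * exp (of_real u)" for u :: real
    by (simp add: algebra_simps exp_diff exp_add exp_minus divide_inverse)
  ultimately show "((\<lambda>u. (npow n s - exp (- s * of_real u)) * exp (of_real u)) has_integral (npow n s - npow_diff n (s - 1))) ?I"
    by simp
next
  fix u assume u: "u \<in> {ln (real n)..ln (real n + 1)}"
  let ?a = "complex_of_real (ln (real n))" and ?b = "complex_of_real u"
  have "norm (exp (- s * ?a) - exp (- s * ?b)) \<le> (norm s * real n powr (- Re s)) * norm (?a - ?b)"
  proof (rule field_differentiable_bound[where f = "\<lambda>z. exp (- s * z)" and S = "closed_segment ?a ?b" and f' = "\<lambda>z. - s * exp (- s * z)"])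
    show "((\<lambda>z. exp (- s * z)) has_field_derivative - s * exp (- s * z)) (at z within closed_segment ?a ?b)" for z
      by (auto intro!: derivative_eq_intros)
    fix z assume "z \<in> closed_segment ?a ?b"
    then obtain v where v: "z = of_real v" "v \<in> closed_segment (ln (real n)) u"
      by (auto simp: closed_segment_of_real)
    hence "v \<ge> ln (real n)" using u by (auto simp: closed_segment_eq_real_ivl)
    from norm_exp_le_npow[OF n s this] show "norm (- s * exp (- s * z)) \<le> norm s * real n powr (- Re s)"
      unfolding norm_mult v(1) norm_minus_cancel by (intro mult_left_mono) auto
  qed auto
  also have "norm (?a - ?b) = u - ln (real n)" using u by (simp flip: of_real_diff)
  also have "\<dots> \<le> 1 / real n" using ln_Suc_diff_le[OF n] u by auto
  finally have 1: "norm (npow n s - exp (- s * ?b)) \<le> norm s * real n powr (- Re s) * (1 / real n)"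
    unfolding npow_def by (simp add: mult_left_mono)
  have "exp u \<le> exp (ln (real n + 1))" using u by (subst exp_le_cancel_iff) auto
  also have "\<dots> = real n + 1" by simp
  also have "\<dots> \<le> 2 * real n" using n by simp
  finally have 2: "exp u \<le> 2 * real n" .
  have "norm ((npow n s - exp (- s * ?b)) * exp ?b) = norm (npow n s - exp (- s * ?b)) * exp u"
    by (simp add: norm_mult)
  also have "\<dots> \<le> (norm s * real n powr (- Re s) * (1 / real n)) * (2 * real n)"
    by (intro mult_mono 1 2) auto
  also have "\<dots> = 2 * norm s * real n powr (- Re s)" using n by simp
  finally show "norm ((npow n s - exp (- s * ?b)) * exp ?b) \<le> 2 * norm s * real n powr (- Re s)" .
qed auto

lemma holomorphic_series_right_half_plane:
  fixes f :: "nat \<Rightarrow> complex \<Rightarrow> complex"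
  assumes hol: "\<And>n. f n holomorphic_on UNIV" and C: "C \<ge> 0"
    and le: "\<And>n s. Re s > 0 \<Longrightarrow> norm (f n s) \<le> C * norm s * (real n + 1) powr (- Re s) / (real n + 1)"
  shows "(\<lambda>s. \<Sum>n. f n s) holomorphic_on {s. Re s > 0}"
    and "Re s > 0 \<Longrightarrow> (\<lambda>n. f n s) sums (\<Sum>n. f n s)"
proof -
  have bd: "\<exists>d>0. \<exists>h::nat\<Rightarrow>real. summable h \<and> (\<forall>n. \<forall>y\<in>ball x d \<inter> {s. Re s > 0}. norm (f n y) \<le> h n)"
    if x: "x \<in> {s. Re s > 0}" for x
  proof -
    define d where "d = Re x / 2"
    define h where "h = (\<lambda>n. C * (norm x + d) * (real n + 1) powr (-(1 + d)))"
    have d: "d > 0" "Re x = 2 * d" using x by (auto simp: d_def)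
    have "summable (\<lambda>n. (real n + 1) powr (-(1 + d)))" using d summable_real_powr_iff[of "-(1+d)"]
      by (subst (asm) summable_Suc_iff [symmetric]) (simp add: add_ac)
    hence "summable h" unfolding h_def by (rule summable_mult)
    moreover have "norm (f n y) \<le> h n" if y: "y \<in> ball x d \<inter> {s. Re s > 0}" for n y
    proof -
      have yd: "norm (x - y) < d" using y by (auto simp: dist_norm)
      have "\<bar>Re (x - y)\<bar> < d" using yd abs_Re_le_cmod[of "x - y"] by linarith
      hence Rey: "Re y \<ge> d" using d unfolding minus_complex.simps abs_less_iff by linarith
      have ny: "norm y \<le> norm x + d" using yd norm_triangle_ineq2[of y x] by (simp add: norm_minus_commute)
      have "norm (f n y) \<le> C * norm y * ((real n + 1) powr (- Re y) / (real n + 1))"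
        using le[of y n] y by simp
      also have "(real n + 1) powr (- Re y) / (real n + 1) = (real n + 1) powr (- Re y - 1)"
        by (simp add: powr_diff)
      also have "C * norm y * (real n + 1) powr (- Re y - 1) \<le> h n"
        unfolding h_def using C d Rey ny by (intro mult_mono powr_mono) auto
      finally show ?thesis .
    qed
    ultimately show ?thesis using d by blast
  qed
  have hol': "f n holomorphic_on {s. Re s > 0}" for n using hol holomorphic_on_subset by blast
  note * = holomorphic_series[OF open_halfspace_Re_gt hol' bd]
  show "(\<lambda>s. \<Sum>n. f n s) holomorphic_on {s. Re s > 0}" by (rule *(1))
  show "(\<lambda>n. f n s) sums (\<Sum>n. f n s)" if "Re s > 0" using *(2)[of s] that by simp
qed

definition one_char :: "nat \<Rightarrow> real" where "one_char n = (if n = 0 then 0 else 1)"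

interpretation one_char: real_cm one_char
  by unfold_locales (auto simp: one_char_def)

text \<open>This is (s - 1) zeta(s): for Re s > 1 the series of
  \<open>npow_diff (Suc n) (s - 1)\<close> telescopes to 1 / (s - 1), and the series of differences
  that is left converges for Re s > 0.\<close>

definition zeta_reg :: "complex \<Rightarrow> complex" where
  "zeta_reg s = 1 + (s - 1) * (\<Sum>n. npow (Suc n) s - npow_diff (Suc n) (s - 1))"

lemma zeta_reg_1 [simp]: "zeta_reg 1 = 1"
  by (simp add: zeta_reg_def)

lemma zeta_series:
  "(\<lambda>s. \<Sum>n. npow (Suc n) s - npow_diff (Suc n) (s - 1)) holomorphic_on {s. Re s > 0}"
  "Re s > 0 \<Longrightarrow> (\<lambda>n. npow (Suc n) s - npow_diff (Suc n) (s - 1)) sums (\<Sum>n. npow (Suc n) s - npow_diff (Suc n) (s - 1))"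
proof -
  have 1: "(\<lambda>s. npow (Suc n) s - npow_diff (Suc n) (s - 1)) holomorphic_on UNIV" for n
    by (intro holomorphic_intros)
  have 2: "norm (npow (Suc n) s - npow_diff (Suc n) (s - 1)) \<le> 2 * norm s * (real n + 1) powr (- Re s) / (real n + 1)"
    if "Re s > 0" for n s
    using norm_zeta_term_le[of "Suc n" s] that by (simp add: add_ac)
  note * = holomorphic_series_right_half_plane[OF 1 _ 2, simplified]
  show "(\<lambda>s. \<Sum>n. npow (Suc n) s - npow_diff (Suc n) (s - 1)) holomorphic_on {s. Re s > 0}" by (rule *(1))
  show "Re s > 0 \<Longrightarrow> (\<lambda>n. npow (Suc n) s - npow_diff (Suc n) (s - 1)) sums (\<Sum>n. npow (Suc n) s - npow_diff (Suc n) (s - 1))"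
    by (rule *(2))
qed

lemma zeta_reg_holomorphic: "zeta_reg holomorphic_on {s. Re s > 0}"
  unfolding zeta_reg_def by (intro holomorphic_intros zeta_series(1))

lemma npow_tendsto_0:
  assumes "Re s > 0"
  shows "(\<lambda>N. npow (Suc N) s) \<longlonglongrightarrow> 0"
proof (rule tendsto_norm_zero_cancel)
  have "(\<lambda>N. (real N + 1) powr (- Re s)) \<longlonglongrightarrow> 0" using assms by real_asymp
  thus "(\<lambda>N. norm (npow (Suc N) s)) \<longlonglongrightarrow> 0" by (simp add: norm_npow add_ac)
qed

lemma zeta_reg_eq:
  assumes "Re s > 1"
  shows "ds one_char s = zeta_reg s / (s - 1)"
proof -
  have s1: "s \<noteq> 1" using assms by auto
  have lim: "(\<lambda>n. npow (Suc n) (s - 1)) \<longlonglongrightarrow> 0" by (rule npow_tendsto_0) (use assms in simp)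
  have "(\<lambda>n. npow (Suc n) (s - 1) - npow (Suc (Suc n)) (s - 1)) sums (npow (Suc 0) (s - 1) - 0)"
    by (rule telescope_sums'[OF lim])
  hence "(\<lambda>n. (s - 1) * npow_diff (Suc n) (s - 1)) sums 1"
    by (simp only: npow_diff_eq) simp
  moreover have "(\<lambda>n. (s - 1) * (npow (Suc n) s - npow_diff (Suc n) (s - 1))) sums
      ((s - 1) * (\<Sum>n. npow (Suc n) s - npow_diff (Suc n) (s - 1)))"
    by (intro sums_mult zeta_series(2)) (use assms in auto)
  ultimately have "(\<lambda>n. (s - 1) * npow_diff (Suc n) (s - 1) + (s - 1) * (npow (Suc n) s - npow_diff (Suc n) (s - 1))) sums zeta_reg s"
    unfolding zeta_reg_def by (rule sums_add)
  moreover have "(s - 1) * npow_diff (Suc n) (s - 1) + (s - 1) * (npow (Suc n) s - npow_diff (Suc n) (s - 1)) = (s - 1) * npow (Suc n) s" for n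
    by (simp add: algebra_simps)
  ultimately have "(\<lambda>n. (s - 1) * npow (Suc n) s / (s - 1)) sums (zeta_reg s / (s - 1))"
    by (intro sums_divide) simp
  hence "(\<lambda>n. npow (Suc n) s) sums (zeta_reg s / (s - 1))" using s1 by simp
  thus ?thesis by (simp add: ds_def one_char_def sums_iff)
qed

lemma zeta_reg_nonzero: "Re s > 1 \<Longrightarrow> zeta_reg s \<noteq> 0"
  using one_char.ds_chi_nonzero[of s] zeta_reg_eq[of s] by auto

lemma ds_mangoldt:
  assumes "Re s > 1"
  shows "ds mangoldt s = 1 / (s - 1) - deriv zeta_reg s / zeta_reg s"
proof -
  have s1: "s \<noteq> 1" "s - 1 \<noteq> 0" using assms by auto
  have op: "open {s. Re s > 1}" by (rule open_halfspace_Re_gt)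
  have "(zeta_reg has_field_derivative deriv zeta_reg s) (at s)"
    by (rule holomorphic_derivI[OF zeta_reg_holomorphic]) (use assms in \<open>auto simp: open_halfspace_Re_gt\<close>)
  hence "((\<lambda>s. zeta_reg s / (s - 1)) has_field_derivative (deriv zeta_reg s * (s - 1) - zeta_reg s) / (s - 1)^2) (at s)"
    using s1 by (auto intro!: derivative_eq_intros simp: power2_eq_square)
  hence "(ds one_char has_field_derivative (deriv zeta_reg s * (s - 1) - zeta_reg s) / (s - 1)^2) (at s)"
    by (rule has_field_derivative_transform_within_open[OF _ op]) (use assms zeta_reg_eq in auto)
  hence d: "deriv (ds one_char) s = (deriv zeta_reg s * (s - 1) - zeta_reg s) / (s - 1)^2" by (rule DERIV_imp_deriv)
  have gen: "- ((b * w - a) / w^2) / (a / w) = 1 / w - b / a" if "w \<noteq> 0" "a \<noteq> 0" for a b w :: complex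
    using that by (simp add: field_simps power2_eq_square)
  have "ds mangoldt s = ds (\<lambda>n. one_char n * mangoldt n) s" by (rule ds_cong) (simp add: one_char_def)
  also have "\<dots> = - deriv (ds one_char) s / ds one_char s" by (rule one_char.ds_chi_mangoldt[OF assms])
  also have "\<dots> = 1 / (s - 1) - deriv zeta_reg s / zeta_reg s"
    unfolding d zeta_reg_eq[OF assms] by (rule gen) (use s1 zeta_reg_nonzero[OF assms] in auto)
  finally show ?thesis .
qed

text \<open>Summation by parts: the differences of the decreasing weights telescope, together with
  the boundary term, to b 1.\<close>

lemma abel_sum_bound:
  fixes c b :: "nat \<Rightarrow> real"
  assumes X: "\<And>N. \<bar>\<Sum>n=1..N. c n\<bar> \<le> q"
    and anti: "\<And>n. n \<ge> 1 \<Longrightarrow> b (Suc n) \<le> b n" and nn: "\<And>n. n \<ge> 1 \<Longrightarrow> b n \<ge> 0"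
  shows "\<bar>\<Sum>n<N. c (Suc n) * b (Suc n)\<bar> \<le> q * b 1"
proof -
  define A where "A = (\<lambda>N. \<Sum>n=1..N. c n)"
  have XA: "\<bar>A n\<bar> \<le> q" for n using X by (simp add: A_def)
  have q0: "q \<ge> 0" using XA[of 0] by linarith
  have "(\<Sum>n<N. c (Suc n) * b (Suc n)) = (\<Sum>n<N. A (Suc n) * (b (Suc n) - b (Suc (Suc n)))) + A N * b (Suc N)"
    by (induction N) (auto simp: A_def algebra_simps)
  also have "\<bar>\<dots>\<bar> \<le> (\<Sum>n<N. \<bar>A (Suc n) * (b (Suc n) - b (Suc (Suc n)))\<bar>) + \<bar>A N * b (Suc N)\<bar>"
    by (intro order.trans[OF abs_triangle_ineq] add_right_mono sum_abs)
  also have "\<dots> \<le> (\<Sum>n<N. q * (b (Suc n) - b (Suc (Suc n)))) + q * b (Suc N)"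
    unfolding abs_mult using anti nn q0 by (intro add_mono sum_mono mult_mono XA) auto
  also have "\<dots> = q * ((\<Sum>n<N. b (Suc n) - b (Suc (Suc n))) + b (Suc N))"
    by (simp add: sum_distrib_left algebra_simps)
  also have "(\<Sum>n<N. b (Suc n) - b (Suc (Suc n))) = b 1 - b (Suc N)"
    using sum_lessThan_telescope'[of "\<lambda>n. b (Suc n)" N] by simp
  finally show ?thesis by simp
qed

text \<open>q is a bound for the partial sums and not a modulus; it is the form in which partial
  summation takes its input. For \<open>jac n\<close> with n not a square it is 8 n.\<close>

locale quad_char = real_cm +
  fixes q :: real
  assumes partial_sums: "\<bar>\<Sum>n=1..N. chi n\<bar> \<le> q"
begin

text \<open>Partial summation replaces the terms by (chi 1 + ... + chi n) s
  \<open>npow_diff n s\<close>, which is O(q |s| n^(-Re s - 1)) and hence summable for Re s >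
  0.\<close>

lemma ds_chi_series:
  "ds chi holomorphic_on {s. Re s > 0}"
  "Re s > 0 \<Longrightarrow> (\<lambda>n. of_real (chi (Suc n)) * npow (Suc n) s) sums ds chi s"
proof -
  define A where "A = (\<lambda>N. \<Sum>n=1..N. chi n)"
  have XA: "\<bar>A n\<bar> \<le> q" for n using partial_sums by (simp add: A_def)
  have q0: "q \<ge> 0" using partial_sums[of 0] by simp
  define f where "f = (\<lambda>n s. of_real (A (Suc n)) * (s * npow_diff (Suc n) s))"
  have 1: "f n holomorphic_on UNIV" for n unfolding f_def by (intro holomorphic_intros)
  have 2: "norm (f n s) \<le> q * norm s * (real n + 1) powr (- Re s) / (real n + 1)" if "Re s > 0" for n s
  proof -
    have "norm (f n s) = \<bar>A (Suc n)\<bar> * (norm s * norm (npow_diff (Suc n) s))" by (simp add: f_def norm_mult)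
    also have "\<dots> \<le> q * (norm s * ((real n + 1) powr (- Re s) / (real n + 1)))"
      using norm_npow_diff_le'[of "Suc n" s] that partial_sums[of "Suc n"] q0 unfolding A_def
      by (intro mult_mono mult_left_mono) (auto simp: add_ac)
    finally show ?thesis by (simp add: mult_ac)
  qed
  have *: "(\<lambda>s. \<Sum>n. f n s) holomorphic_on {s. Re s > 0}"
      "\<And>s. Re s > 0 \<Longrightarrow> (\<lambda>n. f n s) sums (\<Sum>n. f n s)"
    by (rule holomorphic_series_right_half_plane[OF 1 q0 2]; assumption)+
  have abel: "(\<Sum>n<N. of_real (chi (Suc n)) * npow (Suc n) s) = (\<Sum>n<N. f n s) + of_real (A N) * npow (Suc N) s" for N s
    by (induction N) (auto simp: f_def npow_diff_eq A_def algebra_simps)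
  have S: "(\<lambda>n. of_real (chi (Suc n)) * npow (Suc n) s) sums (\<Sum>n. f n s)" if s: "Re s > 0" for s
  proof -
    have "(\<lambda>N. of_real (A N) * npow (Suc N) s) \<longlonglongrightarrow> 0"
    proof (rule Lim_null_comparison)
      have "(\<lambda>N. q * norm (npow (Suc N) s)) \<longlonglongrightarrow> q * norm (0 :: complex)"
        by (intro tendsto_intros npow_tendsto_0[OF s])
      thus "(\<lambda>N. q * norm (npow (Suc N) s)) \<longlonglongrightarrow> 0" by simp
      show "\<forall>\<^sub>F N in sequentially. norm (of_real (A N) * npow (Suc N) s) \<le> q * norm (npow (Suc N) s)"
        by (intro always_eventually allI) (simp add: norm_mult mult_right_mono XA)
    qed
    from tendsto_add[OF *(2)[OF s, unfolded sums_def] this] show ?thesis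
      by (simp add: sums_def abel)
  qed
  have eq: "ds chi s = (\<Sum>n. f n s)" if "Re s > 0" for s using S[OF that] by (simp add: ds_def sums_iff)
  show "ds chi holomorphic_on {s. Re s > 0}"
    by (rule holomorphic_transform[OF *(1)]) (simp add: eq)
  show "(\<lambda>n. of_real (chi (Suc n)) * npow (Suc n) s) sums ds chi s" if "Re s > 0"
    using S[OF that] eq[OF that] by simp
qed

end

text \<open>With S_n = 1 + x + ... + x^(n-1) the claim reduces to n (n + 1) x^n <= S_n S_(n+1). This
  follows from S_n >= n y^(n-1) with y = sqrt x, by pairing x^i with x^(n-1-i) in the
  arithmetic-geometric mean inequality. The terms are the weights of Monsky's argument.\<close>

lemma power_div_one_minus_decreasing:
  fixes x :: real
  assumes x: "0 < x" "x < 1" and n: "n \<ge> 1"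
  shows "1 / (real (Suc n) * (1 - x)) - x ^ Suc n / (1 - x ^ Suc n) \<le> 1 / (real n * (1 - x)) - x ^ n / (1 - x ^ n)"
proof -
  define y where "y = sqrt x"
  have y: "y > 0" "y < 1" "y ^ 2 = x" using x by (auto simp: y_def)
  define S where "S = (\<lambda>n. \<Sum>i<n. x ^ i)"
  have S_ge: "S n \<ge> real n * y ^ (n - 1)" for n
  proof -
    have "2 * S n = S n + (\<Sum>i<n. x ^ (n - Suc i))"
      unfolding S_def by (subst sum.nat_diff_reindex) simp
    also have "\<dots> = (\<Sum>i<n. x ^ i + x ^ (n - Suc i))" by (simp add: S_def sum.distrib)
    also have "\<dots> \<ge> (\<Sum>i<n. 2 * y ^ (n - 1))"
    proof (rule sum_mono)
      fix i assume i: "i \<in> {..<n}"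
      have "0 \<le> (y ^ i - y ^ (n - Suc i))\<^sup>2" by simp
      also have "\<dots> = x ^ i + x ^ (n - Suc i) - 2 * (y ^ i * y ^ (n - Suc i))"
        by (simp add: power2_diff y(3) [symmetric] power_mult [symmetric] mult.commute)
      also have "y ^ i * y ^ (n - Suc i) = y ^ (n - 1)" using i by (simp flip: power_add)
      finally show "2 * y ^ (n - 1) \<le> x ^ i + x ^ (n - Suc i)" by simp
    qed
    finally show ?thesis by simp
  qed
  have S1: "1 - x ^ n = (1 - x) * S n" for n unfolding S_def by (rule one_diff_power_eq)
  have Spos: "S n > 0" "S (Suc n) > 0"
    using S_ge[of n] S_ge[of "Suc n"] n y by (auto intro: less_le_trans[rotated])
  have prod: "real n * real (Suc n) * x ^ n \<le> S n * S (Suc n)"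
  proof -
    have "x ^ n \<le> y ^ (n - 1) * y ^ n"
    proof -
      have "x ^ n = y ^ (2 * n)" by (simp add: y(3) [symmetric] power_mult)
      also have "\<dots> \<le> y ^ (n - 1 + n)" using y n by (intro power_decreasing) auto
      finally show ?thesis by (simp add: power_add)
    qed
    hence "real n * real (Suc n) * x ^ n \<le> real n * real (Suc n) * (y ^ (n - 1) * y ^ n)"
      by (intro mult_left_mono) auto
    also have "\<dots> = (real n * y ^ (n - 1)) * (real (Suc n) * y ^ (Suc n - 1))" by simp
    also have "\<dots> \<le> S n * S (Suc n)" using y Spos by (intro mult_mono S_ge) auto
    finally show ?thesis .
  qed
  have "x ^ n / S n - x ^ Suc n / S (Suc n) = x ^ n * (S (Suc n) - x * S n) / (S n * S (Suc n))"
    using Spos by (simp add: field_simps)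
  also have "S (Suc n) - x * S n = 1"
    unfolding S_def by (simp only: sum.lessThan_Suc_shift sum_distrib_left) simp
  also have "x ^ n * 1 / (S n * S (Suc n)) \<le> 1 / (real n * real (Suc n))"
    using prod Spos n by (simp add: divide_simps mult_ac)
  also have "\<dots> = 1 / real n - 1 / real (Suc n)" using n by (simp add: field_simps)
  finally have "(x ^ n / S n - x ^ Suc n / S (Suc n)) / (1 - x) \<le> (1 / real n - 1 / real (Suc n)) / (1 - x)"
    using x by (intro divide_right_mono) auto
  hence "x ^ n / S n / (1 - x) - x ^ Suc n / S (Suc n) / (1 - x) \<le> 1 / real n / (1 - x) - 1 / real (Suc n) / (1 - x)"
    by (simp only: diff_divide_distrib)
  moreover have e: "a / ((1 - x) * c) = a / c / (1 - x)" "1 / (c * (1 - x)) = 1 / c / (1 - x)" for a c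
    by simp_all
  ultimately show ?thesis unfolding S1 e by linarith
qed

context quad_char
begin

text \<open>Monsky's argument. The Lambert series f(x) = sum of chi(n) x^n / (1 - x^n) equals the
  sum of r(n) x^n with r the divisor sum of chi, hence is at least the sum of x^(m^2). If L(1, chi)
  = 0, adding the vanishing series divided by 1 - x turns -f into the series of chi(n) with weights
  decreasing from 1, so f <= q for all x < 1. Letting x tend to 1 contradicts the infinitude of
  squares.\<close>

lemma ds_chi_1_nonzero: "ds chi 1 \<noteq> 0"
proof
  assume zero: "ds chi 1 = 0"
  have "(\<lambda>n. of_real (chi (Suc n)) * npow (Suc n) 1) sums 0"
    using ds_chi_series(2)[of 1] zero by simp
  hence "(\<lambda>n. complex_of_real (chi (Suc n) / real (Suc n))) sums 0"
    by (simp only: npow_at_1[OF zero_less_Suc]) simp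
  from sums_Re[OF this] have L1: "(\<lambda>n. chi (Suc n) / real (Suc n)) sums 0" by simp
  define r where "r = (\<lambda>n. \<Sum>d | d dvd n. chi d)"
  have bound: "(\<Sum>m=1..K. x ^ (m\<^sup>2)) \<le> q" if x: "0 < x" "x < 1" for x :: real and K :: nat
  proof -
    define b where "b = (\<lambda>n. 1 / (real n * (1 - x)) - x ^ n / (1 - x ^ n))"
    define g where "g = (\<lambda>n. x ^ n / (1 - x ^ n))"
    have xn: "x ^ n < 1" if "n \<ge> 1" for n
      using x power_Suc_less_one[of x "n - 1"] that by (cases n) auto
    have inner: "((\<lambda>e. x ^ (d * e)) has_sum g d) {1..}" if d: "d \<ge> 1" for d
    proof -
      have "(\<lambda>n. (x ^ d) ^ n) sums (1 / (1 - x ^ d))" using x xn[OF d] by (intro geometric_sums) auto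
      hence "(\<lambda>n. x ^ d * (x ^ d) ^ n) sums (x ^ d * (1 / (1 - x ^ d)))" by (rule sums_mult)
      hence s: "(\<lambda>n. x ^ (d * Suc n)) sums g d" by (simp add: g_def power_add power_mult)
      hence "summable (\<lambda>n. norm (x ^ (d * Suc n)))" using x by (simp add: sums_iff)
      from norm_summable_imp_has_sum_Suc[OF this] s show ?thesis by (simp add: sums_iff)
    qed
    have g0: "g n \<ge> 0" if "n \<ge> 1" for n using x xn[OF that] by (simp add: g_def)
    have gle: "g (Suc n) \<le> x ^ Suc n / (1 - x)" for n
    proof -
      have "x ^ Suc n \<le> x ^ 1" using x by (intro power_decreasing) auto
      hence le: "1 - x \<le> 1 - x ^ Suc n" by simp
      show ?thesis unfolding g_def by (rule frac_le[OF _ order_refl _ le]) (use x in simp_all)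
    qed
    have gsum: "summable (\<lambda>n. g (Suc n))"
    proof (rule summable_comparison_test'[where N = 0])
      have "summable (\<lambda>n. x ^ n)" using x by (intro summable_geometric) auto
      thus "summable (\<lambda>n. x ^ Suc n / (1 - x))" by (intro summable_divide) (simp only: summable_Suc_iff)
      show "norm (g (Suc n)) \<le> x ^ Suc n / (1 - x)" for n using gle[of n] g0[of "Suc n"] by simp
    qed
    have cgsum: "summable (\<lambda>n. norm (chi (Suc n) * g (Suc n)))"
    proof (rule summable_comparison_test'[OF gsum, where N = 0])
      show "norm (norm (chi (Suc n) * g (Suc n))) \<le> g (Suc n)" for n
        using mult_right_mono[OF abs_chi_le[of "Suc n"] g0[of "Suc n"]] g0[of "Suc n"] by (simp add: abs_mult)
    qed
    define f where "f = (\<Sum>n. chi (Suc n) * g (Suc n))"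
    have "((\<lambda>(d, e). chi d * x ^ (d * e)) has_sum f) ({1..} \<times> {1..})"
    proof (rule has_sum_SigmaI)
      show "((\<lambda>e. case (d, e) of (d, e) \<Rightarrow> chi d * x ^ (d * e)) has_sum (chi d * g d)) {1..}" if "d \<in> {1..}" for d
        using has_sum_cmult_right[OF inner, of d "chi d"] that by simp
      show "((\<lambda>d. chi d * g d) has_sum f) {1..}"
        unfolding f_def by (rule norm_summable_imp_has_sum_Suc[OF cgsum])
      have "(\<lambda>z. norm (case z of (d, e) \<Rightarrow> chi d * x ^ (d * e))) summable_on ({1..} \<times> {1..})"
      proof (rule summable_on_SigmaI)
        show "((\<lambda>e. norm (case (d, e) of (d, e) \<Rightarrow> chi d * x ^ (d * e))) has_sum (\<bar>chi d\<bar> * g d)) {1..}" if "d \<in> {1..}" for d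
          using has_sum_cmult_right[OF inner, of d "\<bar>chi d\<bar>"] that x by (simp add: abs_mult)
        have "((\<lambda>d. norm (chi d * g d)) has_sum (\<Sum>n. norm (chi (Suc n) * g (Suc n)))) {1..}"
          using norm_summable_imp_has_sum_Suc[of "\<lambda>n. norm (chi n * g n)"] cgsum by simp
        hence "((\<lambda>d. \<bar>chi d\<bar> * g d) has_sum (\<Sum>n. norm (chi (Suc n) * g (Suc n)))) {1..}"
          by (rule has_sum_cong[THEN iffD1, rotated]) (use g0 in \<open>simp add: abs_mult\<close>)
        thus "(\<lambda>d. \<bar>chi d\<bar> * g d) summable_on {1..}" by (auto simp: summable_on_def)
      qed auto
      thus "(\<lambda>(d, e). chi d * x ^ (d * e)) summable_on ({1..} \<times> {1..})" by (rule abs_summable_summable)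
    qed
    from has_sum_imp_sums_Suc[OF has_sum_divisor_pairs[OF this]]
    have "(\<lambda>n. \<Sum>d | d dvd Suc n. chi d * x ^ (d * (Suc n div d))) sums f" by simp
    moreover have "(\<Sum>d | d dvd Suc n. chi d * x ^ (d * (Suc n div d))) = r (Suc n) * x ^ Suc n" for n
      unfolding r_def sum_distrib_right by (intro sum.cong refl) auto
    ultimately have fr: "(\<lambda>n. r (Suc n) * x ^ Suc n) sums f" by simp
    have "(\<Sum>m=1..K. x ^ (m\<^sup>2)) \<le> (\<Sum>m=1..K. r (m\<^sup>2) * x ^ (m\<^sup>2))"
    proof (rule sum_mono)
      fix m assume m: "m \<in> {1..K}"
      have "r (m\<^sup>2) \<ge> 1" unfolding r_def using sum_divisors_chi_nonneg[of "m\<^sup>2"] m by auto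
      thus "x ^ (m\<^sup>2) \<le> r (m\<^sup>2) * x ^ (m\<^sup>2)" using x by simp
    qed
    also have "\<dots> = (\<Sum>n\<in>(\<lambda>m. m\<^sup>2 - 1) ` {1..K}. r (Suc n) * x ^ Suc n)"
    proof (subst sum.reindex)
      show "inj_on (\<lambda>m. m\<^sup>2 - 1) {1..K}"
      proof (rule inj_onI)
        fix a b :: nat assume "a \<in> {1..K}" "b \<in> {1..K}" "a\<^sup>2 - 1 = b\<^sup>2 - 1"
        hence "a\<^sup>2 = b\<^sup>2" by (metis One_nat_def Suc_pred atLeastAtMost_iff less_le_trans zero_less_one zero_less_power)
        thus "a = b" by simp
      qed
      show "(\<Sum>m=1..K. r (m\<^sup>2) * x ^ (m\<^sup>2)) = sum ((\<lambda>n. r (Suc n) * x ^ Suc n) \<circ> (\<lambda>m. m\<^sup>2 - 1)) {1..K}"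
      proof (rule sum.cong[OF refl])
        fix m :: nat assume "m \<in> {1..K}"
        hence "Suc (m\<^sup>2 - 1) = m\<^sup>2" by (simp add: Suc_pred)
        thus "r (m\<^sup>2) * x ^ (m\<^sup>2) = ((\<lambda>n. r (Suc n) * x ^ Suc n) \<circ> (\<lambda>m. m\<^sup>2 - 1)) m" by (simp only: o_def)
      qed
    qed
    also have "\<dots> \<le> (\<Sum>n. r (Suc n) * x ^ Suc n)"
    proof (rule sum_le_suminf)
      show "0 \<le> r (Suc n) * x ^ Suc n" for n
        unfolding r_def using sum_divisors_chi_nonneg[of "Suc n"] x by simp
    qed (use fr in \<open>auto simp: sums_iff\<close>)
    also have "\<dots> = f" using fr by (simp add: sums_iff)
    also have "f \<le> q"
    proof -
      have "(\<lambda>n. chi (Suc n) * g (Suc n)) sums f"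
        unfolding f_def using summable_norm_cancel[OF cgsum] by (rule summable_sums)
      from sums_diff[OF sums_divide[OF L1, of "1 - x"] this]
      have s: "(\<lambda>n. chi (Suc n) / real (Suc n) / (1 - x) - chi (Suc n) * g (Suc n)) sums (- f)" by simp
      have "chi (Suc n) / real (Suc n) / (1 - x) - chi (Suc n) * g (Suc n) = chi (Suc n) * b (Suc n)" for n
        by (simp add: b_def g_def right_diff_distrib)
      with s have s: "(\<lambda>N. \<Sum>n<N. chi (Suc n) * b (Suc n)) \<longlonglongrightarrow> - f" by (simp add: sums_def)
      have nn: "b n \<ge> 0" if n: "n \<ge> 1" for n
      proof -
        have "real n * x ^ n = (\<Sum>i<n. x ^ n)" by simp
        also have "\<dots> \<le> (\<Sum>i<n. x ^ i)" using x by (intro sum_mono power_decreasing) auto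
        finally have "(1 - x) * (real n * x ^ n) \<le> (1 - x) * (\<Sum>i<n. x ^ i)" using x by (intro mult_left_mono) auto
        also have "\<dots> = 1 - x ^ n" by (rule one_diff_power_eq [symmetric])
        finally have "x ^ n / (1 - x ^ n) \<le> 1 / (real n * (1 - x))"
          using x n xn[OF n] by (simp add: pos_divide_le_eq pos_le_divide_eq mult_ac)
        thus ?thesis by (simp add: b_def)
      qed
      have "\<bar>\<Sum>n<N. chi (Suc n) * b (Suc n)\<bar> \<le> q * b 1" for N
        by (rule abel_sum_bound[OF partial_sums _ nn])
           (use power_div_one_minus_decreasing[OF x] in \<open>auto simp: b_def\<close>)
      moreover have "b 1 = 1" using x by (simp add: b_def diff_divide_distrib [symmetric])
      ultimately have "norm (\<Sum>n<N. chi (Suc n) * b (Suc n)) \<le> q" for N by simp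
      hence "norm (- f) \<le> q" using LIMSEQ_le_const2[OF tendsto_norm[OF s]] by blast
      thus ?thesis by simp
    qed
    finally show ?thesis .
  qed
  \<comment> \<open>Only K squares are kept, so that x can tend to 1 before K grows.\<close>
  have "real K \<le> q" for K
  proof -
    have "((\<lambda>x::real. \<Sum>m=1..K. x ^ (m\<^sup>2)) \<longlongrightarrow> (\<Sum>m=1..K. 1 ^ (m\<^sup>2))) (at_left 1)"
      by (intro tendsto_intros)
    moreover have "\<forall>\<^sub>F x in at_left 1. (\<Sum>m=1..K. x ^ (m\<^sup>2)) \<le> q"
      by (rule eventually_mono[OF eventually_at_left_real[OF zero_less_one]]) (rule bound, simp_all)
    ultimately have "(\<Sum>m=1..K. (1::real) ^ (m\<^sup>2)) \<le> q"
      by (rule tendsto_upperbound) simp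
    thus ?thesis by simp
  qed
  from this[of "nat \<lceil>q\<rceil> + 1"] show False by linarith
qed

end

section \<open>Non-vanishing on the line Re s = 1\<close>

lemma logarithmic_derivative_order:
  assumes S: "open S" "connected S" "P holomorphic_on S" "z0 \<in> S" "\<exists>w\<in>S. P w \<noteq> 0"
  obtains k :: nat where "k = 0 \<longleftrightarrow> P z0 \<noteq> 0" "((\<lambda>w. (w - z0) * deriv P w / P w) \<longlongrightarrow> of_nat k) (at z0)"
proof -
  define n where "n = zorder P z0"
  define g where "g = zor_poly P z0"
  have *: "(if P z0 = 0 then n > 0 else n = 0) \<and> (\<exists>r. r > 0 \<and> cball z0 r \<subseteq> S \<and> g holomorphic_on cball z0 r
    \<and> (\<forall>w\<in>cball z0 r. P w = g w * (w - z0) ^ nat n \<and> g w \<noteq> 0))"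
    unfolding n_def g_def by (rule zorder_exist_zero[OF S(3,1,2,4,5)])
  then obtain r where r: "r > 0" "g holomorphic_on cball z0 r"
    "\<And>w. w \<in> cball z0 r \<Longrightarrow> P w = g w * (w - z0) ^ nat n \<and> g w \<noteq> 0" by blast
  define k where "k = nat n"
  have gh: "g holomorphic_on ball z0 r" using r(2) by (rule holomorphic_on_subset) auto
  have eq: "(w - z0) * deriv P w / P w = (w - z0) * (deriv g w / g w) + of_nat k"
    if w: "w \<in> ball z0 r" "w \<noteq> z0" for w
  proof -
    have "(g has_field_derivative deriv g w) (at w)" by (rule holomorphic_derivI[OF gh open_ball w(1)])
    hence "((\<lambda>w. g w * (w - z0) ^ k) has_field_derivative
        deriv g w * (w - z0) ^ k + of_nat k * (w - z0) ^ (k - 1) * g w) (at w)"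
      by (auto intro!: derivative_eq_intros)
    hence "(P has_field_derivative deriv g w * (w - z0) ^ k + of_nat k * (w - z0) ^ (k - 1) * g w) (at w)"
      by (rule has_field_derivative_transform_within_open[OF _ open_ball w(1)]) (use r(3) in \<open>auto simp: k_def\<close>)
    hence d: "deriv P w = deriv g w * (w - z0) ^ k + of_nat k * (w - z0) ^ (k - 1) * g w" by (rule DERIV_imp_deriv)
    have gw: "g w \<noteq> 0" "P w = g w * (w - z0) ^ k" using r(3)[of w] w by (auto simp: k_def)
    define u where "u = w - z0"
    have u: "u \<noteq> 0" using w(2) by (simp add: u_def)
    have e: "u * (of_nat k * u ^ (k - 1)) = of_nat k * u ^ k"
      by (cases k) auto
    have "u * (deriv g w * u ^ k + of_nat k * u ^ (k - 1) * g w) = u * deriv g w * u ^ k + (u * (of_nat k * u ^ (k - 1))) * g w"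
      by (simp add: distrib_left mult.assoc)
    also have "\<dots> = (u * deriv g w + of_nat k * g w) * u ^ k" unfolding e by (simp add: algebra_simps)
    finally have "u * (deriv g w * u ^ k + of_nat k * u ^ (k - 1) * g w) / (g w * u ^ k) = u * (deriv g w / g w) + of_nat k"
      using gw(1) u by (simp add: add_divide_distrib)
    thus ?thesis unfolding d gw(2) u_def .
  qed
  have "isCont (deriv g) z0" "isCont g z0"
    using r(1) by (auto intro!: continuous_on_interior[of "ball z0 r"] holomorphic_on_imp_continuous_on holomorphic_deriv gh)
  moreover have "g z0 \<noteq> 0" using r by auto
  ultimately have "((\<lambda>w. (w - z0) * (deriv g w / g w) + of_nat k) \<longlongrightarrow> (z0 - z0) * (deriv g z0 / g z0) + of_nat k) (at z0)"
    by (intro tendsto_intros isContD) auto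
  moreover have "\<forall>\<^sub>F w in at z0. (w - z0) * (deriv g w / g w) + of_nat k = (w - z0) * deriv P w / P w"
    using eventually_at_ball'[OF r(1), of z0 UNIV] by eventually_elim (use eq in auto)
  ultimately have "((\<lambda>w. (w - z0) * deriv P w / P w) \<longlongrightarrow> (z0 - z0) * (deriv g z0 / g z0) + of_nat k) (at z0)"
    by (rule Lim_transform_eventually)
  moreover have "k = 0 \<longleftrightarrow> P z0 \<noteq> 0" using * by (auto simp: k_def)
  ultimately show thesis using that by simp
qed

lemma Re_npow: "Re (npow n s) = exp (- Re s * ln (real n)) * cos (Im s * ln (real n))"
  by (simp add: npow_def Re_exp)

text \<open>At 1 + i tau, h times the series at 1 + h + i tau tends to 1 (if tau = 0) or 0, minus
  the order of the zero of P there. As a is non-negative, 3 + 4 cos + cos 2 >= 0 gives 3 - 4 k1 - k2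
  >= 0 for the orders at heights t and 2 t, so k1 = 0. P is kept general: it is (s - 1) zeta(s), and
  later its product with L(s, chi).\<close>

lemma nonvanishing_on_line:
  assumes a: "\<And>n. a n \<ge> 0" "log_bounded a"
    and P: "P holomorphic_on {s. Re s > 0}" "\<And>s. Re s > 1 \<Longrightarrow> P s \<noteq> 0" "P 1 \<noteq> 0"
    and D: "\<And>s. Re s > 1 \<Longrightarrow> ds a s = 1 / (s - 1) - deriv P s / P s"
    and s: "Re s = 1"
  shows "P s \<noteq> 0"
proof (cases "Im s = 0")
  case True
  hence "s = 1" using s by (simp add: complex_eq_iff)
  thus ?thesis using P(3) by simp
next
  case False
  define t where "t = Im s"
  have t: "t \<noteq> 0" using False by (simp add: t_def)
  define pt where "pt = (\<lambda>\<tau> h. Complex (1 + h) \<tau>)"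
  have ord: "\<exists>k::nat. (k = 0 \<longleftrightarrow> P (Complex 1 \<tau>) \<noteq> 0) \<and>
      ((\<lambda>h. of_real h * ds a (pt \<tau> h)) \<longlongrightarrow> (if \<tau> = 0 then 1 else 0) - of_nat k) (at_right 0)" for \<tau>
  proof -
    define z0 where "z0 = Complex 1 \<tau>"
    obtain k :: nat where k: "k = 0 \<longleftrightarrow> P z0 \<noteq> 0" "((\<lambda>w. (w - z0) * deriv P w / P w) \<longlongrightarrow> of_nat k) (at z0)"
    proof (rule logarithmic_derivative_order[OF open_halfspace_Re_gt _ P(1)])
      show "connected {s. Re s > 0}" by (intro convex_connected convex_halfspace_Re_gt)
      show "z0 \<in> {s. Re s > 0}" by (simp add: z0_def)
      show "\<exists>w\<in>{s. Re s > 0}. P w \<noteq> 0" using P(2)[of 2] by (intro bexI[of _ 2]) auto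
    qed
    have lim: "((\<lambda>h. pt \<tau> h) \<longlongrightarrow> z0) (at_right 0)"
      unfolding pt_def z0_def by (auto intro!: tendsto_eq_intros)
    have filt: "filterlim (\<lambda>h. pt \<tau> h) (at z0) (at_right 0)"
      unfolding filterlim_at
    proof
      show "\<forall>\<^sub>F h in at_right 0. pt \<tau> h \<in> UNIV \<and> pt \<tau> h \<noteq> z0"
        unfolding eventually_at_right_field by (auto simp: pt_def z0_def intro: exI[of _ 1])
      show "((\<lambda>h. pt \<tau> h) \<longlongrightarrow> z0) (at_right 0)" by (rule lim)
    qed
    have 1: "((\<lambda>h. (pt \<tau> h - z0) * deriv P (pt \<tau> h) / P (pt \<tau> h)) \<longlongrightarrow> of_nat k) (at_right 0)"
      by (rule filterlim_compose[OF k(2) filt])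
    have 2: "((\<lambda>h. of_real h / (pt \<tau> h - 1)) \<longlongrightarrow> (if \<tau> = 0 then 1 else 0)) (at_right 0)"
    proof (cases "\<tau> = 0")
      case True
      have "\<forall>\<^sub>F h in at_right 0. 1 = of_real h / (pt \<tau> h - 1)"
        unfolding eventually_at_right_field
        by (intro exI[of _ 1]) (auto simp: pt_def True complex_eq_iff Re_divide Im_divide power2_eq_square)
      thus ?thesis using True by (auto intro: Lim_transform_eventually[OF tendsto_const])
    next
      case False
      hence "z0 - 1 \<noteq> 0" by (auto simp: z0_def complex_eq_iff)
      hence "((\<lambda>h. of_real h / (pt \<tau> h - 1)) \<longlongrightarrow> of_real 0 / (z0 - 1)) (at_right 0)"
        by (intro tendsto_intros lim) auto
      thus ?thesis using False by simp
    qed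
    have "\<forall>\<^sub>F h in at_right 0. of_real h / (pt \<tau> h - 1) - (pt \<tau> h - z0) * deriv P (pt \<tau> h) / P (pt \<tau> h) = of_real h * ds a (pt \<tau> h)"
      unfolding eventually_at_right_field
    proof (intro exI[of _ 1] conjI allI impI)
      fix h :: real assume h: "0 < h" "h < 1"
      have "pt \<tau> h - z0 = of_real h" by (simp add: pt_def z0_def complex_eq_iff)
      moreover have "Re (pt \<tau> h) > 1" using h by (simp add: pt_def)
      ultimately show "of_real h / (pt \<tau> h - 1) - (pt \<tau> h - z0) * deriv P (pt \<tau> h) / P (pt \<tau> h) = of_real h * ds a (pt \<tau> h)"
        by (simp add: D right_diff_distrib)
    qed simp
    from Lim_transform_eventually[OF tendsto_diff[OF 2 1] this] k(1)
    show ?thesis by (auto simp: z0_def)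
  qed
  obtain k0 :: nat where k0: "k0 = 0 \<longleftrightarrow> P (Complex 1 0) \<noteq> 0"
      "((\<lambda>h. of_real h * ds a (pt 0 h)) \<longlongrightarrow> 1 - of_nat k0) (at_right 0)" using ord[of 0] unfolding if_P[OF refl] by (elim exE conjE) (rule that)
  obtain k1 :: nat where k1: "k1 = 0 \<longleftrightarrow> P (Complex 1 t) \<noteq> 0"
      "((\<lambda>h. of_real h * ds a (pt t h)) \<longlongrightarrow> 0 - of_nat k1) (at_right 0)"
    using ord[of t] unfolding if_not_P[OF t] by (elim exE conjE) (rule that)
  have t2: "2 * t \<noteq> 0" using t by simp
  obtain k2 :: nat where k2: "((\<lambda>h. of_real h * ds a (pt (2 * t) h)) \<longlongrightarrow> 0 - of_nat k2) (at_right 0)"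
    using ord[of "2 * t"] unfolding if_not_P[OF t2] by (elim exE conjE) (rule that)
  have lim: "((\<lambda>h. Re (3 * (of_real h * ds a (pt 0 h)) + 4 * (of_real h * ds a (pt t h)) + of_real h * ds a (pt (2 * t) h)))
      \<longlongrightarrow> Re (3 * (1 - of_nat k0) + 4 * (0 - of_nat k1) + (0 - of_nat k2))) (at_right 0)"
    by (intro tendsto_intros k0 k1 k2)
  have "\<forall>\<^sub>F h in at_right 0. 0 \<le> Re (3 * (of_real h * ds a (pt 0 h)) + 4 * (of_real h * ds a (pt t h)) + of_real h * ds a (pt (2 * t) h))"
    unfolding eventually_at_right_field
  proof (intro exI[of _ 1] conjI allI impI)
    fix h :: real assume h: "0 < h" "h < 1"
    have S: "(\<lambda>n. of_real (a (Suc n)) * npow (Suc n) (pt \<tau> h)) sums ds a (pt \<tau> h)" for \<tau>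
      by (rule ds_sums[OF a(2)]) (use h in \<open>simp add: pt_def\<close>)
    have S3: "(\<lambda>n. Re (3 * (of_real (a (Suc n)) * npow (Suc n) (pt 0 h)) + 4 * (of_real (a (Suc n)) * npow (Suc n) (pt t h))
        + of_real (a (Suc n)) * npow (Suc n) (pt (2 * t) h))) sums Re (3 * ds a (pt 0 h) + 4 * ds a (pt t h) + ds a (pt (2 * t) h))"
      by (intro sums_Re sums_add sums_mult S)
    have S4: "Re (3 * (of_real (a (Suc n)) * npow (Suc n) (pt 0 h)) + 4 * (of_real (a (Suc n)) * npow (Suc n) (pt t h))
        + of_real (a (Suc n)) * npow (Suc n) (pt (2 * t) h)) \<ge> 0" for n :: nat
    proof -
      define \<theta> where "\<theta> = t * ln (real (Suc n))"
      have "cos (2 * \<theta>) = 2 * (cos \<theta>)\<^sup>2 - 1" by (rule cos_double_cos)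
      hence "3 + 4 * cos \<theta> + cos (2 * \<theta>) = 2 * (1 + cos \<theta>)\<^sup>2" by (simp add: power2_eq_square algebra_simps)
      hence nn: "3 + 4 * cos \<theta> + cos (2 * \<theta>) \<ge> 0" by simp
      have "Re (3 * (of_real (a (Suc n)) * npow (Suc n) (pt 0 h)) + 4 * (of_real (a (Suc n)) * npow (Suc n) (pt t h))
        + of_real (a (Suc n)) * npow (Suc n) (pt (2 * t) h)) =
         a (Suc n) * exp (- (1 + h) * ln (real (Suc n))) * (3 + 4 * cos \<theta> + cos (2 * \<theta>))"
        by (simp add: Re_npow pt_def \<theta>_def algebra_simps del: of_nat_Suc)
      thus ?thesis using nn a(1) by simp
    qed
    have "0 \<le> Re (3 * ds a (pt 0 h) + 4 * ds a (pt t h) + ds a (pt (2 * t) h))"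
      by (rule sums_le[OF S4 sums_zero S3])
    hence "0 \<le> h * Re (3 * ds a (pt 0 h) + 4 * ds a (pt t h) + ds a (pt (2 * t) h))" using h by simp
    thus "0 \<le> Re (3 * (of_real h * ds a (pt 0 h)) + 4 * (of_real h * ds a (pt t h)) + of_real h * ds a (pt (2 * t) h))"
      by (simp add: algebra_simps)
  qed simp
  hence "0 \<le> Re (3 * (1 - of_nat k0) + 4 * (0 - of_nat k1) + (0 - of_nat k2))"
    by (rule tendsto_lowerbound[OF lim]) simp
  moreover have "k0 = 0" using k0(1) P(3) by (simp add: one_complex.code)
  ultimately have "4 * real k1 \<le> 3" by simp
  hence "k1 = 0" by linarith
  moreover have "Complex 1 t = s" using s by (simp add: t_def complex_eq_iff)
  ultimately show ?thesis using k1(1) by simp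
qed

section \<open>Chebyshev's bound and the prime number theorems\<close>

lemma dconv_mangoldt_one: "n > 0 \<Longrightarrow> dconv mangoldt (\<lambda>_. 1) n = ln (real n)"
  using mangoldt_sum[of n, where ?'a = real] by (simp add: dconv_def)

text \<open>Legendre's formula for M!, obtained by summing the identity that Lambda convolved with 1
  is log.\<close>

lemma sum_mangoldt_div:
  "(\<Sum>d=1..M. mangoldt d * real (M div d)) = ln (fact M)"
proof -
  have "(\<Sum>n=1..M. ln (real n)) = (\<Sum>n=1..M. dconv mangoldt (\<lambda>_. 1) n)"
    by (intro sum.cong refl) (simp add: dconv_mangoldt_one)
  also have "\<dots> = (\<Sum>d=1..M. mangoldt d * real (M div d))" unfolding sum_dconv by simp
  also have "(\<Sum>n=1..M. ln (real n)) = ln (fact M)"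
    by (subst ln_prod [symmetric]) (auto simp: fact_prod)
  finally show ?thesis by simp
qed

text \<open>Chebyshev's method: for h = N div 2 the weight N div n - 2 (h div n) is non-negative and
  equals 1 for h < n <= N, while its total against Lambda is log (N! / h!^2) <= 2 N. Induction on
  the half adds up to 4 h + 2 N <= 4 N.\<close>

lemma psi_le: "(\<Sum>n=1..N. mangoldt n :: real) \<le> 4 * real N"
proof (induction N rule: less_induct)
  case (less N)
  show ?case
  proof (cases "N \<le> 1")
    case True
    hence "N = 0 \<or> N = 1" by auto
    thus ?thesis by auto
  next
    case False
    define h where "h = N div 2"
    have h: "h < N" using False by (simp add: h_def)
    note T = sum_mangoldt_div
    have Th: "(\<Sum>d=1..N. mangoldt d * real (h div d)) = ln (fact h)"
    proof -
      have "(\<Sum>d=1..N. mangoldt d * real (h div d)) = (\<Sum>d=1..h. mangoldt d * real (h div d))"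
        using h by (intro sum.mono_neutral_right) auto
      thus ?thesis unfolding T .
    qed
    have "(\<Sum>n=1..N. mangoldt n :: real) - (\<Sum>n=1..h. mangoldt n) = (\<Sum>n\<in>{1..N} - {1..h}. mangoldt n)"
      using h by (subst sum_diff) auto
    also have "{1..N} - {1..h} = {Suc h..N}" by auto
    also have "(\<Sum>n\<in>{Suc h..N}. mangoldt n :: real) = (\<Sum>n\<in>{Suc h..N}. mangoldt n * (real (N div n) - 2 * real (h div n)))"
    proof (rule sum.cong[OF refl])
      fix n assume n: "n \<in> {Suc h..N}"
      hence "h div n = 0" by simp
      moreover have "N div n = 1"
      proof (rule div_nat_eqI)
        show "n * 1 \<le> N" using n by simp
        have "N < 2 * h + 2" unfolding h_def by presburger
        thus "N < n * Suc 1" using n by auto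
      qed
      ultimately show "(mangoldt n :: real) = mangoldt n * (real (N div n) - 2 * real (h div n))" by simp
    qed
    also have "\<dots> \<le> (\<Sum>n=1..N. mangoldt n * (real (N div n) - 2 * real (h div n)))"
    proof (rule sum_mono2)
      fix n assume "n \<in> {1..N} - {Suc h..N}"
      have "h div n = (N div n) div 2" by (simp add: h_def div_mult2_eq [symmetric] mult.commute)
      hence "2 * (h div n) \<le> N div n" by simp
      hence "real (2 * (h div n)) \<le> real (N div n)" by (simp only: of_nat_le_iff)
      thus "0 \<le> (mangoldt n :: real) * (real (N div n) - 2 * real (h div n))"
        by (intro mult_nonneg_nonneg mangoldt_nonneg) simp
    qed auto
    also have "\<dots> = (\<Sum>n=1..N. mangoldt n * real (N div n)) - 2 * (\<Sum>n=1..N. mangoldt n * real (h div n))"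
      by (simp add: right_diff_distrib sum_subtractf sum_distrib_left mult.left_commute)
    also have "\<dots> = ln (fact N) - 2 * ln (fact h)" unfolding T Th ..
    also have "\<dots> \<le> 2 * real N"
    proof -
      define c where "c = N - h"
      have "fact N = fact h * fact (N - h) * real (N choose h)"
        using binomial_fact_lemma[of h N] h by (metis less_imp_le of_nat_fact of_nat_mult)
      also have "fact (N - h) \<le> real N * fact h"
      proof (cases "even N")
        case True
        hence "N - h = h" by (auto simp: h_def)
        thus ?thesis using False by simp
      next
        case odd: False
        hence e: "N - h = Suc h" by (auto simp: h_def elim: oddE)
        have "real (Suc h) \<le> real N" using h by simp
        hence "real (Suc h) * fact h \<le> real N * fact h" by (intro mult_right_mono) auto
        thus ?thesis unfolding e by simp
      qed
      also have "real (N choose h) \<le> 2 ^ N" using binomial_le_pow2[of N h]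
        by (metis of_nat_le_iff of_nat_numeral of_nat_power)
      finally have "(fact N :: real) \<le> fact h * (real N * fact h) * 2 ^ N"
        by (simp add: mult_left_mono mult_right_mono)
      hence "ln (fact N) \<le> ln (fact h * (real N * fact h) * 2 ^ N)" by (subst ln_le_cancel_iff) (use False in auto)
      also have "\<dots> = 2 * ln (fact h) + ln (real N) + real N * ln 2"
        using False by (simp add: ln_mult ln_realpow)
      finally have "ln (fact N) - 2 * ln (fact h) \<le> ln (real N) + real N * ln 2" by simp
      moreover have "ln (real N) \<le> real N" using False ln_bound[of "real N"] by simp
      moreover have "real N * ln 2 \<le> real N * 1" using ln_2_less_1 by (intro mult_left_mono) auto
      ultimately show ?thesis by simp
    qed
    finally have "(\<Sum>n=1..N. mangoldt n :: real) \<le> 4 * real h + 2 * real N" using less.IH[OF h] by simp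
    also have "2 * h \<le> N" by (simp add: h_def)
    hence "real (2 * h) \<le> real N" by (simp only: of_nat_le_iff)
    hence "4 * real h + 2 * real N \<le> 4 * real N" by simp
    finally show ?thesis .
  qed
qed


lemma open_Collect_nonzero:
  assumes "f holomorphic_on S" "open S"
  shows "open {s \<in> S. f s \<noteq> 0}"
proof -
  have "open (S \<inter> f -` (- {0}))"
    by (rule continuous_open_preimage[OF holomorphic_on_imp_continuous_on]) (use assms in auto)
  moreover have "S \<inter> f -` (- {0}) = {s \<in> S. f s \<noteq> 0}" by auto
  ultimately show ?thesis by simp
qed

theorem prime_number_theorem_psi: "(\<lambda>N. (\<Sum>n=1..N. mangoldt n) / real N) \<longlonglongrightarrow> 1"
proof -
  have S1: "mangoldt n = (1 :: real) * mangoldt n" for n by simp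
  have lb: "log_bounded mangoldt" using log_bounded_mangoldt[of "\<lambda>_. 1"] by simp
  have nz: "zeta_reg s \<noteq> 0" if "Re s \<ge> 1" for s
    using nonvanishing_on_line[OF mangoldt_nonneg lb zeta_reg_holomorphic zeta_reg_nonzero _ ds_mangoldt, of s]
      zeta_reg_nonzero[of s] that by (cases "Re s = 1") auto
  define V where "V = {s \<in> {s. Re s > 0}. zeta_reg s \<noteq> 0}"
  \<comment> \<open>The pole at 1 cancels between Lambda and the constant 1: what remains is (1 -
    \<open>zeta_reg s\<close>) / (s - 1), a difference quotient with a removable
    singularity.\<close>
  define g where "g = (\<lambda>s. 1 - zeta_reg s)"
  define H where "H = (\<lambda>s. (if s = 1 then deriv g 1 else (g s - g 1) / (s - 1)) - deriv zeta_reg s / zeta_reg s)"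
  have op: "open {s. Re s > 0}" by (rule open_halfspace_Re_gt)
  show ?thesis
  proof (rule dirichlet_series_tauberian[where V = V and H = H and C = 4])
    show "open V" unfolding V_def by (rule open_Collect_nonzero[OF zeta_reg_holomorphic op])
    show "{s. Re s \<ge> 1} \<subseteq> V" using nz by (auto simp: V_def)
    have hol: "zeta_reg holomorphic_on V" by (rule holomorphic_on_subset[OF zeta_reg_holomorphic]) (auto simp: V_def)
    have dhol: "deriv zeta_reg holomorphic_on V"
      by (rule holomorphic_on_subset[OF holomorphic_deriv[OF zeta_reg_holomorphic op]]) (auto simp: V_def)
    have "(\<lambda>s. if s = 1 then deriv g 1 else (g s - g 1) / (s - 1)) holomorphic_on {s. Re s > 0}"
      by (rule pole_lemma) (auto simp: g_def interior_open[OF op] intro!: holomorphic_intros zeta_reg_holomorphic)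
    hence "(\<lambda>s. if s = 1 then deriv g 1 else (g s - g 1) / (s - 1)) holomorphic_on V"
      by (rule holomorphic_on_subset) (auto simp: V_def)
    thus "H holomorphic_on V"
      unfolding H_def by (intro holomorphic_intros hol dhol) (auto simp: V_def)
    show "(\<lambda>n. of_real (mangoldt (Suc n) - 1) * npow (Suc n) s) sums H s" if s: "Re s > 1" for s
    proof -
      have s1: "s \<noteq> 1" using s by auto
      have one: "log_bounded one_char" by (rule log_bounded_bounded) (simp add: one_char_def)
      from sums_diff[OF ds_sums[OF lb s] ds_sums[OF one s]]
      have "(\<lambda>n. of_real (mangoldt (Suc n) - 1) * npow (Suc n) s) sums (ds mangoldt s - ds one_char s)"
        by (simp add: one_char_def left_diff_distrib)
      also have "ds mangoldt s - ds one_char s = H s"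
        using s1 by (simp add: ds_mangoldt[OF s] zeta_reg_eq[OF s] H_def g_def diff_divide_distrib)
      finally show ?thesis .
    qed
  qed (use psi_le in \<open>auto simp: mangoldt_nonneg\<close>)
qed

context quad_char
begin

text \<open>chi Lambda changes sign, so the Tauberian theorem is applied to (1 + chi) Lambda >= 0,
  whose series is minus the logarithmic derivative of zeta(s) L(s, chi). Its pole at 1 keeps residue
  1 because L(1, chi) is not 0; subtracting the prime number theorem leaves the twisted sum.\<close>

theorem prime_number_theorem_psi_chi: "(\<lambda>N. (\<Sum>n=1..N. chi n * mangoldt n) / real N) \<longlonglongrightarrow> 0"
proof -
  define a :: "nat \<Rightarrow> real" where "a = (\<lambda>n. mangoldt n + chi n * mangoldt n)"
  define P where "P = (\<lambda>s. zeta_reg s * ds chi s)"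
  have op: "open {s. Re s > 0}" by (rule open_halfspace_Re_gt)
  have chi_ge: "1 + chi n \<ge> 0" for n using chi_vals[of n] by auto
  have a_eq: "a n = (1 + chi n) * mangoldt n" for n by (simp add: a_def algebra_simps)
  have a0: "a n \<ge> 0" for n unfolding a_eq by (intro mult_nonneg_nonneg chi_ge mangoldt_nonneg)
  have lb1: "log_bounded mangoldt" using log_bounded_mangoldt[of "\<lambda>_. 1"] by simp
  have lb2: "log_bounded (\<lambda>n. chi n * mangoldt n)" by (rule log_bounded_mangoldt[OF abs_chi_le])
  have lb: "log_bounded a"
  proof (rule log_boundedI[where K = 2])
    fix n :: nat assume n: "n > 0"
    have "\<bar>a n\<bar> \<le> 2 * mangoldt n" unfolding a_eq abs_mult abs_mangoldt
      using abs_chi_le[of n] by (intro mult_right_mono mangoldt_nonneg) linarith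
    also have "mangoldt n \<le> ln (real n)" by (rule mangoldt_le[OF n])
    finally show "\<bar>a n\<bar> \<le> 2 * (1 + ln (real n))" by simp
  qed
  have Phol: "P holomorphic_on {s. Re s > 0}"
    unfolding P_def by (intro holomorphic_intros zeta_reg_holomorphic ds_chi_series)
  have Pnz: "P s \<noteq> 0" if "Re s > 1" for s
    using zeta_reg_nonzero[OF that] ds_chi_nonzero[OF that] by (simp add: P_def)
  have P1: "P 1 \<noteq> 0" using ds_chi_1_nonzero by (simp add: P_def)
  have dsa: "ds a s = ds mangoldt s + ds (\<lambda>n. chi n * mangoldt n) s" if "Re s > 1" for s
    using sums_add[OF ds_sums[OF lb1 that] ds_sums[OF lb2 that]]
    by (simp add: ds_def a_def sums_iff distrib_right)
  have D: "ds a s = 1 / (s - 1) - deriv P s / P s" if s: "Re s > 1" for s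
  proof -
    have mem: "s \<in> {s. Re s > 0}" using s by simp
    have "(P has_field_derivative deriv zeta_reg s * ds chi s + deriv (ds chi) s * zeta_reg s) (at s)"
      unfolding P_def
      by (intro DERIV_mult holomorphic_derivI[OF zeta_reg_holomorphic op mem] holomorphic_derivI[OF ds_chi_series(1) op mem])
    hence d: "deriv P s = deriv zeta_reg s * ds chi s + deriv (ds chi) s * zeta_reg s" by (rule DERIV_imp_deriv)
    show ?thesis unfolding dsa[OF s] ds_mangoldt[OF s] ds_chi_mangoldt[OF s] d unfolding P_def
      using zeta_reg_nonzero[OF s] ds_chi_nonzero[OF s] by (simp add: add_divide_distrib)
  qed
  have nz: "P s \<noteq> 0" if "Re s \<ge> 1" for s
    using nonvanishing_on_line[OF a0 lb Phol Pnz P1 D, of s] Pnz[of s] that by (cases "Re s = 1") auto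
  define V where "V = {s \<in> {s. Re s > 0}. P s \<noteq> 0}"
  define g where "g = (\<lambda>s. 1 - zeta_reg s)"
  define H where "H = (\<lambda>s. (if s = 1 then deriv g 1 else (g s - g 1) / (s - 1)) - deriv P s / P s)"
  have "(\<lambda>N. (\<Sum>n=1..N. a n) / real N) \<longlonglongrightarrow> 1"
  proof (rule dirichlet_series_tauberian[where V = V and H = H and C = 8])
    show "open V" unfolding V_def by (rule open_Collect_nonzero[OF Phol op])
    show "{s. Re s \<ge> 1} \<subseteq> V" using nz by (auto simp: V_def)
    have hol: "P holomorphic_on V" by (rule holomorphic_on_subset[OF Phol]) (auto simp: V_def)
    have dhol: "deriv P holomorphic_on V"
      by (rule holomorphic_on_subset[OF holomorphic_deriv[OF Phol op]]) (auto simp: V_def)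
    have "(\<lambda>s. if s = 1 then deriv g 1 else (g s - g 1) / (s - 1)) holomorphic_on {s. Re s > 0}"
      by (rule pole_lemma) (auto simp: g_def interior_open[OF op] intro!: holomorphic_intros zeta_reg_holomorphic)
    hence "(\<lambda>s. if s = 1 then deriv g 1 else (g s - g 1) / (s - 1)) holomorphic_on V"
      by (rule holomorphic_on_subset) (auto simp: V_def)
    thus "H holomorphic_on V"
      unfolding H_def by (intro holomorphic_intros hol dhol) (auto simp: V_def)
    show "(\<lambda>n. of_real (a (Suc n) - 1) * npow (Suc n) s) sums H s" if s: "Re s > 1" for s
    proof -
      have s1: "s \<noteq> 1" using s by auto
      have one: "log_bounded one_char" by (rule log_bounded_bounded) (simp add: one_char_def)
      from sums_diff[OF ds_sums[OF lb s] ds_sums[OF one s]]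
      have "(\<lambda>n. of_real (a (Suc n) - 1) * npow (Suc n) s) sums (ds a s - ds one_char s)"
        by (simp add: one_char_def left_diff_distrib)
      also have "ds a s - ds one_char s = H s"
        using s1 by (simp add: D[OF s] zeta_reg_eq[OF s] H_def g_def diff_divide_distrib)
      finally show ?thesis .
    qed
    show "(\<Sum>n=1..N. a n) \<le> 8 * real N" for N
    proof -
      have "(\<Sum>n=1..N. a n) \<le> (\<Sum>n=1..N. 2 * mangoldt n)"
        unfolding a_eq using abs_chi_le by (intro sum_mono mult_right_mono mangoldt_nonneg) (smt (verit))
      also have "\<dots> \<le> 8 * real N" using psi_le[of N] by (simp flip: sum_distrib_left)
      finally show ?thesis .
    qed
  qed (use a0 in auto)
  from tendsto_diff[OF this prime_number_theorem_psi] show ?thesis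
    by (simp add: a_def sum.distrib add_divide_distrib)
qed

end

section \<open>Selberg's function\<close>

lemma dconv_cong:
  assumes "n > 0" "\<And>d. d > 0 \<Longrightarrow> f d = f' d" "\<And>d. d > 0 \<Longrightarrow> g d = g' d"
  shows "dconv f g n = dconv f' g' n"
  unfolding dconv_def
proof (rule sum.cong[OF refl])
  fix d assume "d \<in> {d. d dvd n}"
  then obtain e where e: "n = d * e" by auto
  hence "d > 0" "e > 0" using assms(1) by auto
  thus "f d * g (n div d) = f' d * g' (n div d)" using assms(2,3) e by simp
qed

lemma dconv_unit:
  assumes "n > 0"
  shows "dconv (\<lambda>d. if d = 1 then 1 else 0) f n = f n"
proof -
  have "dconv (\<lambda>d. if d = 1 then 1 else 0) f n = (\<Sum>d\<in>{1}. (if d = 1 then 1 else 0) * f (n div d))"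
    unfolding dconv_def using assms by (intro sum.mono_neutral_right) (auto simp: finite_divisors_nat)
  thus ?thesis by simp
qed

lemma dconv_assoc:
  assumes n: "n > 0"
  shows "dconv (dconv f g) h n = dconv f (dconv g h) n"
proof -
  have fin: "finite {d. d dvd m}" if "m dvd n" for m
  proof -
    have "m > 0" using that n by (auto intro: Nat.gr0I)
    thus ?thesis by (simp add: finite_divisors_nat)
  qed
  have div: "n div e dvd n" if "e dvd n" for e using that by auto
  have "dconv (dconv f g) h n = (\<Sum>d | d dvd n. \<Sum>e | e dvd d. f e * g (d div e) * h (n div d))"
    by (simp add: dconv_def sum_distrib_right)
  also have "\<dots> = (\<Sum>(d, e)\<in>(SIGMA d:{d. d dvd n}. {e. e dvd d}). f e * g (d div e) * h (n div d))"
    by (rule sum.Sigma) (use fin in auto)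
  also have "\<dots> = (\<Sum>(e, c)\<in>(SIGMA e:{e. e dvd n}. {c. c dvd n div e}). f e * (g c * h (n div e div c)))"
  proof (rule sum.reindex_bij_witness[where j = "\<lambda>(d, e). (e, d div e)" and i = "\<lambda>(e, c). (e * c, e)"])
    fix x assume "x \<in> (SIGMA d:{d. d dvd n}. {e. e dvd d})"
    then obtain d e where x: "x = (d, e)" "d dvd n" "e dvd d" by auto
    then obtain c k where ck: "d = e * c" "n = e * c * k" by (metis dvdE)
    have pos: "e > 0" "c > 0" "k > 0" using n ck(2) by auto
    show "(case case x of (d, e) \<Rightarrow> (e, d div e) of (e, c) \<Rightarrow> (e * c, e)) = x"
      "(case x of (d, e) \<Rightarrow> (e, d div e)) \<in> (SIGMA e:{e. e dvd n}. {c. c dvd n div e})"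
      "(case case x of (d, e) \<Rightarrow> (e, d div e) of (e, c) \<Rightarrow> f e * (g c * h (n div e div c))) =
         (case x of (d, e) \<Rightarrow> f e * g (d div e) * h (n div d))"
      using pos by (simp_all add: x(1) ck mult.assoc)
  next
    fix x assume "x \<in> (SIGMA e:{e. e dvd n}. {c. c dvd n div e})"
    then obtain e c where x: "x = (e, c)" "e dvd n" "c dvd n div e" by auto
    then obtain m where m: "n = e * m" by blast
    hence pos: "e > 0" "m > 0" using n by auto
    with x m obtain k where k: "m = c * k" by auto
    have "c > 0" using pos k by auto
    thus "(case case x of (e, c) \<Rightarrow> (e * c, e) of (d, e) \<Rightarrow> (e, d div e)) = x"
      "(case x of (e, c) \<Rightarrow> (e * c, e)) \<in> (SIGMA d:{d. d dvd n}. {e. e dvd d})"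
      using pos by (simp_all add: x(1) m k)
  qed
  also have "\<dots> = (\<Sum>e | e dvd n. \<Sum>c | c dvd n div e. f e * (g c * h (n div e div c)))"
    by (rule sum.Sigma [symmetric]) (use fin div in auto)
  also have "\<dots> = dconv f (dconv g h) n"
    by (simp add: dconv_def sum_distrib_left)
  finally show ?thesis .
qed

text \<open>Equal to mu convolved with log^2. At a prime it is at least (log p)^2 while its mean up
  to M is only O(log M), so as a majorant of the primes it has the right order of magnitude.\<close>

definition selberg_mangoldt :: "nat \<Rightarrow> real" where
  "selberg_mangoldt n = mangoldt n * ln (real n) + dconv mangoldt mangoldt n"

lemma dconv_mangoldt_nonneg: "dconv mangoldt mangoldt n \<ge> 0"
  unfolding dconv_def by (intro sum_nonneg mult_nonneg_nonneg mangoldt_nonneg)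

lemma selberg_mangoldt_nonneg: "selberg_mangoldt n \<ge> 0"
proof -
  have "ln (real n) \<ge> 0" by (cases "n = 0") auto
  thus ?thesis unfolding selberg_mangoldt_def
    by (intro add_nonneg_nonneg mult_nonneg_nonneg mangoldt_nonneg dconv_mangoldt_nonneg)
qed

lemma selberg_mangoldt_prime: "prime p \<Longrightarrow> selberg_mangoldt p \<ge> (ln (real p))\<^sup>2"
  using dconv_mangoldt_nonneg[of p] by (simp add: selberg_mangoldt_def power2_eq_square)

lemma ln_fact_le: "ln (fact M) \<le> real M * ln (real M)"
proof (cases "M = 0")
  case False
  have "ln (fact M :: real) \<le> ln (real M ^ M)"
    using fact_le_power[of M, where ?'a = real] False by (subst ln_le_cancel_iff) auto
  thus ?thesis using False by (simp add: ln_realpow)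
qed simp

lemma real_div_bounds:
  assumes "d > 0"
  shows "real (M div d) \<le> real M / real d" "real M / real d \<le> real (M div d) + 1"
proof -
  show "real (M div d) \<le> real M / real d" by (rule of_nat_div_le_of_nat)
  have "M \<le> (M div d + 1) * d" using assms
    by (metis add.commute div_mult_mod_eq less_imp_le mod_less_divisor mult.commute mult_Suc_right nat_add_left_cancel_le plus_1_eq_Suc)
  hence "real M \<le> (real (M div d) + 1) * real d"
    by (metis of_nat_1 of_nat_add of_nat_le_iff of_nat_mult)
  thus "real M / real d \<le> real (M div d) + 1" using assms by (simp add: pos_divide_le_eq)
qed

text \<open>Chebyshev's bound for the inner sum reduces the convolution to M times the sum of
  Lambda(d) / d, which is at most log M + 4 by the formula for log M!.\<close>

lemma sum_selberg_mangoldt_le: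
  assumes M: "M > 0"
  shows "(\<Sum>n=1..M. selberg_mangoldt n) \<le> 8 * real M * ln (real M) + 16 * real M"
proof -
  have lnM: "ln (real M) \<ge> 0" using M by simp
  have 1: "(\<Sum>n=1..M. mangoldt n * ln (real n)) \<le> 4 * real M * ln (real M)"
  proof -
    have "(\<Sum>n=1..M. mangoldt n * ln (real n)) \<le> (\<Sum>n=1..M. mangoldt n * ln (real M))"
      by (intro sum_mono mult_left_mono mangoldt_nonneg) auto
    also have "\<dots> = (\<Sum>n=1..M. mangoldt n) * ln (real M)" by (simp add: sum_distrib_right)
    also have "\<dots> \<le> 4 * real M * ln (real M)" by (intro mult_right_mono psi_le lnM)
    finally show ?thesis .
  qed
  have 2: "(\<Sum>d=1..M. mangoldt d * (real M / real d)) \<le> real M * ln (real M) + 4 * real M"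
  proof -
    have "(\<Sum>d=1..M. mangoldt d * (real M / real d)) \<le> (\<Sum>d=1..M. mangoldt d * (real (M div d) + 1))"
      by (intro sum_mono mult_left_mono mangoldt_nonneg real_div_bounds(2)) auto
    also have "\<dots> = (\<Sum>d=1..M. mangoldt d * real (M div d)) + (\<Sum>d=1..M. mangoldt d)"
      by (simp add: distrib_left sum.distrib)
    also have "\<dots> \<le> real M * ln (real M) + 4 * real M"
      unfolding sum_mangoldt_div by (intro add_mono ln_fact_le psi_le)
    finally show ?thesis .
  qed
  have "(\<Sum>n=1..M. dconv mangoldt mangoldt n) = (\<Sum>d=1..M. mangoldt d * (\<Sum>m=1..M div d. mangoldt m))"
    by (rule sum_dconv)
  also have "\<dots> \<le> (\<Sum>d=1..M. mangoldt d * (4 * (real M / real d)))"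
  proof (intro sum_mono mult_left_mono mangoldt_nonneg)
    fix d assume d: "d \<in> {1..M}"
    have "(\<Sum>m=1..M div d. mangoldt m :: real) \<le> 4 * real (M div d)" by (rule psi_le)
    also have "\<dots> \<le> 4 * (real M / real d)" using real_div_bounds(1)[of d M] d by simp
    finally show "(\<Sum>m=1..M div d. mangoldt m :: real) \<le> 4 * (real M / real d)" .
  qed
  also have "\<dots> = 4 * (\<Sum>d=1..M. mangoldt d * (real M / real d))"
    by (simp add: sum_distrib_left mult.left_commute)
  also have "\<dots> \<le> 4 * (real M * ln (real M) + 4 * real M)" using 2 by simp
  finally have 3: "(\<Sum>n=1..M. dconv mangoldt mangoldt n) \<le> 4 * (real M * ln (real M) + 4 * real M)" .
  have "(\<Sum>n=1..M. selberg_mangoldt n) = (\<Sum>n=1..M. mangoldt n * ln (real n)) + (\<Sum>n=1..M. dconv mangoldt mangoldt n)"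
    by (simp add: selberg_mangoldt_def sum.distrib)
  also have "\<dots> \<le> 4 * real M * ln (real M) + 4 * (real M * ln (real M) + 4 * real M)"
    by (intro add_mono 1 3)
  finally show ?thesis by (simp add: algebra_simps)
qed

text \<open>log^2 t <= 16 sqrt t reduces the sum to sqrt M times the sum of 1 / sqrt d, which is at
  most 2 sqrt M. On average over d the squared logarithm thus costs only a constant.\<close>

lemma sum_ln_div_sq_le: "(\<Sum>d=1..M. (ln (real (M div d)))\<^sup>2) \<le> 32 * real M"
proof -
  have "(\<Sum>d=1..M. (ln (real (M div d)))\<^sup>2) \<le> (\<Sum>d=1..M. 16 * (sqrt (real M) / sqrt (real d)))"
  proof (rule sum_mono)
    fix d assume d: "d \<in> {1..M}"
    define t where "t = real (M div d)"
    have t1: "t \<ge> 1" using d by (simp add: t_def Suc_le_eq div_greater_zero_iff)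
    have "ln t \<le> t powr (1/4) / (1/4)" by (rule ln_powr_bound[OF t1]) simp
    hence "(ln t)\<^sup>2 \<le> (4 * t powr (1/4))\<^sup>2" using t1 by (intro power_mono) auto
    also have "\<dots> = 16 * (t powr (1/4) * t powr (1/4))" by (simp add: power2_eq_square)
    also have "t powr (1/4) * t powr (1/4) = sqrt t" using t1 by (simp add: powr_half_sqrt flip: powr_add)
    also have "sqrt t \<le> sqrt (real M / real d)" unfolding t_def using d by (intro real_sqrt_le_mono real_div_bounds) auto
    also have "sqrt (real M / real d) = sqrt (real M) / sqrt (real d)" by (rule real_sqrt_divide)
    finally show "(ln (real (M div d)))\<^sup>2 \<le> 16 * (sqrt (real M) / sqrt (real d))" by (simp add: t_def)
  qed
  also have "\<dots> = 16 * sqrt (real M) * (\<Sum>d=1..M. 1 / sqrt (real d))"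
    by (simp add: sum_distrib_left)
  also have "(\<Sum>d=1..M. 1 / sqrt (real d)) \<le> 2 * sqrt (real M)"
  proof (induction M)
    case (Suc M)
    define a b where "a = sqrt (real M)" and "b = sqrt (real (Suc M))"
    have ab: "a \<ge> 0" "b > 0" "b\<^sup>2 - a\<^sup>2 = 1" by (simp_all add: a_def b_def)
    have "0 \<le> (b - a)\<^sup>2" by simp
    hence "2 * a * b + 1 \<le> 2 * b * b" using ab(3) by (simp add: power2_eq_square algebra_simps)
    hence "(2 * a * b + 1) / b \<le> (2 * b * b) / b" using ab(2) by (intro divide_right_mono) auto
    hence "2 * a + 1 / b \<le> 2 * b" using ab(2) by (simp add: add_divide_distrib)
    thus ?case using Suc by (simp add: a_def b_def del: of_nat_Suc)
  qed simp
  hence "16 * sqrt (real M) * (\<Sum>d=1..M. 1 / sqrt (real d)) \<le> 16 * sqrt (real M) * (2 * sqrt (real M))"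
    by (intro mult_left_mono) auto
  also have "\<dots> = 32 * real M" by simp
  finally show ?thesis .
qed

text \<open>\<open>abel_sum_bound\<close> expects decreasing weights, so it is applied to w y - w n,
  continued by 0 beyond y.\<close>

lemma increasing_weight_bound:
  fixes c w :: "nat \<Rightarrow> real"
  assumes X: "\<And>N. \<bar>\<Sum>n=1..N. c n\<bar> \<le> q" and mono: "\<And>m n. 1 \<le> m \<Longrightarrow> m \<le> n \<Longrightarrow> w m \<le> w n"
    and w0: "w 1 \<ge> 0" and y: "y \<ge> 1"
  shows "\<bar>\<Sum>n=1..y. c n * w n\<bar> \<le> 2 * q * w y"
proof -
  define b where "b = (\<lambda>n. w y - w (min n y))"
  have "\<bar>\<Sum>n<y. c (Suc n) * b (Suc n)\<bar> \<le> q * b 1"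
    by (rule abel_sum_bound[OF X]) (use y mono in \<open>auto simp: b_def\<close>)
  also have "(\<Sum>n<y. c (Suc n) * b (Suc n)) = (\<Sum>n=1..y. c n * b n)"
    by (rule sum.reindex_bij_witness[where i = "\<lambda>n. n - 1" and j = Suc]) auto
  also have "(\<Sum>n=1..y. c n * b n) = (\<Sum>n=1..y. c n) * w y - (\<Sum>n=1..y. c n * w n)"
  proof -
    have "(\<Sum>n=1..y. c n * b n) = (\<Sum>n=1..y. c n * w y - c n * w n)"
      by (intro sum.cong refl) (simp add: b_def right_diff_distrib)
    thus ?thesis by (simp add: sum_subtractf sum_distrib_right)
  qed
  finally have 1: "\<bar>(\<Sum>n=1..y. c n) * w y - (\<Sum>n=1..y. c n * w n)\<bar> \<le> q * b 1" .
  have q0: "q \<ge> 0" using X[of 0] by simp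
  have wy: "w y \<ge> 0" using mono[of 1 y] w0 y by simp
  have "b 1 \<le> w y" using w0 y by (simp add: b_def min_def)
  hence 2: "q * b 1 \<le> q * w y" using q0 by (intro mult_left_mono)
  have 3: "\<bar>(\<Sum>n=1..y. c n) * w y\<bar> \<le> q * w y"
    unfolding abs_mult using X[of y] wy q0 by (intro mult_mono) auto
  from 1 2 3 show ?thesis by simp
qed

context quad_char
begin

text \<open>Selberg's function convolved with 1 is log^2; the twist by the completely multiplicative
  \<open>chi\<close> respects convolution, and \<open>moebius d * chi d\<close> inverts
  \<open>chi\<close>.\<close>

lemma selberg_mangoldt_chi_eq:
  assumes n: "n > 0"
  shows "selberg_mangoldt n * chi n = dconv (\<lambda>d. moebius d * chi d) (\<lambda>m. chi m * (ln (real m))\<^sup>2) n"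
proof -
  let ?g = "\<lambda>n. selberg_mangoldt n * chi n"
  let ?\<Lambda> = "\<lambda>n. chi n * mangoldt n"
  have sq: "dconv chi ?g m = chi m * (ln (real m))\<^sup>2" if m: "m > 0" for m
  proof -
    have "dconv chi ?g m = dconv ?g chi m" by (rule dconv_commute[OF m])
    also have "\<dots> = (\<Sum>d | d dvd m. chi m * selberg_mangoldt d)"
      unfolding dconv_def by (intro sum.cong refl) (auto simp: chi_mult [symmetric] mult_ac)
    also have "\<dots> = chi m * (\<Sum>d | d dvd m. selberg_mangoldt d)" by (simp add: sum_distrib_left)
    also have "(\<Sum>d | d dvd m. selberg_mangoldt d) = (\<Sum>d | d dvd m. mangoldt d * ln (real d)) + dconv (dconv mangoldt mangoldt) (\<lambda>_. 1) m"
      by (simp add: selberg_mangoldt_def dconv_def sum.distrib)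
    also have "dconv (dconv mangoldt mangoldt) (\<lambda>_. 1) m = dconv mangoldt (dconv mangoldt (\<lambda>_. 1)) m"
      by (rule dconv_assoc[OF m])
    also have "\<dots> = dconv mangoldt (\<lambda>d. ln (real d)) m"
      by (rule dconv_cong[OF m refl dconv_mangoldt_one])
    also have "(\<Sum>d | d dvd m. mangoldt d * ln (real d)) + \<dots> = (\<Sum>d | d dvd m. mangoldt d * ln (real m))"
      unfolding dconv_def sum.distrib [symmetric]
    proof (intro sum.cong refl)
      fix d assume "d \<in> {d. d dvd m}"
      then obtain e where e: "m = d * e" by auto
      hence "d > 0" "e > 0" using m by auto
      thus "mangoldt d * ln (real d) + mangoldt d * ln (real (m div d)) = mangoldt d * ln (real m)"
        by (simp add: e ln_mult algebra_simps)
    qed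
    also have "\<dots> = (\<Sum>d | d dvd m. mangoldt d) * ln (real m)" by (simp add: sum_distrib_right)
    also have "\<dots> = (ln (real m))\<^sup>2"
      using mangoldt_sum[of m, where ?'a = real] m by (simp add: power2_eq_square)
    finally show ?thesis .
  qed
  have "?g n = dconv (\<lambda>d. if d = 1 then 1 else 0) ?g n" by (rule dconv_unit[OF n, symmetric])
  also have "\<dots> = dconv (dconv (\<lambda>d. moebius d * chi d) chi) ?g n"
    by (rule dconv_cong[OF n _ refl]) (rule dconv_moebius_chi [symmetric])
  also have "\<dots> = dconv (\<lambda>d. moebius d * chi d) (dconv chi ?g) n" by (rule dconv_assoc[OF n])
  also have "\<dots> = dconv (\<lambda>d. moebius d * chi d) (\<lambda>m. chi m * (ln (real m))\<^sup>2) n"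
    by (rule dconv_cong[OF n refl sq])
  finally show ?thesis .
qed

text \<open>Expanding through log^2 leaves inner sums of size 2 q log^2 (M / d), which add up to O(q
  M). The bound is linear in q and loses no logarithm; this is what allows l to grow with M in the
  moments.\<close>

lemma sum_selberg_mangoldt_chi_le: "\<bar>\<Sum>n=1..M. selberg_mangoldt n * chi n\<bar> \<le> 64 * q * real M"
proof -
  have q0: "q \<ge> 0" using partial_sums[of 0] by simp
  have B: "\<bar>\<Sum>m=1..y. chi m * (ln (real m))\<^sup>2\<bar> \<le> 2 * q * (ln (real y))\<^sup>2" for y
  proof (cases "y \<ge> 1")
    case True
    show ?thesis
      by (rule increasing_weight_bound[OF partial_sums _ _ True]) (auto intro!: power_mono)
  qed (auto simp: not_le)
  have "(\<Sum>n=1..M. selberg_mangoldt n * chi n) = (\<Sum>n=1..M. dconv (\<lambda>d. moebius d * chi d) (\<lambda>m. chi m * (ln (real m))\<^sup>2) n)"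
    by (intro sum.cong refl selberg_mangoldt_chi_eq) auto
  also have "\<dots> = (\<Sum>d=1..M. (moebius d * chi d) * (\<Sum>m=1..M div d. chi m * (ln (real m))\<^sup>2))"
    by (rule sum_dconv)
  also have "\<bar>\<dots>\<bar> \<le> (\<Sum>d=1..M. \<bar>(moebius d * chi d) * (\<Sum>m=1..M div d. chi m * (ln (real m))\<^sup>2)\<bar>)"
    by (rule sum_abs)
  also have "\<dots> \<le> (\<Sum>d=1..M. 1 * (2 * q * (ln (real (M div d)))\<^sup>2))"
  proof (rule sum_mono)
    fix d
    have "\<bar>moebius d * chi d\<bar> \<le> 1" unfolding abs_mult by (intro mult_le_one abs_moebius_le abs_chi_le) auto
    thus "\<bar>(moebius d * chi d) * (\<Sum>m=1..M div d. chi m * (ln (real m))\<^sup>2)\<bar> \<le> 1 * (2 * q * (ln (real (M div d)))\<^sup>2)"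
      unfolding abs_mult[of "moebius d * chi d"] by (intro mult_mono B) auto
  qed
  also have "\<dots> = 2 * q * (\<Sum>d=1..M. (ln (real (M div d)))\<^sup>2)" by (simp add: sum_distrib_left)
  also have "\<dots> \<le> 2 * q * (32 * real M)" using q0 by (intro mult_left_mono sum_ln_div_sq_le) auto
  finally show ?thesis by simp
qed

end

section \<open>Moments of character sums\<close>

lemma card_divisors_mult_le:
  assumes "a > 0" "b > (0::nat)"
  shows "card {d. d dvd a * b} \<le> card {d. d dvd a} * card {d. d dvd b}"
proof -
  have "{d. d dvd a * b} \<subseteq> (\<lambda>(x, y). x * y) ` ({d. d dvd a} \<times> {d. d dvd b})"
    by (force dest: division_decomp)
  hence "card {d. d dvd a * b} \<le> card ((\<lambda>(x, y). x * y) ` ({d. d dvd a} \<times> {d. d dvd b}))"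
    using assms by (intro card_mono) (auto simp: finite_divisors_nat)
  also have "\<dots> \<le> card ({d. d dvd a} \<times> {d. d dvd b})"
    using assms by (intro card_image_le) (auto simp: finite_divisors_nat)
  finally show ?thesis by (simp add: card_cartesian_product)
qed

lemma card_divisors_prime_power: "prime p \<Longrightarrow> card {d::nat. d dvd p ^ k} = k + 1"
proof -
  assume p: "prime p"
  have "{d. d dvd p ^ k} = (\<lambda>i. p ^ i) ` {..k}" using divides_primepow_nat[OF p] by auto
  moreover have "inj_on (\<lambda>i. p ^ i) {..k}" using prime_gt_1_nat[OF p] by (auto simp: inj_on_def)
  ultimately show ?thesis by (simp add: card_image)
qed

text \<open>The divisor count over n^eta is a product over primes of (k + 1) / p^(k eta). For p >=
  2^(1/eta) the factor is at most 1, and each of the finitely many smaller primes contributes at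
  most K.\<close>

theorem divisor_bound:
  assumes \<eta>: "\<eta> > 0"
  shows "\<exists>C\<ge>1. \<forall>n>0. real (card {d. d dvd n}) \<le> C * real n powr \<eta>"
proof -
  \<comment> \<open>K eta log 2 >= 1 together with K >= 1 gives k + 1 <= K exp (k eta log 2) for all
    k.\<close>
  define K where "K = max 1 (1 / (\<eta> * ln 2))"
  have K1: "K \<ge> 1" by (simp add: K_def)
  have K2: "K * (\<eta> * ln 2) \<ge> 1"
  proof -
    have "1 / (\<eta> * ln 2) * (\<eta> * ln 2) \<le> K * (\<eta> * ln 2)"
      using \<eta> by (intro mult_right_mono) (auto simp: K_def)
    thus ?thesis using \<eta> by simp
  qed
  define Q where "Q = nat \<lceil>2 powr (1 / \<eta>)\<rceil>"
  have Q: "2 powr (1 / \<eta>) \<le> real Q" unfolding Q_def by (rule real_nat_ceiling_ge)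
  define c where "c = (\<lambda>p. if p < Q then K else 1)"
  have pp: "real (k + 1) \<le> c p * real (p ^ k) powr \<eta>" if p: "prime p" for p k
  proof -
    have p2: "real p \<ge> 2" using prime_ge_2_nat[OF p] by simp
    have pk: "real (p ^ k) powr \<eta> = exp (real k * (\<eta> * ln (real p)))"
      using p2 by (simp add: powr_def ln_realpow mult_ac)
    show ?thesis
    proof (cases "p < Q")
      case True
      have "real k * 1 \<le> real k * (K * (\<eta> * ln 2))" by (intro mult_left_mono K2) auto
      hence "real (k + 1) \<le> K * (1 + real k * (\<eta> * ln 2))" using K1 by (simp add: algebra_simps)
      also have "1 + real k * (\<eta> * ln 2) \<le> exp (real k * (\<eta> * ln 2))" by (rule exp_ge_add_one_self)
      also have "real k * (\<eta> * ln 2) \<le> real k * (\<eta> * ln (real p))"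
        using \<eta> p2 by (intro mult_left_mono) auto
      finally show ?thesis using True K1 unfolding pk by (simp add: c_def mult_left_mono)
    next
      case False
      hence "2 powr (1 / \<eta>) \<le> real p" using Q by simp
      hence "(2 powr (1 / \<eta>)) powr \<eta> \<le> real p powr \<eta>" using \<eta> by (intro powr_mono2) auto
      hence two: "2 \<le> real p powr \<eta>" using \<eta> by (simp add: powr_powr)
      have "real (k + 1) \<le> 2 ^ k" by (induction k) auto
      also have "\<dots> \<le> (real p powr \<eta>) ^ k" by (intro power_mono two) auto
      also have "\<dots> = real (p ^ k) powr \<eta>" using p2 by (simp add: powr_power powr_realpow [symmetric] powr_powr mult.commute)
      finally show ?thesis using False by (simp add: c_def)
    qed
  qed
  have "real (card {d. d dvd (\<Prod>p\<in>A. p ^ e p)}) \<le> (\<Prod>p\<in>A. c p) * real (\<Prod>p\<in>A. p ^ e p) powr \<eta>"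
    if "finite A" "\<And>p. p \<in> A \<Longrightarrow> prime p" for A and e :: "nat \<Rightarrow> nat"
    using that
  proof (induction A rule: finite_induct)
    case (insert p A)
    have pos: "p ^ e p > 0" "(\<Prod>p\<in>A. p ^ e p) > 0" using insert.prems by (auto intro!: prod_pos simp: prime_gt_0_nat)
    have "real (card {d. d dvd (\<Prod>p\<in>insert p A. p ^ e p)}) = real (card {d. d dvd p ^ e p * (\<Prod>p\<in>A. p ^ e p)})"
      using insert.hyps by simp
    also have "\<dots> \<le> real (card {d. d dvd p ^ e p} * card {d. d dvd (\<Prod>p\<in>A. p ^ e p)})"
      by (rule of_nat_mono[OF card_divisors_mult_le[OF pos]])
    also have "\<dots> = real (e p + 1) * real (card {d. d dvd (\<Prod>p\<in>A. p ^ e p)})"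
      using insert.prems by (simp add: card_divisors_prime_power algebra_simps)
    also have "\<dots> \<le> (c p * real (p ^ e p) powr \<eta>) * ((\<Prod>p\<in>A. c p) * real (\<Prod>p\<in>A. p ^ e p) powr \<eta>)"
      using insert K1 by (intro mult_mono pp insert.IH) (auto simp: c_def)
    also have "\<dots> = (\<Prod>p\<in>insert p A. c p) * real (\<Prod>p\<in>insert p A. p ^ e p) powr \<eta>"
      using insert.hyps by (simp add: powr_mult prod_nonneg mult_ac)
    finally show ?case .
  qed simp
  note prod_bound = this
  have "real (card {d. d dvd n}) \<le> K ^ Q * real n powr \<eta>" if n: "n > 0" for n
  proof -
    have e: "(\<Prod>p\<in>prime_factors n. p ^ multiplicity p n) = n" by (rule prime_factorization_nat[OF n, symmetric])
    have "real (card {d. d dvd n}) \<le> (\<Prod>p\<in>prime_factors n. c p) * real n powr \<eta>"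
      using prod_bound[of "prime_factors n" "\<lambda>p. multiplicity p n", OF finite_set_mset in_prime_factors_imp_prime]
      unfolding e .
    also have "(\<Prod>p\<in>prime_factors n. c p) = K ^ card (prime_factors n \<inter> {p. p < Q})"
      unfolding c_def by (subst prod.If_cases) auto
    also have "\<dots> \<le> K ^ Q"
    proof (rule power_increasing[OF _ K1])
      have "card (prime_factors n \<inter> {p. p < Q}) \<le> card {..<Q}" by (intro card_mono) auto
      thus "card (prime_factors n \<inter> {p. p < Q}) \<le> Q" by simp
    qed
    finally show ?thesis by (simp add: mult_right_mono)
  qed
  moreover have "K ^ Q \<ge> 1" using K1 by (rule one_le_power)
  ultimately show ?thesis by blast
qed

definition tuples :: "nat \<Rightarrow> nat \<Rightarrow> (nat \<Rightarrow> nat) set" where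
  "tuples k l = PiE {..<k} (\<lambda>_. {1..l})"

text \<open>A 2k-tuple is kept as two halves: moments need all 2k-tuples with square product, while
  duality needs pairs of k-tuples with equal products, which are among them.\<close>

definition square_pairs :: "nat \<Rightarrow> nat \<Rightarrow> ((nat \<Rightarrow> nat) \<times> (nat \<Rightarrow> nat)) set" where
  "square_pairs k l = {x \<in> tuples k l \<times> tuples k l. is_nth_power 2 ((\<Prod>i<k. fst x i) * (\<Prod>i<k. snd x i))}"

lemma finite_tuples [simp]: "finite (tuples k l)"
  by (simp add: tuples_def finite_PiE)

lemma card_tuples: "card (tuples k l) = l ^ k"
  by (simp add: tuples_def card_PiE)

lemma tuples_prod_bounds:
  assumes "g \<in> tuples k l"
  shows "(\<Prod>i<k. g i) > 0" "(\<Prod>i<k. g i) \<le> l ^ k"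
proof -
  have g: "1 \<le> g i \<and> g i \<le> l" if "i < k" for i using assms that by (auto simp: tuples_def PiE_iff)
  show "(\<Prod>i<k. g i) > 0" by (intro prod_pos) (use g in force)
  have "(\<Prod>i<k. g i) \<le> (\<Prod>i<k. l)" by (intro prod_mono) (use g in auto)
  thus "(\<Prod>i<k. g i) \<le> l ^ k" by simp
qed

lemma power_sum_tuples: "(\<Sum>n=1..l. f n :: real) ^ k = (\<Sum>g\<in>tuples k l. \<Prod>i<k. f (g i))"
proof -
  have "(\<Prod>i<k. \<Sum>n=1..l. f n) = (\<Sum>g\<in>tuples k l. \<Prod>i<k. f (g i))"
    unfolding tuples_def by (rule prod_sum_PiE) auto
  thus ?thesis by simp
qed

text \<open>The product is m^2 with m <= l^k, and every entry divides m^2. So there are l^k choices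
  of m, and for each at most d(m^2)^(2k) choices of the entries, which is O(sqrt l) by the divisor
  bound.\<close>

lemma card_square_pairs_le:
  assumes k: "k > 0"
  shows "\<exists>C>0. \<forall>l\<ge>1. real (card (square_pairs k l)) \<le> C * real l ^ k * sqrt (real l)"
proof -
  \<comment> \<open>As m^2 <= l^(2k), this choice makes (m^2)^eta to the power 2k at most l^(4 k^2
    eta) = l^(1/2).\<close>
  define \<eta> where "\<eta> = 1 / (8 * real k ^ 2)"
  have \<eta>: "\<eta> > 0" using k by (simp add: \<eta>_def)
  obtain C where C: "C \<ge> 1" "\<And>n. n > 0 \<Longrightarrow> real (card {d. d dvd n}) \<le> C * real n powr \<eta>"
    using divisor_bound[OF \<eta>] by blast
  have "real (card (square_pairs k l)) \<le> C ^ (2 * k) * real l ^ k * sqrt (real l)" if l: "l \<ge> 1" for l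
  proof -
    define D where "D = (\<lambda>m::nat. PiE {..<k} (\<lambda>_. {d. d dvd m\<^sup>2}))"
    have cover: "square_pairs k l \<subseteq> (\<Union>m\<in>{1..l ^ k}. D m \<times> D m)"
    proof
      fix x assume x: "x \<in> square_pairs k l"
      obtain g h where gh: "x = (g, h)" by (cases x)
      have t: "g \<in> tuples k l" "h \<in> tuples k l" using x by (auto simp: square_pairs_def gh)
      obtain m where m: "(\<Prod>i<k. g i) * (\<Prod>i<k. h i) = m\<^sup>2"
        using x by (auto simp: square_pairs_def gh is_nth_power_def)
      note b = tuples_prod_bounds[OF t(1)] tuples_prod_bounds[OF t(2)]
      have "m\<^sup>2 > 0" using b m by (metis nat_0_less_mult_iff)
      hence m0: "m > 0" by (auto intro: Nat.gr0I)
      have "m\<^sup>2 \<le> l ^ k * l ^ k" unfolding m [symmetric] by (intro mult_mono b) auto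
      hence ml: "m \<le> l ^ k" by (metis power2_eq_square power2_nat_le_eq_le)
      have gd: "g i dvd m\<^sup>2" if "i < k" for i
        unfolding m [symmetric] using dvd_prodI[of "{..<k}" i g] that by (intro dvd_mult2) simp
      have hd: "h i dvd m\<^sup>2" if "i < k" for i
        unfolding m [symmetric] using dvd_prodI[of "{..<k}" i h] that by (intro dvd_mult) simp
      have "g \<in> D m" "h \<in> D m" using t gd hd by (auto simp: D_def tuples_def PiE_iff)
      thus "x \<in> (\<Union>m\<in>{1..l ^ k}. D m \<times> D m)" using m0 ml by (auto simp: gh)
    qed
    have finD: "finite (D m)" if "m \<in> {1..l ^ k}" for m
      using that unfolding D_def by (intro finite_PiE) (auto simp: finite_divisors_nat)
    have cardD: "real (card (D m \<times> D m)) \<le> C ^ (2 * k) * sqrt (real l)" if m: "m \<in> {1..l ^ k}" for m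
    proof -
      have "real (card (D m \<times> D m)) = real (card {d. d dvd m\<^sup>2}) ^ (2 * k)"
        by (simp add: D_def card_cartesian_product card_PiE mult_2 power_add)
      also have "\<dots> \<le> (C * real (m\<^sup>2) powr \<eta>) ^ (2 * k)"
        using m by (intro power_mono C) auto
      also have "\<dots> = C ^ (2 * k) * (real (m\<^sup>2) powr \<eta>) ^ (2 * k)" by (simp add: power_mult_distrib)
      also have "(real (m\<^sup>2) powr \<eta>) ^ (2 * k) \<le> sqrt (real l)"
      proof -
        have "m\<^sup>2 \<le> (l ^ k)\<^sup>2" using m by (intro power_mono) auto
        also have "(l ^ k)\<^sup>2 = l ^ (2 * k)" by (simp add: power_mult [symmetric] mult.commute)
        finally have "real (m\<^sup>2) \<le> real (l ^ (2 * k))" by (simp only: of_nat_le_iff)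
        also have "real (l ^ (2 * k)) = real l powr real (2 * k)" using l by (subst powr_realpow) auto
        also have "real (2 * k) = 2 * real k" by simp
        finally have "real (m\<^sup>2) \<le> real l powr (2 * real k)" .
        hence "real (m\<^sup>2) powr \<eta> \<le> (real l powr (2 * real k)) powr \<eta>" using \<eta> by (intro powr_mono2) auto
        hence "(real (m\<^sup>2) powr \<eta>) ^ (2 * k) \<le> ((real l powr (2 * real k)) powr \<eta>) ^ (2 * k)"
          by (intro power_mono) auto
        also have "\<dots> = real l powr (2 * real k * \<eta> * real (2 * k))" using l by (simp add: powr_powr powr_power mult_ac)
        also have "2 * real k * \<eta> * real (2 * k) = 1 / 2" using k by (simp add: \<eta>_def power2_eq_square)
        also have "real l powr (1 / 2) = sqrt (real l)" by (rule powr_half_sqrt) simp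
        finally show ?thesis .
      qed
      finally show ?thesis using C(1) by (simp add: mult_left_mono)
    qed
    have "card (square_pairs k l) \<le> card (\<Union>m\<in>{1..l ^ k}. D m \<times> D m)"
      using finD by (intro card_mono cover) auto
    also have "\<dots> \<le> (\<Sum>m\<in>{1..l ^ k}. card (D m \<times> D m))" by (rule card_UN_le) auto
    finally have "real (card (square_pairs k l)) \<le> real (\<Sum>m\<in>{1..l ^ k}. card (D m \<times> D m))"
      by (simp only: of_nat_le_iff)
    also have "\<dots> = (\<Sum>m\<in>{1..l ^ k}. real (card (D m \<times> D m)))" by (rule of_nat_sum)
    also have "\<dots> \<le> (\<Sum>m\<in>{1..l ^ k}. C ^ (2 * k) * sqrt (real l))" by (intro sum_mono cardD)
    finally show ?thesis by (simp add: mult_ac)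
  qed
  thus ?thesis using C(1) by (intro exI[of _ "C ^ (2 * k)"]) auto
qed

definition jac_sum :: "nat \<Rightarrow> nat \<Rightarrow> real" where
  "jac_sum l m = (\<Sum>n=1..l. jac n m)"

lemma jac_sum_power_eq: "jac_sum l m ^ k = (\<Sum>g\<in>tuples k l. jac (\<Prod>i<k. g i) m)"
  unfolding jac_sum_def power_sum_tuples
  by (intro sum.cong refl jac_prod_left [symmetric]) (force simp: tuples_def PiE_iff)

lemma abs_jac_le: "\<bar>jac n m\<bar> \<le> 1"
  using jac_values[of n m] by auto

text \<open>The power is expanded over 2k-tuples. A square product contributes at most the whole
  weight; a non-square product is some N <= l^(2k) and contributes at most B N, and there are l^(2k)
  tuples in all. The weight is general so that both the constant 1 and Selberg's function can be
  inserted.\<close>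

lemma weighted_moment_bound:
  fixes w :: "nat \<Rightarrow> real"
  assumes w: "\<And>m. w m \<ge> 0" and B: "B \<ge> 0"
    and le: "\<And>n. n > 0 \<Longrightarrow> \<not> is_nth_power 2 n \<Longrightarrow> \<bar>\<Sum>m=1..M. w m * jac n m\<bar> \<le> B * real n"
  shows "(\<Sum>m=1..M. w m * jac_sum l m ^ (2 * k)) \<le>
    real (card (square_pairs k l)) * (\<Sum>m=1..M. w m) + B * real l ^ (4 * k)"
proof -
  define N where "N = (\<lambda>x::(nat \<Rightarrow> nat) \<times> (nat \<Rightarrow> nat). (\<Prod>i<k. fst x i) * (\<Prod>i<k. snd x i))"
  define W where "W = (\<Sum>m=1..M. w m)"
  define T where "T = tuples k l \<times> tuples k l"
  have Npos: "N x > 0" and Nle: "N x \<le> l ^ (2 * k)" if "x \<in> T" for x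
  proof -
    have t: "fst x \<in> tuples k l" "snd x \<in> tuples k l" using that by (auto simp: T_def)
    note b = tuples_prod_bounds[OF t(1)] tuples_prod_bounds[OF t(2)]
    show "N x > 0" unfolding N_def using b by simp
    have "N x \<le> l ^ k * l ^ k" unfolding N_def by (intro mult_mono b) auto
    thus "N x \<le> l ^ (2 * k)" by (simp add: mult_2 power_add)
  qed
  have eq: "jac_sum l m ^ (2 * k) = (\<Sum>x\<in>T. jac (N x) m)" for m
  proof -
    have "jac_sum l m ^ (2 * k) = jac_sum l m ^ k * jac_sum l m ^ k" by (simp add: mult_2 power_add)
    also have "\<dots> = (\<Sum>x\<in>T. jac (\<Prod>i<k. fst x i) m * jac (\<Prod>i<k. snd x i) m)"
      unfolding jac_sum_power_eq T_def by (simp add: sum_product sum.cartesian_product case_prod_unfold)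
    also have "\<dots> = (\<Sum>x\<in>T. jac (N x) m)"
    proof (intro sum.cong refl)
      fix x assume "x \<in> T"
      hence t: "fst x \<in> tuples k l" "snd x \<in> tuples k l" by (auto simp: T_def)
      show "jac (\<Prod>i<k. fst x i) m * jac (\<Prod>i<k. snd x i) m = jac (N x) m"
        unfolding N_def by (rule jac_mult_left [symmetric]) (use tuples_prod_bounds t in auto)
    qed
    finally show ?thesis .
  qed
  have "(\<Sum>m=1..M. w m * jac_sum l m ^ (2 * k)) = (\<Sum>x\<in>T. \<Sum>m=1..M. w m * jac (N x) m)"
    unfolding eq sum_distrib_left by (rule sum.swap)
  also have "\<dots> \<le> (\<Sum>x\<in>T. (if x \<in> square_pairs k l then W else 0) + B * real l ^ (2 * k))"
  proof (rule sum_mono)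
    fix x assume x: "x \<in> T"
    show "(\<Sum>m=1..M. w m * jac (N x) m) \<le> (if x \<in> square_pairs k l then W else 0) + B * real l ^ (2 * k)"
    proof (cases "x \<in> square_pairs k l")
      case True
      have "(\<Sum>m=1..M. w m * jac (N x) m) \<le> (\<Sum>m=1..M. w m * 1)"
        using abs_jac_le by (intro sum_mono mult_left_mono w) (simp add: abs_le_iff)
      moreover have "B * real l ^ (2 * k) \<ge> 0" using B by simp
      ultimately show ?thesis using True by (simp add: W_def)
    next
      case False
      hence "\<not> is_nth_power 2 (N x)" using x by (auto simp: square_pairs_def T_def N_def)
      from le[OF Npos[OF x] this] have "(\<Sum>m=1..M. w m * jac (N x) m) \<le> B * real (N x)" by simp
      also have "real (N x) \<le> real (l ^ (2 * k))" using Nle[OF x] by (simp only: of_nat_le_iff)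
      finally show ?thesis using False B by (simp add: mult_left_mono)
    qed
  qed
  also have "\<dots> = real (card (square_pairs k l)) * W + real (card T) * (B * real l ^ (2 * k))"
  proof -
    have "square_pairs k l \<subseteq> T" by (auto simp: square_pairs_def T_def)
    moreover have "finite T" by (simp add: T_def)
    ultimately show ?thesis by (simp add: sum.distrib sum.If_cases Int_absorb1 Collect_mem_eq)
  qed
  also have "real (card T) * (B * real l ^ (2 * k)) = B * real l ^ (4 * k)"
    by (simp add: T_def card_cartesian_product card_tuples flip: power_add)
  finally show ?thesis by (simp add: W_def)
qed

section \<open>Primes with a large character sum\<close>

definition odd_primes_le :: "nat \<Rightarrow> nat set" where
  "odd_primes_le M = {p. prime p \<and> odd p \<and> p \<le> M}"

text \<open>Of the l inequalities that make up f(p) > l only the last is kept: a single large sum is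
  what moments detect.\<close>

definition large_sum_primes :: "real \<Rightarrow> nat \<Rightarrow> nat \<Rightarrow> nat set" where
  "large_sum_primes \<epsilon> l M = {p \<in> odd_primes_le M. jac_sum l p \<ge> \<epsilon> * real l}"

lemma odd_primes_le_subset: "odd_primes_le M \<subseteq> {1..M}"
  by (auto simp: odd_primes_le_def Suc_le_eq prime_gt_0_nat)

lemma finite_odd_primes_le [simp]: "finite (odd_primes_le M)"
  by (rule finite_subset[OF odd_primes_le_subset]) simp

lemma large_sum_primes_subset: "large_sum_primes \<epsilon> l M \<subseteq> odd_primes_le M"
  by (auto simp: large_sum_primes_def)

lemma finite_large_sum_primes [simp]: "finite (large_sum_primes \<epsilon> l M)"
  by (rule finite_subset[OF large_sum_primes_subset]) simp

lemma jac_quad_char: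
  assumes "n > 0" "\<not> is_nth_power 2 n"
  shows "quad_char (jac n) (8 * real n)"
proof -
  have "n > 1" using assms by (cases "n = 1") auto
  then interpret real_cm "jac n" by (rule jac_real_cm)
  show ?thesis by unfold_locales (rule jac_partial_sums[OF assms])
qed

text \<open>The 16th moment with constant weight: l^(17/2) M from the square tuples against 8 l^32
  from the others, the latter absorbed by l^24 <= M. Dividing by (eps l)^16 leaves l^(-15/2)
  M.\<close>

lemma card_large_sum_primes_le_trivial_weight:
  assumes \<epsilon>: "\<epsilon> > 0"
  shows "\<exists>C>0. \<forall>l\<ge>1. \<forall>M. l ^ 24 \<le> M \<longrightarrow>
    real (card (large_sum_primes \<epsilon> l M)) * real l ^ 7 * sqrt (real l) \<le> C * real M"
proof -
  obtain T where T: "T > 0" "\<And>l. l \<ge> 1 \<Longrightarrow> real (card (square_pairs 8 l)) \<le> T * real l ^ 8 * sqrt (real l)"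
    using card_square_pairs_le[of 8] by auto
  have "real (card (large_sum_primes \<epsilon> l M)) * real l ^ 7 * sqrt (real l) \<le> (T + 8) / \<epsilon> ^ 16 * real M"
    if l: "l \<ge> 1" and lM: "l ^ 24 \<le> M" for l M
  proof -
    have lM': "real l ^ 24 \<le> real M" using lM by (simp flip: of_nat_power)
    have l1: "real l \<ge> 1" using l by simp
    have s: "sqrt (real l) \<ge> 1" "sqrt (real l) * sqrt (real l) = real l" using l1 by auto
    have "real (card (large_sum_primes \<epsilon> l M)) * (\<epsilon> * real l) ^ 16 = (\<Sum>p\<in>large_sum_primes \<epsilon> l M. (\<epsilon> * real l) ^ 16)"
      by simp
    also have "\<dots> \<le> (\<Sum>p\<in>large_sum_primes \<epsilon> l M. 1 * jac_sum l p ^ (2 * 8))"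
      using \<epsilon> by (intro sum_mono) (auto simp: large_sum_primes_def intro: power_mono)
    also have "\<dots> \<le> (\<Sum>m=1..M. 1 * jac_sum l m ^ (2 * 8))"
      using large_sum_primes_subset odd_primes_le_subset by (intro sum_mono2) (blast | simp)+
    also have "\<dots> \<le> real (card (square_pairs 8 l)) * (\<Sum>m=1..M. 1) + 8 * real l ^ (4 * 8)"
      by (rule weighted_moment_bound) (use jac_partial_sums in auto)
    also have "\<dots> \<le> T * real l ^ 8 * sqrt (real l) * real M + 8 * (real l ^ 8 * sqrt (real l) * real M)"
    proof (intro add_mono mult_left_mono)
      show "real (card (square_pairs 8 l)) * (\<Sum>m=1..M. 1) \<le> T * real l ^ 8 * sqrt (real l) * real M"
        using T(2)[OF l] by (simp add: mult_right_mono)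
      have "real l ^ (4 * 8) = real l ^ 8 * 1 * real l ^ 24" by (simp flip: power_add)
      also have "\<dots> \<le> real l ^ 8 * sqrt (real l) * real M"
        using lM' s l1 by (intro mult_mono) auto
      finally show "real l ^ (4 * 8) \<le> real l ^ 8 * sqrt (real l) * real M" .
    qed auto
    finally have *: "real (card (large_sum_primes \<epsilon> l M)) * (\<epsilon> * real l) ^ 16 \<le> (T + 8) * (real l ^ 8 * sqrt (real l) * real M)"
      by (simp add: algebra_simps)
    have "(real (card (large_sum_primes \<epsilon> l M)) * real l ^ 7 * sqrt (real l) * \<epsilon> ^ 16) * (real l ^ 8 * sqrt (real l)) =
        real (card (large_sum_primes \<epsilon> l M)) * real l ^ 15 * \<epsilon> ^ 16 * (sqrt (real l) * sqrt (real l))"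
      by (simp add: mult_ac flip: power_add)
    also have "\<dots> = real (card (large_sum_primes \<epsilon> l M)) * (\<epsilon> * real l) ^ 16"
      unfolding s(2) by (simp add: power_mult_distrib mult_ac power_Suc2 [symmetric] del: power_Suc) (simp add: eval_nat_numeral)
    also have "\<dots> \<le> ((T + 8) * real M) * (real l ^ 8 * sqrt (real l))" using * by (simp add: mult_ac)
    finally have "real (card (large_sum_primes \<epsilon> l M)) * real l ^ 7 * sqrt (real l) * \<epsilon> ^ 16 \<le> (T + 8) * real M"
      by (rule mult_right_le_imp_le) (use l1 s in auto)
    thus ?thesis using \<epsilon> by (simp add: field_simps)
  qed
  thus ?thesis using T(1) \<epsilon> by (intro exI[of _ "(T + 8) / \<epsilon> ^ 16"]) auto
qed

text \<open>The fourth moment with Selberg's weight, which is at least (log M)^2 / 4 at primes above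
  sqrt M while its total is O(M log M). The error 512 M l^8, where 512 = 64 * 8 comes from the
  twisted sums with q = 8 n, is absorbed by l^6 <= log M.\<close>

lemma card_large_sum_primes_le_selberg_weight:
  assumes \<epsilon>: "\<epsilon> > 0"
  shows "\<exists>C>0. \<forall>l\<ge>1. \<forall>M\<ge>3. real l ^ 6 \<le> ln (real M) \<longrightarrow>
    real (card (large_sum_primes \<epsilon> l M)) * real l * sqrt (real l) * ln (real M) \<le> C * real M"
proof -
  obtain T where T: "T > 0" "\<And>l. l \<ge> 1 \<Longrightarrow> real (card (square_pairs 2 l)) \<le> T * real l ^ 2 * sqrt (real l)"
    using card_square_pairs_le[of 2] by auto
  have "real (card (large_sum_primes \<epsilon> l M)) * real l * sqrt (real l) * ln (real M) \<le> ((96 * T + 2048) / \<epsilon> ^ 4 + 64) * real M"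
    if l: "l \<ge> 1" and M3: "M \<ge> 3" and lM: "real l ^ 6 \<le> ln (real M)" for l M
  proof -
    define L where "L = ln (real M)"
    have l1: "real l \<ge> 1" using l by simp
    have s: "sqrt (real l) \<ge> 1" "sqrt (real l) * sqrt (real l) = real l" using l1 by auto
    have L1: "L \<ge> 1"
    proof -
      have "1 \<le> real l ^ 6" using l1 by (rule one_le_power)
      thus ?thesis using lM by (simp add: L_def)
    qed
    have Mpos: "real M > 0" using M3 by simp
    define P where "P = {p \<in> large_sum_primes \<epsilon> l M. sqrt (real M) < real p}"
    have Psub: "P \<subseteq> large_sum_primes \<epsilon> l M" by (auto simp: P_def)
    have finP: "finite P" by (rule finite_subset[OF Psub]) simp
    have "real (card P) * (L\<^sup>2 / 4 * (\<epsilon> * real l) ^ 4) = (\<Sum>p\<in>P. L\<^sup>2 / 4 * (\<epsilon> * real l) ^ 4)" by simp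
    also have "\<dots> \<le> (\<Sum>p\<in>P. selberg_mangoldt p * jac_sum l p ^ (2 * 2))"
    proof (rule sum_mono)
      fix p assume p: "p \<in> P"
      have pr: "prime p" and ps: "sqrt (real M) < real p" and js: "jac_sum l p \<ge> \<epsilon> * real l"
        using p by (auto simp: P_def large_sum_primes_def odd_primes_le_def)
      have "L / 2 = ln (sqrt (real M))" using Mpos by (simp add: L_def ln_sqrt)
      also have "\<dots> \<le> ln (real p)" using ps Mpos prime_gt_0_nat[OF pr] by (subst ln_le_cancel_iff) auto
      finally have "(L / 2)\<^sup>2 \<le> (ln (real p))\<^sup>2" using L1 by (intro power_mono) auto
      also have "\<dots> \<le> selberg_mangoldt p" by (rule selberg_mangoldt_prime[OF pr])
      finally have "L\<^sup>2 / 4 \<le> selberg_mangoldt p" by (simp add: power_divide)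
      moreover have "(\<epsilon> * real l) ^ 4 \<le> jac_sum l p ^ (2 * 2)" using js \<epsilon> by (simp add: power_mono)
      ultimately show "L\<^sup>2 / 4 * (\<epsilon> * real l) ^ 4 \<le> selberg_mangoldt p * jac_sum l p ^ (2 * 2)"
        using \<epsilon> by (intro mult_mono selberg_mangoldt_nonneg) auto
    qed
    also have "\<dots> \<le> (\<Sum>m=1..M. selberg_mangoldt m * jac_sum l m ^ (2 * 2))"
    proof (rule sum_mono2)
      show "P \<subseteq> {1..M}" using Psub large_sum_primes_subset odd_primes_le_subset by blast
      show "0 \<le> selberg_mangoldt m * jac_sum l m ^ (2 * 2)" for m
        by (intro mult_nonneg_nonneg selberg_mangoldt_nonneg) (simp add: power_mult)
    qed simp
    also have "\<dots> \<le> real (card (square_pairs 2 l)) * (\<Sum>m=1..M. selberg_mangoldt m) + 512 * real M * real l ^ (4 * 2)"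
    proof (rule weighted_moment_bound)
      fix n :: nat assume n: "n > 0" "\<not> is_nth_power 2 n"
      interpret quad_char "jac n" "8 * real n" by (rule jac_quad_char[OF n])
      show "\<bar>\<Sum>m=1..M. selberg_mangoldt m * jac n m\<bar> \<le> 512 * real M * real n"
        using sum_selberg_mangoldt_chi_le[of M] by (simp add: mult_ac)
    qed (auto simp: selberg_mangoldt_nonneg)
    also have "\<dots> \<le> (T * real l ^ 2 * sqrt (real l)) * (24 * real M * L) + 512 * real M * (real l ^ 2 * sqrt (real l) * L)"
    proof (intro add_mono mult_mono T(2)[OF l] mult_left_mono)
      have "(\<Sum>m=1..M. selberg_mangoldt m) \<le> 8 * real M * L + 16 * real M"
        unfolding L_def by (rule sum_selberg_mangoldt_le) (use M3 in simp)
      also have "16 * real M * 1 \<le> 16 * real M * L" using L1 by (intro mult_left_mono) auto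
      hence "8 * real M * L + 16 * real M \<le> 24 * real M * L" by (simp add: algebra_simps)
      finally show "(\<Sum>m=1..M. selberg_mangoldt m) \<le> 24 * real M * L" .
      have "real l ^ (4 * 2) = real l ^ 2 * 1 * real l ^ 6" by (simp flip: power_add)
      also have "\<dots> \<le> real l ^ 2 * sqrt (real l) * L" unfolding L_def using s l1 lM by (intro mult_mono) auto
      finally show "real l ^ (4 * 2) \<le> real l ^ 2 * sqrt (real l) * L" .
    qed (use T(1) in \<open>auto intro!: sum_nonneg selberg_mangoldt_nonneg\<close>)
    also have "\<dots> = ((24 * T + 512) * real M) * (real l ^ 2 * sqrt (real l) * L)" by (simp add: algebra_simps)
    finally have *: "real (card P) * (L\<^sup>2 / 4 * (\<epsilon> * real l) ^ 4) \<le> ((24 * T + 512) * real M) * (real l ^ 2 * sqrt (real l) * L)" .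
    have "(real (card P) * real l * sqrt (real l) * L * (\<epsilon> ^ 4 / 4)) * (real l ^ 2 * sqrt (real l) * L)
        = real (card P) * real l * (sqrt (real l) * sqrt (real l)) * real l ^ 2 * (L\<^sup>2 / 4) * \<epsilon> ^ 4"
      by (simp add: power2_eq_square mult_ac)
    also have "\<dots> = real (card P) * (L\<^sup>2 / 4 * (\<epsilon> * real l) ^ 4)"
      unfolding s(2) by (simp add: power_mult_distrib power2_eq_square power4_eq_xxxx mult_ac)
    also note *
    finally have "(real (card P) * real l * sqrt (real l) * L * (\<epsilon> ^ 4 / 4)) * (real l ^ 2 * sqrt (real l) * L)
       \<le> ((24 * T + 512) * real M) * (real l ^ 2 * sqrt (real l) * L)" .
    hence "real (card P) * real l * sqrt (real l) * L * (\<epsilon> ^ 4 / 4) \<le> (24 * T + 512) * real M"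
      by (rule mult_right_le_imp_le) (use l1 s L1 in auto)
    hence main: "real (card P) * real l * sqrt (real l) * L \<le> (96 * T + 2048) / \<epsilon> ^ 4 * real M"
      using \<epsilon> by (simp add: field_simps)
    have small: "real (card (large_sum_primes \<epsilon> l M - P)) \<le> sqrt (real M)"
    proof -
      have "large_sum_primes \<epsilon> l M - P \<subseteq> {1..nat \<lfloor>sqrt (real M)\<rfloor>}"
        using large_sum_primes_subset odd_primes_le_subset
        by (force simp: P_def le_nat_floor not_less)
      hence "card (large_sum_primes \<epsilon> l M - P) \<le> nat \<lfloor>sqrt (real M)\<rfloor>"
        using card_mono[of "{1..nat \<lfloor>sqrt (real M)\<rfloor>}"] by simp
      hence "real (card (large_sum_primes \<epsilon> l M - P)) \<le> real (nat \<lfloor>sqrt (real M)\<rfloor>)" by (simp only: of_nat_le_iff)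
      also have "\<dots> \<le> sqrt (real M)" by (rule of_nat_floor) simp
      finally show ?thesis .
    qed
    \<comment> \<open>The primes up to sqrt M are counted trivially: l^(3/2) log M is at most (log
      M)^2, which is O(sqrt M).\<close>
    have "sqrt (real M) * real l * sqrt (real l) * L \<le> 64 * real M"
    proof -
      have "sqrt (real l) * 1 \<le> sqrt (real l) * sqrt (real l)" using s(1) by (intro mult_left_mono) auto
      hence "sqrt (real l) \<le> real l" using s(2) by simp
      hence "real l * sqrt (real l) \<le> real l * real l" using l1 by (intro mult_left_mono) auto
      also have "\<dots> \<le> real l ^ 6" using l1 power_increasing[of 2 6 "real l"] by (simp add: power2_eq_square)
      also have "\<dots> \<le> L" using lM by (simp add: L_def)
      finally have a: "real l * sqrt (real l) \<le> L" .
      have "L \<le> real M powr (1/8) / (1/8)" unfolding L_def by (rule ln_powr_bound) (use M3 in auto)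
      hence b: "L \<le> 8 * real M powr (1/8)" by simp
      have "L * L \<le> (8 * real M powr (1/8)) * (8 * real M powr (1/8))" using b L1 by (intro mult_mono) auto
      also have "\<dots> = 64 * real M powr (1/4)" by (simp flip: powr_add)
      also have "real M powr (1/4) \<le> real M powr (1/2)" using M3 by (intro powr_mono) auto
      also have "real M powr (1/2) = sqrt (real M)" by (rule powr_half_sqrt) simp
      finally have c: "L * L \<le> 64 * sqrt (real M)" by simp
      have "sqrt (real M) * real l * sqrt (real l) * L = sqrt (real M) * ((real l * sqrt (real l)) * L)" by (simp add: mult_ac)
      also have "\<dots> \<le> sqrt (real M) * (L * L)" using a L1 by (intro mult_left_mono mult_right_mono) auto
      also have "\<dots> \<le> sqrt (real M) * (64 * sqrt (real M))" using c by (intro mult_left_mono) auto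
      also have "\<dots> = 64 * real M" by simp
      finally show ?thesis .
    qed
    moreover have "real (card (large_sum_primes \<epsilon> l M - P)) * (real l * sqrt (real l) * L) \<le> sqrt (real M) * (real l * sqrt (real l) * L)"
      using small L1 by (intro mult_right_mono) auto
    ultimately have small': "real (card (large_sum_primes \<epsilon> l M - P)) * (real l * sqrt (real l) * L) \<le> 64 * real M"
      by (simp add: mult_ac)
    have "card (large_sum_primes \<epsilon> l M) = card P + card (large_sum_primes \<epsilon> l M - P)"
      using card_Diff_subset[OF finP Psub] card_mono[OF _ Psub] by simp
    hence "real (card (large_sum_primes \<epsilon> l M)) * real l * sqrt (real l) * L =
       real (card P) * real l * sqrt (real l) * L + real (card (large_sum_primes \<epsilon> l M - P)) * (real l * sqrt (real l) * L)"
      by (simp add: algebra_simps)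
    also have "\<dots> \<le> (96 * T + 2048) / \<epsilon> ^ 4 * real M + 64 * real M" by (intro add_mono main small')
    finally show ?thesis by (simp add: L_def algebra_simps)
  qed
  thus ?thesis using T(1) \<epsilon> by (intro exI[of _ "(96 * T + 2048) / \<epsilon> ^ 4 + 64"]) (auto intro!: add_pos_pos divide_pos_pos)
qed

theorem card_large_sum_primes_le:
  assumes \<epsilon>: "\<epsilon> > 0"
  shows "\<exists>C>0. \<forall>l\<ge>1. \<forall>M\<ge>3. l ^ 24 \<le> M \<longrightarrow>
    real (card (large_sum_primes \<epsilon> l M)) * ln (real M) / real M \<le> C * real l powr (-3/2)"
proof -
  obtain C1 where C1: "C1 > 0" "\<And>l M. l \<ge> 1 \<Longrightarrow> l ^ 24 \<le> M \<Longrightarrow>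
     real (card (large_sum_primes \<epsilon> l M)) * real l ^ 7 * sqrt (real l) \<le> C1 * real M"
    using card_large_sum_primes_le_trivial_weight[OF \<epsilon>] by blast
  obtain C2 where C2: "C2 > 0" "\<And>l M. l \<ge> 1 \<Longrightarrow> M \<ge> 3 \<Longrightarrow> real l ^ 6 \<le> ln (real M) \<Longrightarrow>
     real (card (large_sum_primes \<epsilon> l M)) * real l * sqrt (real l) * ln (real M) \<le> C2 * real M"
    using card_large_sum_primes_le_selberg_weight[OF \<epsilon>] by blast
  have "real (card (large_sum_primes \<epsilon> l M)) * ln (real M) / real M \<le> (C1 + C2) * real l powr (-3/2)"
    if l: "l \<ge> 1" and M: "M \<ge> 3" and lM: "l ^ 24 \<le> M" for l M
  proof -
    define R where "R = real (card (large_sum_primes \<epsilon> l M))"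
    have l1: "real l \<ge> 1" using l by simp
    have Mpos: "real M > 0" using M by simp
    have "R * real l * sqrt (real l) * ln (real M) \<le> (C1 + C2) * real M"
    proof (cases "real l ^ 6 \<le> ln (real M)")
      case True
      have "C1 * real M \<ge> 0" using C1(1) by simp
      thus ?thesis using C2(2)[OF l M True] by (simp add: R_def distrib_right)
    next
      case False
      \<comment> \<open>Here log M < l^6, and these six powers are taken from the l^(15/2) of the
        higher moment.\<close>
      have "R * real l * sqrt (real l) * ln (real M) \<le> R * real l * sqrt (real l) * real l ^ 6"
        using False by (intro mult_left_mono) (auto simp: R_def)
      also have "\<dots> = R * real l ^ 7 * sqrt (real l)" by (simp add: eval_nat_numeral mult_ac)
      also have "\<dots> \<le> C1 * real M" unfolding R_def by (rule C1(2)[OF l lM])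
      also have "\<dots> \<le> (C1 + C2) * real M" using C2(1) by (intro mult_right_mono) auto
      finally show ?thesis .
    qed
    hence "R * ln (real M) * (real l * sqrt (real l)) / real M \<le> (C1 + C2)"
      using Mpos by (simp add: divide_le_eq mult_ac)
    moreover have "real l powr (-3/2) = 1 / (real l * sqrt (real l))"
    proof -
      have "real l powr (3/2) = real l powr (1 + 1/2)" by simp
      also have "\<dots> = real l * sqrt (real l)" using l1 by (simp only: powr_add powr_half_sqrt) simp
      finally show ?thesis using powr_minus_divide[of "real l" "3/2"] by simp
    qed
    moreover have "real l * sqrt (real l) > 0" using l1 by simp
    ultimately show ?thesis unfolding R_def [symmetric] by (simp add: field_simps)
  qed
  thus ?thesis using C1(1) C2(1) by (intro exI[of _ "C1 + C2"]) auto
qed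

section \<open>Duality for l near the root of M\<close>

lemma Legendre_pair_partial_sums:
  assumes p: "prime p" "p > 2" and q: "prime q" "q > 2" and pq: "p \<noteq> q"
  shows "\<bar>\<Sum>n=1..N. jac n p * jac n q\<bar> \<le> real (p * q)"
proof -
  define f where "f = (\<lambda>n. real_of_int (Legendre (int n) (int p) * Legendre (int n) (int q)))"
  have pos: "p * q > 0" using p q by simp
  have per: "f (m + p * q) = f m" for m
  proof -
    have "Legendre (int (m + p * q)) (int p) = Legendre (int m) (int p)"
      "Legendre (int (m + p * q)) (int q) = Legendre (int m) (int q)"
      by (intro Legendre_mod; simp add: cong_iff_dvd_diff)+
    thus ?thesis by (simp add: f_def)
  qed
  have le: "\<bar>f m\<bar> \<le> 1" for m
    using Legendre_values[of "int m" "int p"] Legendre_values[of "int m" "int q"] by (auto simp: f_def)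
  obtain a where a: "Legendre (int a) (int p) = -1" using exists_nonresidue[OF p] by blast
  have cpq: "coprime p q" using p q pq by (simp add: primes_coprime)
  \<comment> \<open>Multiplication by u changes the sign of the symbol at p and keeps the one at q,
    so the product of the two symbols sums to 0 over a period.\<close>
  obtain u where u: "[u = a] (mod p)" "[u = 1] (mod q)"
    using binary_chinese_remainder_nat[OF cpq, of a 1] by blast
  have up: "Legendre (int u) (int p) = -1"
    using Legendre_mod[of "int u" "int a" "int p"] u(1) a by (simp add: cong_int_iff)
  have uq: "Legendre (int u) (int q) = 1"
  proof -
    have "[int u = int 1] (mod int q)" using u(2) by (simp only: cong_int_iff)
    from Legendre_mod[OF this] show ?thesis using Legendre_1[OF q(1)] by simp
  qed
  have mult: "f (u * m) = - f m" for m
    by (simp add: f_def Legendre_mult[OF p] Legendre_mult[OF q] up uq)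
  have "\<not> p dvd u" using up Legendre_eq_0_iff[of "int u" "int p"] by auto
  moreover have "\<not> q dvd u" using uq Legendre_eq_0_iff[of "int u" "int q"] by auto
  ultimately have "coprime p u" "coprime q u" using p q by (auto intro: prime_imp_coprime)
  hence cop: "coprime u (p * q)" by (simp add: coprime_commute)
  have zero: "(\<Sum>m<p * q. f m) = 0" by (rule periodic_sum_zero[OF pos per mult cop])
  have "\<bar>\<Sum>m<Suc N. f m\<bar> \<le> real (p * q)" by (rule periodic_partial_sums[OF pos per zero le])
  moreover have "(\<Sum>m<Suc N. f m) = (\<Sum>n=1..N. f n)"
  proof -
    have "f 0 = 0" using Legendre_eq_0_iff[of 0 "int p"] by (simp add: f_def)
    thus ?thesis by (simp add: lessThan_Suc_atMost atMost_atLeast0 sum.atLeast_Suc_atMost)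
  qed
  moreover have "(\<Sum>n=1..N. f n) = (\<Sum>n=1..N. jac n p * jac n q)"
    by (intro sum.cong refl) (simp add: f_def jac_Legendre[OF p] jac_Legendre[OF q])
  ultimately show ?thesis by simp
qed

text \<open>The k-th power of the sum over n <= l is a sum over n <= l^k whose coefficients count
  the tuples with product n. Summing over p in P and applying Cauchy-Schwarz separates coefficients
  from symbols. The squared coefficients count pairs of tuples with equal products; in the mean
  square of Y the diagonal gives |P| l^k and every other pair of primes at most M^2.\<close>

lemma large_values_duality:
  assumes P: "P \<subseteq> odd_primes_le M" and ge: "\<And>p. p \<in> P \<Longrightarrow> jac_sum l p \<ge> B" and B: "B \<ge> 0"
  shows "(real (card P))\<^sup>2 * B ^ (2 * k) \<le>
    real (card (square_pairs k l)) * (real (card P) * real l ^ k + (real (card P))\<^sup>2 * (real M)\<^sup>2)"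
proof -
  define N where "N = l ^ k"
  have finP: "finite P" by (rule finite_subset[OF P]) simp
  have P2: "prime p" "p > 2" "p \<le> M" if "p \<in> P" for p
  proof -
    have "p \<in> odd_primes_le M" using that P by blast
    thus "prime p" "p \<le> M" by (auto simp: odd_primes_le_def)
    moreover have "odd p" using \<open>p \<in> odd_primes_le M\<close> by (simp add: odd_primes_le_def)
    ultimately show "p > 2" using prime_ge_2_nat[of p] by (cases "p = 2") auto
  qed
  define Y where "Y = (\<lambda>n. \<Sum>p\<in>P. jac n p)"
  define fib where "fib = (\<lambda>n. {g \<in> tuples k l. (\<Prod>i<k. g i) = n})"
  have finfib: "finite (fib n)" for n by (rule finite_subset[of _ "tuples k l"]) (auto simp: fib_def)
  have "real (card P) * B ^ k = (\<Sum>p\<in>P. B ^ k)" by simp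
  also have "\<dots> \<le> (\<Sum>p\<in>P. jac_sum l p ^ k)" by (intro sum_mono power_mono ge B)
  also have "\<dots> = (\<Sum>g\<in>tuples k l. Y (\<Prod>i<k. g i))"
    unfolding jac_sum_power_eq Y_def by (rule sum.swap)
  also have "\<dots> = (\<Sum>n\<in>{1..N}. \<Sum>g\<in>fib n. Y (\<Prod>i<k. g i))"
    unfolding fib_def
    by (rule sum.group [symmetric]) (use tuples_prod_bounds in \<open>force simp: N_def Suc_le_eq\<close>)+
  also have "\<dots> = (\<Sum>n\<in>{1..N}. real (card (fib n)) * Y n)"
    by (intro sum.cong refl) (simp add: fib_def)
  finally have 1: "real (card P) * B ^ k \<le> (\<Sum>n\<in>{1..N}. real (card (fib n)) * Y n)" .
  have "(real (card P))\<^sup>2 * B ^ (2 * k) = (real (card P) * B ^ k)\<^sup>2"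
    by (simp add: power_mult_distrib power_mult [symmetric] mult.commute)
  also have "\<dots> \<le> (\<Sum>n\<in>{1..N}. real (card (fib n)) * Y n)\<^sup>2" using 1 B by (intro power_mono) auto
  also have "\<dots> \<le> (\<Sum>n\<in>{1..N}. (real (card (fib n)))\<^sup>2) * (\<Sum>n\<in>{1..N}. (Y n)\<^sup>2)"
    by (rule Cauchy_Schwarz_ineq_sum)
  also have "\<dots> \<le> real (card (square_pairs k l)) * (real (card P) * real l ^ k + (real (card P))\<^sup>2 * (real M)\<^sup>2)"
  proof (rule mult_mono)
    have "(\<Sum>n\<in>{1..N}. card (fib n \<times> fib n)) = card (\<Union>n\<in>{1..N}. fib n \<times> fib n)"
      by (rule card_UN_disjoint [symmetric]) (use finfib in \<open>auto simp: fib_def\<close>)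
    also have "\<dots> \<le> card (square_pairs k l)"
    proof (rule card_mono)
      show "finite (square_pairs k l)" by (rule finite_subset[of _ "tuples k l \<times> tuples k l"]) (auto simp: square_pairs_def)
      show "(\<Union>n\<in>{1..N}. fib n \<times> fib n) \<subseteq> square_pairs k l"
        by (auto simp: fib_def square_pairs_def is_nth_power_def power2_eq_square)
    qed
    finally have "real (\<Sum>n\<in>{1..N}. card (fib n \<times> fib n)) \<le> real (card (square_pairs k l))" by (simp only: of_nat_le_iff)
    thus "(\<Sum>n\<in>{1..N}. (real (card (fib n)))\<^sup>2) \<le> real (card (square_pairs k l))"
      by (simp add: card_cartesian_product power2_eq_square)
  next
    have "(\<Sum>n\<in>{1..N}. (Y n)\<^sup>2) = (\<Sum>n\<in>{1..N}. \<Sum>p\<in>P. \<Sum>q\<in>P. jac n p * jac n q)"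
      by (simp add: Y_def power2_eq_square sum_product)
    also have "\<dots> = (\<Sum>p\<in>P. \<Sum>n\<in>{1..N}. \<Sum>q\<in>P. jac n p * jac n q)" by (rule sum.swap)
    also have "\<dots> = (\<Sum>p\<in>P. \<Sum>q\<in>P. \<Sum>n\<in>{1..N}. jac n p * jac n q)" by (intro sum.cong refl sum.swap)
    also have "\<dots> \<le> (\<Sum>p\<in>P. \<Sum>q\<in>P. (if p = q then real N else 0) + (real M)\<^sup>2)"
    proof (intro sum_mono)
      fix p q assume pq: "p \<in> P" "q \<in> P"
      show "(\<Sum>n\<in>{1..N}. jac n p * jac n q) \<le> (if p = q then real N else 0) + (real M)\<^sup>2"
      proof (cases "p = q")
        case True
        have "(\<Sum>n\<in>{1..N}. jac n p * jac n q) \<le> (\<Sum>n\<in>{1..N}. 1)"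
        proof (rule sum_mono)
          fix n
          have "\<bar>jac n p * jac n q\<bar> \<le> 1" unfolding abs_mult by (intro mult_le_one abs_jac_le) auto
          thus "jac n p * jac n q \<le> 1" by simp
        qed
        thus ?thesis using True by (simp add: add_increasing2)
      next
        case False
        have "(\<Sum>n\<in>{1..N}. jac n p * jac n q) \<le> real (p * q)"
          using Legendre_pair_partial_sums[OF P2(1,2)[OF pq(1)] P2(1,2)[OF pq(2)] False, of N] by simp
        also have "\<dots> = real p * real q" by simp
        also have "\<dots> \<le> real M * real M" using P2(3)[OF pq(1)] P2(3)[OF pq(2)] by (intro mult_mono) auto
        finally show ?thesis using False by (simp add: power2_eq_square)
      qed
    qed
    also have "\<dots> = real (card P) * real l ^ k + (real (card P))\<^sup>2 * (real M)\<^sup>2"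
      using finP by (simp add: sum.distrib sum.delta N_def power2_eq_square algebra_simps)
    finally show "(\<Sum>n\<in>{1..N}. (Y n)\<^sup>2) \<le> real (card P) * real l ^ k + (real (card P))\<^sup>2 * (real M)\<^sup>2" .
  qed (auto intro!: sum_nonneg)
  finally show ?thesis .
qed

text \<open>Duality replaces the large sieve: for a power \<open>l\<^sup>9\<^sup>6\<close> of length at least \<open>M\<^sup>3\<close>, the trivial bound
  for the period of a product of two Legendre symbols suffices.\<close>

theorem card_large_sum_primes_le_root:
  assumes \<epsilon>: "\<epsilon> > 0"
  shows "\<exists>C>0. \<exists>M0. \<forall>M\<ge>M0. \<forall>l\<ge>1. l ^ 24 \<le> M \<longrightarrow> M \<le> (2 * l) ^ 24 \<longrightarrow>
    real (card (large_sum_primes \<epsilon> l M)) \<le> C * real M powr (1/48)"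
proof -
  obtain T where T: "T > 0" "\<And>l. l \<ge> 1 \<Longrightarrow> real (card (square_pairs 96 l)) \<le> T * real l ^ 96 * sqrt (real l)"
    using card_square_pairs_le[of 96] by auto
  define \<delta> where "\<delta> = \<epsilon> ^ 192"
  have \<delta>: "\<delta> > 0" using \<epsilon> by (simp add: \<delta>_def)
  \<comment> \<open>From M >= 2 T 2^72 / delta and M^3 <= 2^72 l^72 follows 2 T M^2 <= delta l^95,
    which makes the off-diagonal term at most half of the left-hand side.\<close>
  define M0 where "M0 = nat \<lceil>2 * T * 2 ^ 72 / \<delta>\<rceil>"
  have "real (card (large_sum_primes \<epsilon> l M)) \<le> 2 * T / \<delta> * real M powr (1/48)"
    if M: "M \<ge> M0" and l: "l \<ge> 1" and lM: "l ^ 24 \<le> M" "M \<le> (2 * l) ^ 24" for M l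
  proof -
    define R where "R = real (card (large_sum_primes \<epsilon> l M))"
    define L where "L = real l"
    have L1: "L \<ge> 1" using l by (simp add: L_def)
    have s: "sqrt L \<ge> 1" "sqrt L * sqrt L = L" using L1 by auto
    have R0: "R \<ge> 0" by (simp add: R_def)
    have M0': "2 * T * 2 ^ 72 / \<delta> \<le> real M" using M unfolding M0_def by linarith
    have Mpos: "real M > 0" using lM(1) l by (metis gr0I le_0_eq not_one_le_zero of_nat_0_less_iff power_eq_0_iff)
    have "real M \<le> real ((2 * l) ^ 24)" using lM(2) by (simp only: of_nat_le_iff)
    hence M24: "real M \<le> 2 ^ 24 * L ^ 24" by (simp add: L_def power_mult_distrib)
    have M72: "real M ^ 3 \<le> 2 ^ 72 * L ^ 72"
    proof -
      have "real M ^ 3 \<le> (2 ^ 24 * L ^ 24) ^ 3" using M24 by (intro power_mono) auto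
      thus ?thesis by (simp add: power_mult_distrib flip: power_mult)
    qed
    have key: "2 * T * (real M)\<^sup>2 \<le> \<delta> * L ^ 95"
    proof -
      have "2 * T * 2 ^ 72 \<le> real M * \<delta>" using M0' \<delta> by (simp add: pos_divide_le_eq)
      hence "2 * T * 2 ^ 72 * (real M)\<^sup>2 \<le> real M * \<delta> * (real M)\<^sup>2" by (intro mult_right_mono) auto
      also have "\<dots> = \<delta> * real M ^ 3" by (simp add: power2_eq_square power3_eq_cube)
      also have "\<dots> \<le> \<delta> * (2 ^ 72 * L ^ 72)" using M72 \<delta> by (intro mult_left_mono) auto
      also have "\<dots> \<le> \<delta> * (2 ^ 72 * L ^ 95)" using L1 \<delta> by (intro mult_left_mono power_increasing) auto
      finally have "2 ^ 72 * (2 * T * (real M)\<^sup>2) \<le> 2 ^ 72 * (\<delta> * L ^ 95)" by (simp only: mult_ac)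
      thus ?thesis by simp
    qed
    have "R\<^sup>2 * (\<epsilon> * L) ^ (2 * 96) \<le> real (card (square_pairs 96 l)) * (R * L ^ 96 + R\<^sup>2 * (real M)\<^sup>2)"
      unfolding R_def L_def
      by (rule large_values_duality[OF large_sum_primes_subset]) (use \<epsilon> in \<open>auto simp: large_sum_primes_def\<close>)
    also have "\<dots> \<le> (T * L ^ 96 * sqrt L) * (R * L ^ 96 + R\<^sup>2 * (real M)\<^sup>2)"
      using T(2)[OF l] R0 L1 unfolding L_def by (intro mult_right_mono) auto
    finally have A: "R\<^sup>2 * (\<delta> * (L ^ 96 * L ^ 96)) \<le> (T * L ^ 96 * sqrt L) * (R * L ^ 96 + R\<^sup>2 * (real M)\<^sup>2)"
      by (simp add: \<delta>_def power_mult_distrib flip: power_add)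
    have "R\<^sup>2 * \<delta> * L ^ 96 * L ^ 96 \<le> (T * sqrt L * (R * L ^ 96 + R\<^sup>2 * (real M)\<^sup>2)) * L ^ 96"
      using A by (simp only: mult_ac)
    hence B: "R\<^sup>2 * \<delta> * L ^ 96 \<le> T * sqrt L * (R * L ^ 96 + R\<^sup>2 * (real M)\<^sup>2)"
      by (rule mult_right_le_imp_le) (use L1 in simp)
    have "2 * (T * sqrt L * (R\<^sup>2 * (real M)\<^sup>2)) = (2 * T * (real M)\<^sup>2) * (sqrt L * R\<^sup>2)" by (simp only: mult_ac)
    also have "\<dots> \<le> (\<delta> * L ^ 95) * (L * R\<^sup>2)"
    proof (rule mult_mono[OF key mult_right_mono])
      have "sqrt L * 1 \<le> sqrt L * sqrt L" using s by (intro mult_left_mono) auto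
      thus "sqrt L \<le> L" using s(2) by simp
    qed (use \<delta> L1 in auto)
    also have "\<dots> = R\<^sup>2 * \<delta> * L ^ 96"
    proof -
      have "L ^ 96 = L ^ 95 * L" by (simp flip: power_Suc2)
      thus ?thesis by (simp only: mult_ac)
    qed
    finally have C: "2 * (T * sqrt L * (R\<^sup>2 * (real M)\<^sup>2)) \<le> R\<^sup>2 * \<delta> * L ^ 96" .
    have "R\<^sup>2 * \<delta> * L ^ 96 \<le> T * sqrt L * (R * L ^ 96) + T * sqrt L * (R\<^sup>2 * (real M)\<^sup>2)"
      using B by (simp only: distrib_left)
    hence "R\<^sup>2 * \<delta> * L ^ 96 \<le> 2 * (T * sqrt L * (R * L ^ 96))" using C by linarith
    hence "(R * (R * \<delta>)) * L ^ 96 \<le> (R * (2 * T * sqrt L)) * L ^ 96"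
      by (simp only: power2_eq_square mult_ac)
    hence D: "R * (R * \<delta>) \<le> R * (2 * T * sqrt L)" by (rule mult_right_le_imp_le) (use L1 in simp)
    have "R * \<delta> \<le> 2 * T * sqrt L"
    proof (cases "R = 0")
      case True
      thus ?thesis using T(1) s(1) by simp
    next
      case False
      with R0 have "R > 0" by simp
      with D show ?thesis by (simp only: mult_le_cancel_left_pos)
    qed
    hence Rle: "R \<le> 2 * T / \<delta> * sqrt L" using \<delta> by (simp add: pos_le_divide_eq)
    have "sqrt L \<le> real M powr (1/48)"
    proof -
      have "real (l ^ 24) \<le> real M" using lM(1) by (simp only: of_nat_le_iff)
      hence "L ^ 24 \<le> real M" by (simp add: L_def)
      hence "(L ^ 24) powr (1/48) \<le> real M powr (1/48)" using L1 by (intro powr_mono2) auto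
      moreover have "(L ^ 24) powr (1/48) = (L powr 24) powr (1/48)" using L1 powr_realpow[of L 24] by simp
      moreover have "(L powr 24) powr (1/48) = L powr (24 * (1/48))" by (rule powr_powr)
      moreover have "L powr (24 * (1/48)) = sqrt L" using L1 powr_half_sqrt[of L] by simp
      ultimately show ?thesis by simp
    qed
    hence "2 * T / \<delta> * sqrt L \<le> 2 * T / \<delta> * real M powr (1/48)"
      using T(1) \<delta> by (intro mult_left_mono) auto
    with Rle show ?thesis by (simp add: R_def)
  qed
  thus ?thesis using T(1) \<delta> by (intro exI[of _ "2 * T / \<delta>"]) auto
qed

section \<open>An averaged Polya-Vinogradov bound\<close>

lemma periodic_sum_shift:
  fixes f :: "nat \<Rightarrow> real"
  assumes per: "\<And>m. f (m + k) = f m"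
  shows "(\<Sum>m<k. f (m + j)) = (\<Sum>m<k. f m)"
proof (induction j)
  case (Suc j)
  have "(\<Sum>m<Suc k. f (m + j)) = f j + (\<Sum>m<k. f (m + Suc j))"
    by (subst sum.lessThan_Suc_shift) simp
  moreover have "(\<Sum>m<Suc k. f (m + j)) = (\<Sum>m<k. f (m + j)) + f (k + j)" by simp
  moreover have "f (k + j) = f j" using per[of j] by (simp add: add.commute)
  ultimately show ?case using Suc by simp
qed simp

context
  fixes p :: nat and leg :: "nat \<Rightarrow> real"
  assumes p: "prime p" "p > 2"
  defines "leg \<equiv> (\<lambda>n. real_of_int (Legendre (int n) (int p)))"
begin

lemma leg_period: "leg (m + p) = leg m"
proof -
  have "Legendre (int (m + p)) (int p) = Legendre (int m) (int p)"
    by (rule Legendre_mod) (simp add: cong_iff_dvd_diff)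
  thus ?thesis by (simp add: leg_def)
qed

lemma leg_mult: "leg (a * b) = leg a * leg b"
  using Legendre_mult[OF p, of "int a" "int b"] by (simp add: leg_def)

lemma leg_values: "leg a \<in> {-1, 0, 1}"
  using Legendre_values[of "int a" "int p"] by (auto simp: leg_def)

lemma leg_square_le: "leg a * leg a \<le> 1"
  using leg_values[of a] by auto

lemma leg_square: "\<not> p dvd a \<Longrightarrow> leg a * leg a = 1"
  using leg_values[of a] Legendre_eq_0_iff[of "int a" "int p"] by (auto simp: leg_def)

lemma sum_leg: "(\<Sum>m<p. leg m) = 0"
proof -
  obtain a where a: "Legendre (int a) (int p) = -1" using exists_nonresidue[OF p] by blast
  hence "\<not> p dvd a" using Legendre_eq_0_iff[of "int a" "int p"] by auto
  hence "coprime a p" using p prime_imp_coprime[of p a] by (simp add: coprime_commute)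
  moreover have "leg (a * m) = - leg m" for m using a by (simp add: leg_mult) (simp add: leg_def)
  ultimately show ?thesis using p leg_period by (intro periodic_sum_zero[of p leg a]) auto
qed

text \<open>Replacing a by h a shows that the correlation is the same for all shifts h prime to p.
  All p correlations together give the square of the complete sum, which is 0, and the one at shift
  0 is non-negative; so the common value of the others cannot be positive.\<close>

lemma leg_autocorrelation_nonpos:
  assumes h: "0 < h" "h < p"
  shows "(\<Sum>a<p. leg a * leg (a + h)) \<le> 0"
proof -
  define g where "g = (\<lambda>h. \<Sum>a<p. leg a * leg (a + h))"
  have p0: "p > 0" using p by simp
  have g1: "g h = g 1" if h: "0 < h" "h < p" for h
  proof -
    have nd: "\<not> p dvd h" using h by (auto dest: dvd_imp_le)
    hence cop: "coprime h p" using p prime_imp_coprime[of p h] by (simp add: coprime_commute)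
    have per: "leg (m + p) * leg (m + p + h) = leg m * leg (m + h)" for m
      using leg_period[of m] leg_period[of "m + h"] by (simp add: add_ac)
    have "g h = (\<Sum>a<p. leg (h * a) * leg (h * a + h))"
      unfolding g_def using periodic_sum_mult[OF p0, of "\<lambda>m. leg m * leg (m + h)" h] per cop by simp
    also have "\<dots> = (\<Sum>a<p. leg a * leg (a + 1))"
    proof (rule sum.cong[OF refl])
      fix a
      have "leg (h * a) * leg (h * a + h) = leg (h * a) * leg (h * (a + 1))" by (simp add: algebra_simps)
      also have "\<dots> = (leg h * leg h) * (leg a * leg (a + 1))" by (simp only: leg_mult mult_ac)
      finally show "leg (h * a) * leg (h * a + h) = leg a * leg (a + 1)" using leg_square[OF nd] by simp
    qed
    finally show ?thesis by (simp add: g_def)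
  qed
  have "(\<Sum>h<p. g h) = (\<Sum>a<p. \<Sum>h<p. leg a * leg (a + h))" unfolding g_def by (rule sum.swap)
  also have "\<dots> = (\<Sum>a<p. leg a * (\<Sum>h<p. leg (h + a)))" by (simp add: sum_distrib_left add.commute)
  also have "\<dots> = 0" using periodic_sum_shift[of leg p] leg_period sum_leg by simp
  finally have "(\<Sum>h<p. g h) = 0" .
  moreover have "{..<p} = insert 0 {1..<p}" using p by auto
  ultimately have "g 0 + (\<Sum>h\<in>{1..<p}. g h) = 0" by simp
  moreover have "(\<Sum>h\<in>{1..<p}. g h) = (\<Sum>h\<in>{1..<p}. g 1)" by (intro sum.cong refl g1) auto
  moreover have "g 0 \<ge> 0" unfolding g_def by (intro sum_nonneg) simp
  ultimately have "real (p - 1) * g 1 \<le> 0" by simp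
  hence "g 1 \<le> 0" using p by (simp add: mult_le_0_iff)
  thus ?thesis using g1[OF h] by (simp add: g_def)
qed

text \<open>Let h(a) be the sum over the M places after a. The mean square of h over i <= M is
  enlarged to a full period and expanded: off-diagonal correlations are at most 0 and drop out, the
  diagonal gives at most M p. Cauchy-Schwarz turns this into M sqrt p.\<close>

lemma leg_bilinear_bound:
  assumes M: "M \<le> p"
  shows "\<bar>\<Sum>i=1..M. \<Sum>j=1..M. leg (i + j)\<bar> \<le> real M * sqrt (real p)"
proof -
  define h where "h = (\<lambda>a. \<Sum>j=1..M. leg (a + j))"
  have hper: "h (a + p) = h a" for a
    unfolding h_def using leg_period by (intro sum.cong refl) (metis add.assoc add.commute)
  have diag: "(\<Sum>a<p. leg (a + j) * leg (a + j')) \<le> (if j = j' then real p else 0)"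
    if j: "j \<in> {1..M}" "j' \<in> {1..M}" for j j'
  proof -
    have le: "(\<Sum>a<p. leg (a + j) * leg (a + j')) \<le> 0" if jj: "j < j'" "j' \<in> {1..M}" "j \<ge> 1" for j j'
    proof -
      have "(\<Sum>a<p. leg (a + j) * leg (a + j + (j' - j))) = (\<Sum>a<p. leg a * leg (a + (j' - j)))"
        by (rule periodic_sum_shift[of "\<lambda>m. leg m * leg (m + (j' - j))" p j])
           (metis leg_period add.assoc add.commute)
      also have "\<dots> \<le> 0" using jj M by (intro leg_autocorrelation_nonpos) auto
      finally show ?thesis using jj by simp
    qed
    show ?thesis
    proof (cases j j' rule: linorder_cases)
      case equal
      have "(\<Sum>a<p. leg (a + j) * leg (a + j')) \<le> (\<Sum>a<p. 1)"
        unfolding equal by (intro sum_mono leg_square_le)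
      thus ?thesis using equal by simp
    next
      case greater
      thus ?thesis using le[of j' j] j by (simp add: mult.commute)
    qed (use le[of j j'] j in auto)
  qed
  have "(\<Sum>i=1..M. (h i)\<^sup>2) \<le> (\<Sum>i=1..p. (h i)\<^sup>2)" using M by (intro sum_mono2) auto
  also have "(\<Sum>i=1..p. (h i)\<^sup>2) = (\<Sum>a<p. (h (a + 1))\<^sup>2)"
    by (rule sum.reindex_bij_witness[where i = Suc and j = "\<lambda>i. i - 1"]) auto
  also have "\<dots> = (\<Sum>a<p. (h a)\<^sup>2)"
    by (rule periodic_sum_shift[of "\<lambda>a. (h a)\<^sup>2" p 1]) (simp add: hper)
  also have "\<dots> = (\<Sum>a<p. \<Sum>j=1..M. \<Sum>j'=1..M. leg (a + j) * leg (a + j'))"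
    by (simp add: h_def power2_eq_square sum_product)
  also have "\<dots> = (\<Sum>j=1..M. \<Sum>a<p. \<Sum>j'=1..M. leg (a + j) * leg (a + j'))" by (rule sum.swap)
  also have "\<dots> = (\<Sum>j=1..M. \<Sum>j'=1..M. \<Sum>a<p. leg (a + j) * leg (a + j'))" by (intro sum.cong refl sum.swap)
  also have "\<dots> \<le> (\<Sum>j=1..M. \<Sum>j'=1..M. if j = j' then real p else 0)" by (intro sum_mono diag)
  also have "\<dots> = real M * real p" by simp
  finally have sq: "(\<Sum>i=1..M. (h i)\<^sup>2) \<le> real M * real p" .
  have "(\<Sum>i=1..M. 1 * h i)\<^sup>2 \<le> (\<Sum>i=1..M. 1\<^sup>2) * (\<Sum>i=1..M. (h i)\<^sup>2)" by (rule Cauchy_Schwarz_ineq_sum)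
  also have "\<dots> \<le> real M * (real M * real p)" using sq by (simp add: mult_left_mono)
  also have "\<dots> = (real M * sqrt (real p))\<^sup>2" by (simp add: power2_eq_square)
  finally have "\<bar>\<Sum>i=1..M. 1 * h i\<bar> \<le> \<bar>real M * sqrt (real p)\<bar>" by (simp only: abs_le_square_iff)
  thus ?thesis by (simp add: h_def)
qed

lemma jac_sum_eq_leg: "jac_sum l p = (\<Sum>n=1..l. leg n)"
  unfolding jac_sum_def leg_def by (intro sum.cong refl jac_Legendre[OF p]) auto

text \<open>The partial sums up to index 2 M add up to twice those up to M plus the bilinear sum, so
  each doubling raises their average by at most sqrt p / 2.\<close>

lemma sum_jac_sum_power_2_le:
  assumes "2 ^ j \<le> p"
  shows "(\<Sum>m=1..2 ^ j. jac_sum m p) \<le> 2 ^ j * (1 + real j * sqrt (real p) / 2)"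
  using assms
proof (induction j)
  case 0
  have "leg (Suc 0) = 1" using Legendre_1[OF p(1)] by (simp add: leg_def)
  thus ?case by (simp add: jac_sum_eq_leg)
next
  case (Suc j)
  define M :: nat where "M = 2 ^ j"
  have Mp: "M \<le> p" using Suc.prems by (simp add: M_def)
  define S where "S = (\<lambda>m. jac_sum m p)"
  have split: "(\<Sum>m=1..k + i. f m) = (\<Sum>m=1..k. f m) + (\<Sum>m=1..i. f (k + m))" for k i and f :: "nat \<Rightarrow> real"
    by (induction i) auto
  have "(\<Sum>i=1..M. \<Sum>j=1..M. leg (i + j)) = (\<Sum>i=1..M. S (i + M) - S i)"
  proof (rule sum.cong[OF refl])
    fix i
    show "(\<Sum>j=1..M. leg (i + j)) = S (i + M) - S i"
      unfolding S_def jac_sum_eq_leg split[where k = i and i = M and f = leg] by simp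
  qed
  also have "\<dots> = (\<Sum>m=1..M + M. S m) - 2 * (\<Sum>m=1..M. S m)"
    unfolding split[where k = M and i = M and f = S] by (simp add: sum_subtractf add.commute)
  finally have "(\<Sum>m=1..M + M. S m) \<le> 2 * (\<Sum>m=1..M. S m) + real M * sqrt (real p)"
    using leg_bilinear_bound[OF Mp] by simp
  also have "(\<Sum>m=1..M. S m) \<le> real M * (1 + real j * sqrt (real p) / 2)"
    using Suc.IH Mp by (simp add: M_def S_def)
  finally have "(\<Sum>m=1..M + M. S m) \<le> 2 * (real M * (1 + real j * sqrt (real p) / 2)) + real M * sqrt (real p)" by simp
  also have "\<dots> = 2 * real M * (1 + real (Suc j) * sqrt (real p) / 2)" by (simp add: algebra_simps)
  finally have le: "(\<Sum>m=1..M + M. S m) \<le> 2 * real M * (1 + real (Suc j) * sqrt (real p) / 2)" .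
  have e: "(2::nat) ^ Suc j = M + M" "(2::real) ^ Suc j = 2 * real M" by (simp_all add: M_def)
  show ?case unfolding e using le unfolding S_def .
qed

text \<open>Otherwise the average of the sums over m <= 2^j would be at least eps 2^j / 2, above
  what repeated doubling permits.\<close>

lemma exists_small_jac_sum:
  assumes "2 ^ j \<le> p" "1 + real j * sqrt (real p) / 2 < \<epsilon> * 2 ^ j / 2" "\<epsilon> > 0"
  shows "\<exists>m\<ge>1. m \<le> 2 ^ j \<and> jac_sum m p < \<epsilon> * real m"
proof (rule ccontr)
  assume "\<not> ?thesis"
  hence ge: "jac_sum m p \<ge> \<epsilon> * real m" if "m \<in> {1..2 ^ j}" for m using that by (force simp: not_less)
  have "\<epsilon> * (2 ^ j * 2 ^ j / 2) \<le> \<epsilon> * (\<Sum>m=1..2 ^ j. real m)"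
  proof (rule mult_left_mono)
    have "(\<Sum>m=1..n. real m) = real n * (real n + 1) / 2" for n by (induction n) (auto simp: field_simps)
    from this[of "2 ^ j"] show "2 ^ j * 2 ^ j / 2 \<le> (\<Sum>m=1..2 ^ j. real m)" by (simp add: field_simps)
  qed (use assms in simp)
  also have "\<dots> = (\<Sum>m=1..2 ^ j. \<epsilon> * real m)" by (simp add: sum_distrib_left)
  also have "\<dots> \<le> (\<Sum>m=1..2 ^ j. jac_sum m p)" by (intro sum_mono ge)
  also have "\<dots> \<le> 2 ^ j * (1 + real j * sqrt (real p) / 2)" by (rule sum_jac_sum_power_2_le[OF assms(1)])
  also have "\<dots> < 2 ^ j * (\<epsilon> * 2 ^ j / 2)" using assms(2) by (intro mult_strict_left_mono) auto
  finally show False by (simp add: mult_ac)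
qed

lemma legendre_sum_eq: "real_of_int (legendre_sum p l) = jac_sum l p"
  by (simp add: legendre_sum_def jac_sum_eq_leg leg_def)

lemma f_eps_alt: "f_eps \<epsilon> p = (LEAST l. l \<ge> 1 \<and> jac_sum l p < \<epsilon> * real l)"
  by (simp add: f_eps_def legendre_sum_eq)

end

text \<open>\<open>not_less_Least\<close> applies whether or not the minimum exists, so its
  existence can be settled separately, for large p.\<close>

lemma f_eps_greater:
  assumes "prime p" "p > 2" "l \<ge> 1" "l < f_eps \<epsilon> p"
  shows "jac_sum l p \<ge> \<epsilon> * real l"
  using not_less_Least[of l "\<lambda>l. l \<ge> 1 \<and> jac_sum l p < \<epsilon> * real l"] assms f_eps_alt[of p \<epsilon>] by auto

text \<open>On average up to a power of 2 of order p^(3/4), the requirement eps m outgrows the bound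
  of order sqrt p log p. The existence of the minimum is part of the claim, since
  \<open>LEAST\<close> carries no positive information otherwise. Later any exponent between 1/2 and
  1 - 1/48 would serve.\<close>

lemma f_eps_bound:
  assumes \<epsilon>: "\<epsilon> > 0"
  shows "\<exists>p0. \<forall>p\<ge>p0. prime p \<longrightarrow> p > 2 \<longrightarrow>
    (\<exists>m\<ge>1. jac_sum m p < \<epsilon> * real m) \<and> real (f_eps \<epsilon> p) \<le> real p powr (3/4)"
proof -
  \<comment> \<open>2 log p stands for j, since 2^j <= p and log 2 >= 1/2; and p^(3/4) - 1 is at
    most 2 * 2^j, as 2^j is the largest power of 2 below the floor of p^(3/4).\<close>
  have "eventually (\<lambda>p::nat. 1 + (2 * ln (real p)) * sqrt (real p) / 2 < \<epsilon> * (real p powr (3/4) - 1) / 4) sequentially"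
    using \<epsilon> by real_asymp
  then obtain p0 where p0: "\<And>p. p \<ge> p0 \<Longrightarrow> 1 + (2 * ln (real p)) * sqrt (real p) / 2 < \<epsilon> * (real p powr (3/4) - 1) / 4"
    by (auto simp: eventually_at_top_linorder)
  show ?thesis
  proof (intro exI[of _ p0] allI impI)
    fix p assume pp: "p \<ge> p0" "prime p" "p > 2"
    define k where "k = nat \<lfloor>real p powr (3/4)\<rfloor>"
    have x1: "real p powr (3/4) \<ge> 1" using pp by (intro ge_one_powr_ge_zero) auto
    have kle: "real k \<le> real p powr (3/4)" unfolding k_def using x1 by (intro of_nat_floor) simp
    have kge: "real k \<ge> real p powr (3/4) - 1" unfolding k_def by linarith
    have "k \<ge> 1" using x1 by (simp add: k_def le_nat_floor)
    then obtain j where j: "2 ^ j \<le> k" "k < 2 ^ (j + 1)" using ex_power_ivl1[of 2 k] by auto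
    have "real p powr (3/4) \<le> real p powr 1" using pp by (intro powr_mono) auto
    hence "real k \<le> real p" using kle pp by simp
    hence jp: "2 ^ j \<le> p" using j(1) by (simp only: of_nat_le_iff) 
    have "real j \<le> 2 * ln (real p)"
    proof -
      have "real (2 ^ j) \<le> real p" using jp by (simp only: of_nat_le_iff)
      hence "ln (2 ^ j) \<le> ln (real p)" using pp by (subst ln_le_cancel_iff) auto
      hence 1: "real j * ln 2 \<le> ln (real p)" by (simp add: ln_realpow)
      have "real j * (1/2) \<le> real j * ln 2" using ln2_ge_two_thirds by (intro mult_left_mono) auto
      thus ?thesis using 1 by simp
    qed
    hence "1 + real j * sqrt (real p) / 2 \<le> 1 + (2 * ln (real p)) * sqrt (real p) / 2"
      by (intro add_left_mono divide_right_mono mult_right_mono) auto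
    also have "\<dots> < \<epsilon> * (real p powr (3/4) - 1) / 4" by (rule p0[OF pp(1)])
    also have "\<dots> \<le> \<epsilon> * (2 * 2 ^ j) / 4"
    proof -
      have "real k \<le> real (2 ^ (j + 1))" using j(2) by (simp only: of_nat_le_iff less_imp_le)
      hence "real p powr (3/4) - 1 \<le> 2 * 2 ^ j" using kge by simp
      thus ?thesis using \<epsilon> by (intro divide_right_mono mult_left_mono) auto
    qed
    finally have "1 + real j * sqrt (real p) / 2 < \<epsilon> * 2 ^ j / 2" by simp
    from exists_small_jac_sum[OF pp(2,3) jp this \<epsilon>] obtain m where
      m: "m \<ge> 1" "m \<le> 2 ^ j" "jac_sum m p < \<epsilon> * real m" by blast
    have "f_eps \<epsilon> p \<le> m" unfolding f_eps_alt[OF pp(2,3)] by (rule Least_le) (use m in simp)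
    hence "f_eps \<epsilon> p \<le> k" using m(2) j(1) by linarith
    hence "real (f_eps \<epsilon> p) \<le> real p powr (3/4)" using kle by (meson of_nat_le_iff order_trans)
    thus "(\<exists>m\<ge>1. jac_sum m p < \<epsilon> * real m) \<and> real (f_eps \<epsilon> p) \<le> real p powr (3/4)" using m by blast
  qed
qed

section \<open>Densities and the final limit\<close>

text \<open>A prime above sqrt N has log p >= (log N) / 2, so Chebyshev's bound for Lambda counts
  these; the others number at most sqrt N.\<close>

lemma card_odd_primes_le_bound:
  assumes N: "N \<ge> 2"
  shows "real (card (odd_primes_le N)) \<le> sqrt (real N) + 8 * real N / ln (real N)"
proof -
  define L where "L = ln (real N)"
  have L: "L > 0" using N by (simp add: L_def)
  define P where "P = {p \<in> odd_primes_le N. sqrt (real N) < real p}"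
  have Psub: "P \<subseteq> odd_primes_le N" by (auto simp: P_def)
  have finP: "finite P" by (rule finite_subset[OF Psub]) simp
  have "real (card P) * (L / 2) = (\<Sum>p\<in>P. L / 2)" by simp
  also have "\<dots> \<le> (\<Sum>p\<in>P. mangoldt p)"
  proof (rule sum_mono)
    fix p assume p: "p \<in> P"
    hence pr: "prime p" "sqrt (real N) < real p" by (auto simp: P_def odd_primes_le_def)
    have "L / 2 = ln (sqrt (real N))" using N by (simp add: L_def ln_sqrt)
    also have "\<dots> \<le> ln (real p)" using pr N prime_gt_0_nat[OF pr(1)] by (subst ln_le_cancel_iff) auto
    finally show "L / 2 \<le> mangoldt p" using pr by simp
  qed
  also have "\<dots> \<le> (\<Sum>n=1..N. mangoldt n)"
    using Psub odd_primes_le_subset by (intro sum_mono2 mangoldt_nonneg) (blast | simp)+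
  also have "\<dots> \<le> 4 * real N" by (rule psi_le)
  finally have 1: "real (card P) \<le> 8 * real N / L" using L by (simp add: field_simps)
  have 2: "real (card (odd_primes_le N - P)) \<le> sqrt (real N)"
  proof -
    have "odd_primes_le N - P \<subseteq> {1..nat \<lfloor>sqrt (real N)\<rfloor>}"
      using odd_primes_le_subset[of N] by (force simp: P_def le_nat_floor not_less)
    hence "card (odd_primes_le N - P) \<le> nat \<lfloor>sqrt (real N)\<rfloor>"
      using card_mono[of "{1..nat \<lfloor>sqrt (real N)\<rfloor>}"] by simp
    hence "real (card (odd_primes_le N - P)) \<le> real (nat \<lfloor>sqrt (real N)\<rfloor>)" by (simp only: of_nat_le_iff)
    also have "\<dots> \<le> sqrt (real N)" by (rule of_nat_floor) simp
    finally show ?thesis .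
  qed
  have "card (odd_primes_le N) = card P + card (odd_primes_le N - P)"
    using card_Diff_subset[OF finP Psub] card_mono[OF _ Psub] by simp
  thus ?thesis using 1 2 by (simp add: L_def)
qed

text \<open>Normalised by log N / N instead of the number of primes, so that the constant of the
  theorem is itself such a mean, that of f.\<close>

definition prime_mean :: "(nat \<Rightarrow> real) \<Rightarrow> real \<Rightarrow> bool" where
  "prime_mean g c \<longleftrightarrow> (\<lambda>N. ln (real N) / real N * (\<Sum>p\<in>odd_primes_le N. g p)) \<longlonglongrightarrow> c"

text \<open>The primes up to y = N / (log N)^2 number at most y and lose at most log N each. The
  others lose at most 2 log log N each, and by Chebyshev there are O(N / log N) of them.\<close>

lemma sum_log_deficit:
  "(\<lambda>N. (\<Sum>p\<in>odd_primes_le N. ln (real N) - ln (real p)) / real N) \<longlonglongrightarrow> 0"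
proof (rule tendsto_sandwich)
  show "eventually (\<lambda>N. 0 \<le> (\<Sum>p\<in>odd_primes_le N. ln (real N) - ln (real p)) / real N) sequentially"
    using eventually_gt_at_top[of 0]
  proof eventually_elim
    case (elim N)
    have "0 \<le> ln (real N) - ln (real p)" if "p \<in> odd_primes_le N" for p
      using that elim by (simp add: odd_primes_le_def prime_gt_0_nat)
    thus ?case by (intro divide_nonneg_nonneg sum_nonneg) auto
  qed
  show "eventually (\<lambda>N. (\<Sum>p\<in>odd_primes_le N. ln (real N) - ln (real p)) / real N \<le>
     1 / ln (real N) + 2 * ln (ln (real N)) * (1 / sqrt (real N) + 8 / ln (real N))) sequentially"
    using eventually_ge_at_top[of 3]
  proof eventually_elim
    case (elim N)
    define L where "L = ln (real N)"
    have N: "real N \<ge> 3" using elim by simp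
    have L1: "L \<ge> 1"
    proof -
      have "ln (exp 1) \<le> ln (real N)" using N exp_le by (subst ln_le_cancel_iff) auto
      thus ?thesis by (simp add: L_def)
    qed
    define y where "y = real N / L\<^sup>2"
    have y: "y > 0" using L1 N by (simp add: y_def)
    have lny: "ln y = L - 2 * ln L"
      using L1 N by (simp add: y_def ln_div L_def [symmetric] ln_realpow)
    have lnL: "ln L \<ge> 0" using L1 by simp
    define A where "A = {p \<in> odd_primes_le N. real p \<le> y}"
    have A: "real (card A) \<le> y"
    proof -
      have "A \<subseteq> {1..nat \<lfloor>y\<rfloor>}" using odd_primes_le_subset[of N] by (force simp: A_def le_nat_floor)
      hence "card A \<le> nat \<lfloor>y\<rfloor>" using card_mono[of "{1..nat \<lfloor>y\<rfloor>}"] by simp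
      hence "real (card A) \<le> real (nat \<lfloor>y\<rfloor>)" by (simp only: of_nat_le_iff)
      also have "\<dots> \<le> y" by (rule of_nat_floor) (use y in simp)
      finally show ?thesis .
    qed
    have "(\<Sum>p\<in>odd_primes_le N. L - ln (real p)) \<le> (\<Sum>p\<in>odd_primes_le N. (if real p \<le> y then L else 0) + 2 * ln L)"
    proof (rule sum_mono)
      fix p assume "p \<in> odd_primes_le N"
      hence p1: "p \<ge> 1" using odd_primes_le_subset[of N] by auto
      show "L - ln (real p) \<le> (if real p \<le> y then L else 0) + 2 * ln L"
      proof (cases "real p \<le> y")
        case True
        have "ln (real p) \<ge> 0" using p1 by simp
        thus ?thesis using True lnL by simp
      next
        case False
        have "ln y \<le> ln (real p)" using False y p1 by (subst ln_le_cancel_iff) auto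
        thus ?thesis using False lny by simp
      qed
    qed
    also have "\<dots> = real (card A) * L + real (card (odd_primes_le N)) * (2 * ln L)"
      by (simp add: sum.distrib sum.If_cases A_def Int_def conj_commute)
    also have "\<dots> \<le> y * L + (sqrt (real N) + 8 * real N / L) * (2 * ln L)"
      using A L1 lnL card_odd_primes_le_bound[of N] elim unfolding L_def by (intro add_mono mult_right_mono) auto
    finally have "(\<Sum>p\<in>odd_primes_le N. L - ln (real p)) / real N \<le> (y * L + (sqrt (real N) + 8 * real N / L) * (2 * ln L)) / real N"
      by (intro divide_right_mono) auto
    also have "\<dots> = 1 / L + 2 * ln L * (1 / sqrt (real N) + 8 / L)"
    proof -
      have "y * L / real N = 1 / L" using L1 N by (simp add: y_def power2_eq_square)
      moreover have "sqrt (real N) / real N = 1 / sqrt (real N)" using N by (simp add: real_div_sqrt divide_simps)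
      moreover have "8 * real N / L / real N = 8 / L" using N by simp
      ultimately show ?thesis
        by (simp only: add_divide_distrib distrib_right distrib_left times_divide_eq_left [symmetric]) (simp add: mult_ac)
    qed
    finally show ?case by (simp add: L_def)
  qed
  show "(\<lambda>N::nat. 1 / ln (real N) + 2 * ln (ln (real N)) * (1 / sqrt (real N) + 8 / ln (real N))) \<longlonglongrightarrow> 0"
    by real_asymp
qed simp

text \<open>What is left are 2 and the higher prime powers: at most sqrt N bases, at most 2 log N
  exponents, and each term at most log N.\<close>

lemma sum_mangoldt_nonprime_small:
  "(\<lambda>N. (\<Sum>n\<in>{n\<in>{1..N}. \<not> (prime n \<and> odd n)}. mangoldt n :: real) / real N) \<longlonglongrightarrow> 0"
proof (rule tendsto_sandwich)
  show "eventually (\<lambda>N. 0 \<le> (\<Sum>n\<in>{n\<in>{1..N}. \<not> (prime n \<and> odd n)}. mangoldt n :: real) / real N) sequentially"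
    by (intro always_eventually allI divide_nonneg_nonneg sum_nonneg mangoldt_nonneg) auto
  show "eventually (\<lambda>N. (\<Sum>n\<in>{n\<in>{1..N}. \<not> (prime n \<and> odd n)}. mangoldt n :: real) / real N \<le>
     (sqrt (real N) * (2 * ln (real N)) + 1) * ln (real N) / real N) sequentially"
    using eventually_ge_at_top[of 2]
  proof eventually_elim
    case (elim N)
    define J where "J = nat \<lfloor>2 * ln (real N)\<rfloor>"
    define Q where "Q = nat \<lfloor>sqrt (real N)\<rfloor>"
    \<comment> \<open>With exponent 1 only the prime 2 occurs, excluded from the main sum by parity;
      it is inserted by hand.\<close>
    define B where "B = insert 2 ((\<lambda>(p, k). p ^ k) ` ({1..Q} \<times> {1..J}))"
    have lnN: "ln (real N) \<ge> 0" using elim by simp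
    have finB: "finite B" by (simp add: B_def)
    have cardB: "real (card B) \<le> sqrt (real N) * (2 * ln (real N)) + 1"
    proof -
      have "card B \<le> card ((\<lambda>(p, k). p ^ k) ` ({1..Q} \<times> {1..J})) + 1"
        unfolding B_def by (simp add: card_insert_if)
      also have "card ((\<lambda>(p, k). p ^ k) ` ({1..Q} \<times> {1..J})) \<le> card ({1..Q} \<times> {1..J})"
        by (rule card_image_le) simp
      finally have "real (card B) \<le> real (Q * J + 1)" by (simp only: of_nat_le_iff card_cartesian_product card_atLeastAtMost) simp
      also have "\<dots> = real Q * real J + 1" by simp
      also have "\<dots> \<le> sqrt (real N) * (2 * ln (real N)) + 1"
        unfolding Q_def J_def using lnN by (intro add_right_mono mult_mono of_nat_floor) auto
      finally show ?thesis .
    qed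
    have sub: "{n \<in> {1..N}. \<not> (prime n \<and> odd n) \<and> mangoldt n \<noteq> (0::real)} \<subseteq> B"
    proof
      fix n assume "n \<in> {n \<in> {1..N}. \<not> (prime n \<and> odd n) \<and> mangoldt n \<noteq> (0::real)}"
      hence n: "n \<le> N" "\<not> (prime n \<and> odd n)" "primepow n" by (auto simp: mangoldt_def split: if_splits)
      then obtain p k where pk: "prime p" "k > 0" "n = p ^ k" by (auto simp: primepow_def)
      show "n \<in> B"
      proof (cases "k = 1")
        case True
        hence "prime n" "even n" using pk n(2) by auto
        hence "n = 2" using prime_odd_nat[of n] prime_ge_2_nat[of n] by fastforce
        thus ?thesis by (simp add: B_def)
      next
        case False
        hence k2: "k \<ge> 2" using pk(2) by simp
        have p2: "p \<ge> 2" by (rule prime_ge_2_nat[OF pk(1)])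
        have "p ^ 2 \<le> p ^ k" using p2 k2 by (intro power_increasing) auto
        hence "real (p ^ 2) \<le> real N" using n(1) pk(3) by (simp only: of_nat_le_iff)
        hence "real p \<le> sqrt (real N)" by (intro real_le_rsqrt) simp
        hence "p \<le> Q" by (simp add: Q_def le_nat_floor)
        moreover have "k \<le> J"
        proof -
          have "2 ^ k \<le> p ^ k" using p2 by (intro power_mono) auto
          hence "real (2 ^ k) \<le> real N" using n(1) pk(3) by (simp only: of_nat_le_iff)
          hence "ln (2 ^ k) \<le> ln (real N)" using elim by (subst ln_le_cancel_iff) auto
          hence 1: "real k * ln 2 \<le> ln (real N)" by (simp add: ln_realpow)
          have "real k * (1/2) \<le> real k * ln 2" using ln2_ge_two_thirds by (intro mult_left_mono) auto
          hence "real k \<le> 2 * ln (real N)" using 1 by simp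
          thus ?thesis by (simp add: J_def le_nat_floor)
        qed
        ultimately have "(p, k) \<in> {1..Q} \<times> {1..J}" using p2 k2 by simp
        thus ?thesis unfolding B_def pk(3) by (intro insertI2 image_eqI[of _ _ "(p, k)"]) auto
      qed
    qed
    have "(\<Sum>n\<in>{n\<in>{1..N}. \<not> (prime n \<and> odd n)}. mangoldt n :: real) =
        (\<Sum>n\<in>{n \<in> {1..N}. \<not> (prime n \<and> odd n) \<and> mangoldt n \<noteq> (0::real)}. mangoldt n)"
      by (rule sum.mono_neutral_right) auto
    also have "\<dots> \<le> (\<Sum>n\<in>{n \<in> {1..N}. \<not> (prime n \<and> odd n) \<and> mangoldt n \<noteq> (0::real)}. ln (real N))"
    proof (rule sum_mono)
      fix n assume "n \<in> {n \<in> {1..N}. \<not> (prime n \<and> odd n) \<and> mangoldt n \<noteq> (0::real)}"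
      hence n: "1 \<le> n" "n \<le> N" by auto
      hence "mangoldt n \<le> ln (real n)" by (intro mangoldt_le) simp
      also have "\<dots> \<le> ln (real N)" using n by (subst ln_le_cancel_iff) auto
      finally show "mangoldt n \<le> ln (real N)" .
    qed
    also have "\<dots> \<le> real (card B) * ln (real N)"
      using card_mono[OF finB sub] lnN by (simp add: mult_right_mono)
    also have "\<dots> \<le> (sqrt (real N) * (2 * ln (real N)) + 1) * ln (real N)"
      using cardB lnN by (intro mult_right_mono)
    finally show ?case by (intro divide_right_mono) auto
  qed
  show "(\<lambda>N::nat. (sqrt (real N) * (2 * ln (real N)) + 1) * ln (real N) / real N) \<longlonglongrightarrow> 0"
    by real_asymp
qed simp


text \<open>Passing from the weight Lambda to the weight log N on odd primes costs two sums that are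
  o(N): the prime powers, and the deficits log N - log p.\<close>

lemma prime_mean_from_mangoldt:
  assumes c: "\<And>n. \<bar>c n\<bar> \<le> 1" and lim: "(\<lambda>N. (\<Sum>n=1..N. c n * mangoldt n) / real N) \<longlonglongrightarrow> \<delta>"
  shows "prime_mean c \<delta>"
proof -
  define X :: "nat \<Rightarrow> nat set" where "X = (\<lambda>N. {n \<in> {1..N}. \<not> (prime n \<and> odd n)})"
  have 1: "(\<lambda>N. (\<Sum>n\<in>X N. c n * mangoldt n) / real N) \<longlonglongrightarrow> 0"
  proof (rule Lim_null_comparison[OF always_eventually sum_mangoldt_nonprime_small], intro allI)
    fix N
    have "norm (\<Sum>n\<in>X N. c n * mangoldt n) \<le> (\<Sum>n\<in>X N. 1 * mangoldt n)"
    proof (rule sum_norm_le)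
      fix n
      show "norm (c n * mangoldt n) \<le> 1 * mangoldt n"
        using mult_right_mono[OF c mangoldt_nonneg, of n n] by (simp add: abs_mult)
    qed
    thus "norm ((\<Sum>n\<in>X N. c n * mangoldt n) / real N) \<le> (\<Sum>n\<in>{n\<in>{1..N}. \<not> (prime n \<and> odd n)}. mangoldt n) / real N"
      unfolding norm_divide by (simp add: X_def divide_right_mono)
  qed
  have 2: "(\<lambda>N. (\<Sum>p\<in>odd_primes_le N. c p * (ln (real N) - ln (real p))) / real N) \<longlonglongrightarrow> 0"
  proof (rule Lim_null_comparison[OF always_eventually sum_log_deficit], intro allI)
    fix N
    have "norm (\<Sum>p\<in>odd_primes_le N. c p * (ln (real N) - ln (real p))) \<le> (\<Sum>p\<in>odd_primes_le N. 1 * (ln (real N) - ln (real p)))"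
    proof (rule sum_norm_le)
      fix p assume "p \<in> odd_primes_le N"
      hence "p \<ge> 1" "p \<le> N" using odd_primes_le_subset[of N] by auto
      hence "0 \<le> ln (real N) - ln (real p)" by simp
      from mult_right_mono[OF c this, of p] this
      show "norm (c p * (ln (real N) - ln (real p))) \<le> 1 * (ln (real N) - ln (real p))" by (simp add: abs_mult)
    qed
    thus "norm ((\<Sum>p\<in>odd_primes_le N. c p * (ln (real N) - ln (real p))) / real N) \<le> (\<Sum>p\<in>odd_primes_le N. ln (real N) - ln (real p)) / real N"
      unfolding norm_divide by (simp add: divide_right_mono)
  qed
  have eq: "ln (real N) / real N * (\<Sum>p\<in>odd_primes_le N. c p) =
     (\<Sum>n=1..N. c n * mangoldt n) / real N - (\<Sum>n\<in>X N. c n * mangoldt n) / real N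
     + (\<Sum>p\<in>odd_primes_le N. c p * (ln (real N) - ln (real p))) / real N" for N
  proof -
    have "{1..N} = odd_primes_le N \<union> X N" "odd_primes_le N \<inter> X N = {}"
      using odd_primes_le_subset[of N] by (auto simp: odd_primes_le_def X_def)
    hence "(\<Sum>n=1..N. c n * mangoldt n) = (\<Sum>p\<in>odd_primes_le N. c p * mangoldt p) + (\<Sum>n\<in>X N. c n * mangoldt n)"
      by (simp add: sum.union_disjoint X_def)
    also have "(\<Sum>p\<in>odd_primes_le N. c p * mangoldt p) = (\<Sum>p\<in>odd_primes_le N. c p * ln (real p))"
      by (intro sum.cong refl) (simp add: odd_primes_le_def)
    finally have "(\<Sum>n=1..N. c n * mangoldt n) - (\<Sum>n\<in>X N. c n * mangoldt n) = (\<Sum>p\<in>odd_primes_le N. c p * ln (real p))" by simp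
    hence "(\<Sum>n=1..N. c n * mangoldt n) / real N - (\<Sum>n\<in>X N. c n * mangoldt n) / real N = (\<Sum>p\<in>odd_primes_le N. c p * ln (real p)) / real N"
      by (simp only: diff_divide_distrib [symmetric])
    moreover have "ln (real N) * (\<Sum>p\<in>odd_primes_le N. c p) = (\<Sum>p\<in>odd_primes_le N. c p * ln (real p)) + (\<Sum>p\<in>odd_primes_le N. c p * (ln (real N) - ln (real p)))"
      by (simp add: sum.distrib [symmetric] sum_distrib_left algebra_simps)
    ultimately show ?thesis by (simp add: add_divide_distrib)
  qed
  from tendsto_add[OF tendsto_diff[OF lim 1] 2] show ?thesis
    unfolding prime_mean_def eq by simp
qed

section \<open>Mean values over primes of functions of finitely many symbols\<close>

lemma prime_mean_add: "prime_mean f a \<Longrightarrow> prime_mean g b \<Longrightarrow> prime_mean (\<lambda>p. f p + g p) (a + b)"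
  unfolding prime_mean_def by (drule (1) tendsto_add) (simp add: sum.distrib distrib_left)

lemma prime_mean_cmult:
  assumes "prime_mean f a"
  shows "prime_mean (\<lambda>p. k * f p) (k * a)"
proof -
  have eq: "ln (real N) / real N * (\<Sum>p\<in>odd_primes_le N. k * f p) = k * (ln (real N) / real N * (\<Sum>p\<in>odd_primes_le N. f p))" for N
    by (simp flip: sum_distrib_left)
  show ?thesis unfolding prime_mean_def eq
    by (rule tendsto_mult_left[OF assms[unfolded prime_mean_def]])
qed

text \<open>Finitely many primes change the sum by a bounded amount, and log N / N tends to
  0.\<close>

lemma prime_mean_cong:
  assumes "prime_mean f a" "\<And>p. prime p \<Longrightarrow> p > K \<Longrightarrow> p > 2 \<Longrightarrow> f p = g p"
  shows "prime_mean g a"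
proof -
  define B where "B = (\<Sum>p\<in>{..max K 2}. \<bar>g p - f p\<bar>)"
  have "(\<lambda>N. ln (real N) / real N * (\<Sum>p\<in>odd_primes_le N. g p - f p)) \<longlonglongrightarrow> 0"
  proof (rule Lim_null_comparison)
    show "(\<lambda>N::nat. ln (real N) / real N * B) \<longlonglongrightarrow> 0"
    proof -
      have "(\<lambda>N::nat. ln (real N) / real N) \<longlonglongrightarrow> 0" by real_asymp
      from tendsto_mult_right[OF this, of B] show ?thesis by simp
    qed
    show "eventually (\<lambda>N. norm (ln (real N) / real N * (\<Sum>p\<in>odd_primes_le N. g p - f p)) \<le> ln (real N) / real N * B) sequentially"
      using eventually_gt_at_top[of 0]
    proof eventually_elim
      case (elim N)
      have "\<bar>\<Sum>p\<in>odd_primes_le N. g p - f p\<bar> \<le> (\<Sum>p\<in>odd_primes_le N. \<bar>g p - f p\<bar>)" by (rule sum_abs)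
      also have "\<dots> = (\<Sum>p\<in>odd_primes_le N \<inter> {..max K 2}. \<bar>g p - f p\<bar>)"
      proof (rule sum.mono_neutral_right)
        show "\<forall>p\<in>odd_primes_le N - odd_primes_le N \<inter> {..max K 2}. \<bar>g p - f p\<bar> = 0"
        proof
          fix p assume "p \<in> odd_primes_le N - odd_primes_le N \<inter> {..max K 2}"
          hence "prime p" "K < p" "2 < p" by (auto simp: odd_primes_le_def not_le)
          from assms(2)[OF this] show "\<bar>g p - f p\<bar> = 0" by simp
        qed
      qed auto
      also have "\<dots> \<le> B" unfolding B_def by (intro sum_mono2) auto
      finally have le: "\<bar>\<Sum>p\<in>odd_primes_le N. g p - f p\<bar> \<le> B" .
      have R: "ln (real N) / real N \<ge> 0" using elim by (intro divide_nonneg_nonneg) auto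
      show ?case unfolding real_norm_def abs_mult[of "ln (real N) / real N"] abs_of_nonneg[OF R] by (rule mult_left_mono[OF le R])
    qed
  qed
  from tendsto_add[OF assms(1)[unfolded prime_mean_def] this] show ?thesis
    unfolding prime_mean_def sum_subtractf distrib_left [symmetric] by simp
qed

lemma prime_mean_one: "prime_mean (\<lambda>_. 1) 1"
  by (rule prime_mean_from_mangoldt) (use prime_number_theorem_psi in auto)

text \<open>The mean is 0 for a non-square by the twisted prime number theorem, and 1 for a square,
  whose symbol is 1 at all but finitely many primes.\<close>

lemma prime_mean_jac:
  assumes n: "n > 0"
  shows "\<exists>d. prime_mean (jac n) d"
proof (cases "is_nth_power 2 n")
  case False
  interpret quad_char "jac n" "8 * real n" by (rule jac_quad_char[OF n False])
  have "prime_mean (jac n) 0"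
    by (rule prime_mean_from_mangoldt[OF abs_chi_le prime_number_theorem_psi_chi])
  thus ?thesis by blast
next
  case True
  then obtain s where s: "n = s ^ 2" by (auto simp: is_nth_power_def)
  have s0: "s > 0" using n s by (auto intro: Nat.gr0I)
  have "prime_mean (jac n) 1"
  proof (rule prime_mean_cong[OF prime_mean_one])
    fix p assume p: "prime p" "p > s" "p > 2"
    have "\<not> p dvd s" using p s0 by (auto dest: dvd_imp_le)
    hence "jac s p \<noteq> 0" using Legendre_eq_0_iff[of "int s" "int p"] by (simp add: jac_Legendre[OF p(1,3) s0])
    thus "1 = jac n p" using jac_values[of s p] s0 by (auto simp: s power2_eq_square jac_mult_left)
  qed
  thus ?thesis by blast
qed

text \<open>The function H is split at one prime q: it is (1 + chi_q) / 2 times H with sign 1 at q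
  plus (1 - chi_q) / 2 times H with sign -1, valid for p > q. The factor \<open>jac n p\<close> is
  carried along so that chi_q can be absorbed into \<open>jac (n * q) p\<close>, which closes the
  induction.\<close>

lemma prime_mean_jac_signs:
  assumes "finite Q" "\<And>q. q \<in> Q \<Longrightarrow> prime q" "n > 0"
  shows "\<exists>d. prime_mean (\<lambda>p. jac n p * H (\<lambda>q. if q \<in> Q then qchar q p else 1)) d"
  using assms
proof (induction Q arbitrary: H n rule: finite_induct)
  case empty
  obtain d where "prime_mean (jac n) d" using prime_mean_jac[OF empty.prems(2)] by blast
  from prime_mean_cmult[OF this, of "H (\<lambda>_. 1)"]
  have "prime_mean (\<lambda>p. jac n p * H (\<lambda>_. 1)) (H (\<lambda>_. 1) * d)" by (simp add: mult.commute)
  thus ?case by auto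
next
  case (insert q Q)
  have q: "prime q" and Q: "\<And>q. q \<in> Q \<Longrightarrow> prime q" using insert.prems by auto
  have nq: "n * q > 0" using insert.prems(2) q by (simp add: prime_gt_0_nat)
  define \<sigma> where "\<sigma> = (\<lambda>p r. if r \<in> Q then qchar r p else 1)"
  define H1 where "H1 = (\<lambda>s. H (s(q := 1)))"
  define H2 where "H2 = (\<lambda>s. H (s(q := -1)))"
  have IH: "\<exists>d. prime_mean (\<lambda>p. jac m p * H' (\<sigma> p)) d" if "m > 0" for m H'
    using insert.IH[OF Q that, of H'] unfolding \<sigma>_def .
  obtain a where a: "prime_mean (\<lambda>p. jac n p * H1 (\<sigma> p)) a" using IH[OF insert.prems(2), of H1] ..
  obtain b where b: "prime_mean (\<lambda>p. jac (n * q) p * H1 (\<sigma> p)) b" using IH[OF nq, of H1] ..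
  obtain c where c: "prime_mean (\<lambda>p. jac n p * H2 (\<sigma> p)) c" using IH[OF insert.prems(2), of H2] ..
  obtain d where d: "prime_mean (\<lambda>p. jac (n * q) p * H2 (\<sigma> p)) d" using IH[OF nq, of H2] ..
  have m: "prime_mean (\<lambda>p. 1/2 * (jac n p * H1 (\<sigma> p)) + 1/2 * (jac (n * q) p * H1 (\<sigma> p)) +
      (1/2 * (jac n p * H2 (\<sigma> p)) + -1/2 * (jac (n * q) p * H2 (\<sigma> p)))) (1/2 * a + 1/2 * b + (1/2 * c + -1/2 * d))"
    by (intro prime_mean_add prime_mean_cmult a b c d)
  have "prime_mean (\<lambda>p. jac n p * H (\<lambda>r. if r \<in> insert q Q then qchar r p else 1)) (1/2 * a + 1/2 * b + (1/2 * c + -1/2 * d))"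
  proof (rule prime_mean_cong[OF m])
    fix p assume p: "prime p" "p > q" "p > 2"
    have "\<not> p dvd q" using p prime_gt_0_nat[OF q] by (auto dest: dvd_imp_le)
    hence "qchar q p \<noteq> 0" using Legendre_eq_0_iff[of "int q" "int p"] by (simp add: qchar_prime[OF q p(1,3)])
    hence cases: "qchar q p = 1 \<or> qchar q p = -1" using qchar_values[of q p] by auto
    have jq: "jac (n * q) p = jac n p * qchar q p"
      using insert.prems(2) q by (simp add: jac_mult_left jac_prime_left prime_gt_0_nat)
    have fu: "(\<lambda>r. if r \<in> insert q Q then qchar r p else 1) = (\<sigma> p)(q := qchar q p)"
      using insert.hyps by (auto simp: \<sigma>_def fun_eq_iff)
    show "1/2 * (jac n p * H1 (\<sigma> p)) + 1/2 * (jac (n * q) p * H1 (\<sigma> p)) +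
      (1/2 * (jac n p * H2 (\<sigma> p)) + -1/2 * (jac (n * q) p * H2 (\<sigma> p))) =
      jac n p * H (\<lambda>r. if r \<in> insert q Q then qchar r p else 1)"
      unfolding fu jq using cases by (auto simp: H1_def H2_def)
  qed
  thus ?case by blast
qed

lemma prime_mean_f_eps_greater:
  assumes \<epsilon>: "\<epsilon> > 0"
  shows "\<exists>d. prime_mean (\<lambda>p. if f_eps \<epsilon> p > l then 1 else 0) d"
proof -
  define Q where "Q = {q. prime q \<and> q \<le> l}"
  \<comment> \<open>The condition f(p) > l as a function of the signs at the primes q <= l: each
    symbol (i/p) with i <= l is rebuilt from the factorization of i.\<close>
  define H :: "(nat \<Rightarrow> real) \<Rightarrow> real" where
    "H = (\<lambda>s. if \<forall>m\<in>{1..l}. \<epsilon> * real m \<le> (\<Sum>i=1..m. \<Prod>q\<in>#prime_factorization i. s q) then 1 else 0)"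
  have finQ: "finite Q" unfolding Q_def by (rule finite_subset[of _ "{..l}"]) auto
  obtain d where d: "prime_mean (\<lambda>p. jac 1 p * H (\<lambda>q. if q \<in> Q then qchar q p else 1)) d"
    using prime_mean_jac_signs[OF finQ, of 1 H] by (auto simp: Q_def)
  obtain p0 where p0: "\<And>p. p \<ge> p0 \<Longrightarrow> prime p \<Longrightarrow> p > 2 \<Longrightarrow> \<exists>m\<ge>1. jac_sum m p < \<epsilon> * real m"
    using f_eps_bound[OF \<epsilon>] by blast
  have "prime_mean (\<lambda>p. if f_eps \<epsilon> p > l then 1 else 0) d"
  proof (rule prime_mean_cong[OF d])
    fix p assume p: "prime p" "p > p0" "p > 2"
    have eq: "(\<Sum>i=1..m. \<Prod>q\<in>#prime_factorization i. (if q \<in> Q then qchar q p else 1)) = jac_sum m p"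
      if "m \<in> {1..l}" for m
      unfolding jac_sum_def jac_def
    proof (intro sum.cong refl arg_cong[where f = prod_mset] image_mset_cong)
      fix i q assume i: "i \<in> {1..m}" and q: "q \<in># prime_factorization i"
      have "prime q" "q dvd i" using q by (auto simp: in_prime_factors_iff)
      moreover have "q \<le> i" using i \<open>q dvd i\<close> by (intro dvd_imp_le) auto
      ultimately show "(if q \<in> Q then qchar q p else 1) = qchar q p" using i that by (auto simp: Q_def)
    qed
    have iff: "(\<forall>m\<in>{1..l}. \<epsilon> * real m \<le> jac_sum m p) \<longleftrightarrow> f_eps \<epsilon> p > l"
    proof
      assume all: "\<forall>m\<in>{1..l}. \<epsilon> * real m \<le> jac_sum m p"
      have ex: "\<exists>m. m \<ge> 1 \<and> jac_sum m p < \<epsilon> * real m" using p0[of p] p by auto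
      have f: "f_eps \<epsilon> p \<ge> 1 \<and> jac_sum (f_eps \<epsilon> p) p < \<epsilon> * real (f_eps \<epsilon> p)"
        unfolding f_eps_alt[OF p(1,3)] by (rule LeastI_ex[OF ex])
      show "f_eps \<epsilon> p > l"
      proof (rule ccontr)
        assume "\<not> f_eps \<epsilon> p > l"
        hence "f_eps \<epsilon> p \<in> {1..l}" using f by simp
        from bspec[OF all this] f show False by simp
      qed
    next
      assume "f_eps \<epsilon> p > l"
      thus "\<forall>m\<in>{1..l}. \<epsilon> * real m \<le> jac_sum m p" by (intro ballI f_eps_greater[OF p(1,3)]) auto
    qed
    show "jac 1 p * H (\<lambda>q. if q \<in> Q then qchar q p else 1) = (if f_eps \<epsilon> p > l then 1 else 0)"
    proof -
      have "(\<forall>m\<in>{1..l}. \<epsilon> * real m \<le> (\<Sum>i=1..m. \<Prod>q\<in>#prime_factorization i. (if q \<in> Q then qchar q p else 1))) \<longleftrightarrow>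
          f_eps \<epsilon> p > l"
        unfolding iff [symmetric] by (rule ball_cong[OF refl]) (simp only: eq)
      thus ?thesis unfolding H_def by simp
    qed
  qed
  thus ?thesis by blast
qed

text \<open>O(N^(1/48)) primes remain, each with f(p) = O(N^(3/4)). The constant K takes care of the
  finitely many primes below p0, which the bound for f does not reach.\<close>

lemma f_eps_tail_sum_bound:
  assumes \<epsilon>: "\<epsilon> > 0"
  shows "\<exists>C>0. \<exists>N0. \<forall>N\<ge>N0. \<forall>l\<ge>1. l ^ 24 \<le> N \<longrightarrow> N \<le> (2 * l) ^ 24 \<longrightarrow>
    (\<Sum>p\<in>{p \<in> odd_primes_le N. f_eps \<epsilon> p > l}. real (f_eps \<epsilon> p)) \<le> C * real N powr (1/48 + 3/4)"
proof -
  obtain C N0 where C: "C > 0" "\<And>N l. N \<ge> N0 \<Longrightarrow> l \<ge> 1 \<Longrightarrow> l ^ 24 \<le> N \<Longrightarrow> N \<le> (2 * l) ^ 24 \<Longrightarrow>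
      real (card (large_sum_primes \<epsilon> l N)) \<le> C * real N powr (1/48)"
    using card_large_sum_primes_le_root[OF \<epsilon>] by blast
  obtain p0 where p0: "\<And>p. p \<ge> p0 \<Longrightarrow> prime p \<Longrightarrow> p > 2 \<Longrightarrow> real (f_eps \<epsilon> p) \<le> real p powr (3/4)"
    using f_eps_bound[OF \<epsilon>] by blast
  define K where "K = (\<Sum>p<p0. real (f_eps \<epsilon> p))"
  have K0: "K \<ge> 0" unfolding K_def by (intro sum_nonneg) auto
  have "(\<Sum>p\<in>{p \<in> odd_primes_le N. f_eps \<epsilon> p > l}. real (f_eps \<epsilon> p)) \<le> (C * (K + 1)) * real N powr (1/48 + 3/4)"
    if N: "N \<ge> N0" and l: "l \<ge> 1" "l ^ 24 \<le> N" "N \<le> (2 * l) ^ 24" for N l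
  proof -
    have N1: "N \<ge> 1" using l one_le_power[of l 24] by linarith
    have x1: "real N powr (3/4) \<ge> 1" using N1 by (intro ge_one_powr_ge_zero) auto
    have P2: "prime p \<and> p > 2 \<and> p \<le> N" if "p \<in> odd_primes_le N" for p
    proof -
      have "prime p" "odd p" "p \<le> N" using that by (auto simp: odd_primes_le_def)
      thus ?thesis using prime_ge_2_nat[of p] by (cases "p = 2") auto
    qed
    have f: "real (f_eps \<epsilon> p) \<le> (K + 1) * real N powr (3/4)" if p: "p \<in> odd_primes_le N" for p
    proof (cases "p < p0")
      case True
      have "real (f_eps \<epsilon> p) \<le> K" unfolding K_def by (rule member_le_sum) (use True in auto)
      also have "\<dots> \<le> (K + 1) * 1" by simp
      also have "\<dots> \<le> (K + 1) * real N powr (3/4)" using x1 K0 by (intro mult_left_mono) auto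
      finally show ?thesis .
    next
      case False
      have "real (f_eps \<epsilon> p) \<le> real p powr (3/4)" using p0[of p] P2[OF p] False by simp
      also have "\<dots> \<le> real N powr (3/4)" using P2[OF p] by (intro powr_mono2) auto
      also have "\<dots> = 1 * real N powr (3/4)" by simp
      also have "\<dots> \<le> (K + 1) * real N powr (3/4)" using K0 by (intro mult_right_mono) auto
      finally show ?thesis .
    qed
    have sub: "{p \<in> odd_primes_le N. f_eps \<epsilon> p > l} \<subseteq> large_sum_primes \<epsilon> l N"
      using P2 f_eps_greater l(1) by (auto simp: large_sum_primes_def)
    have "(\<Sum>p\<in>{p \<in> odd_primes_le N. f_eps \<epsilon> p > l}. real (f_eps \<epsilon> p)) \<le>
        (\<Sum>p\<in>{p \<in> odd_primes_le N. f_eps \<epsilon> p > l}. (K + 1) * real N powr (3/4))"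
      by (intro sum_mono f) auto
    also have "\<dots> = real (card {p \<in> odd_primes_le N. f_eps \<epsilon> p > l}) * ((K + 1) * real N powr (3/4))" by simp
    also have "\<dots> \<le> (C * real N powr (1/48)) * ((K + 1) * real N powr (3/4))"
    proof (rule mult_right_mono)
      have "real (card {p \<in> odd_primes_le N. f_eps \<epsilon> p > l}) \<le> real (card (large_sum_primes \<epsilon> l N))"
        using card_mono[OF finite_large_sum_primes sub] by (simp only: of_nat_le_iff)
      also have "\<dots> \<le> C * real N powr (1/48)" by (rule C(2)[OF N l])
      finally show "real (card {p \<in> odd_primes_le N. f_eps \<epsilon> p > l}) \<le> C * real N powr (1/48)" .
    qed (use K0 in auto)
    also have "\<dots> = (C * (K + 1)) * (real N powr (1/48) * real N powr (3/4))" by (simp only: mult_ac)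
    also have "real N powr (1/48) * real N powr (3/4) = real N powr (1/48 + 3/4)" by (rule powr_add [symmetric])
    finally show ?thesis .
  qed
  thus ?thesis using C(1) K0 by (intro exI[of _ "C * (K + 1)"]) auto
qed

text \<open>f(p) is the number of l >= 0 with f(p) > l, so the mean of f is a sum over l of means
  tending to D l. The summable majorant C l^(-3/2) lets Tannery's theorem take the limit inside, and
  the constant, the sum of all D l, is positive because D 0 = 1.\<close>

theorem prime_mean_f_eps:
  assumes \<epsilon>: "\<epsilon> > 0"
  shows "\<exists>c>0. prime_mean (\<lambda>p. real (f_eps \<epsilon> p)) c"
proof -
  define I :: "nat \<Rightarrow> nat \<Rightarrow> real" where "I = (\<lambda>l p. if f_eps \<epsilon> p > l then 1 else 0)"
  define R where "R = (\<lambda>N. ln (real N) / real N)"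
  have R0: "R N \<ge> 0" for N unfolding R_def by (cases "N = 0") auto
  obtain D where D: "\<And>l. prime_mean (I l) (D l)"
    using prime_mean_f_eps_greater[OF \<epsilon>] unfolding I_def by metis
  have Dlim: "(\<lambda>N. R N * (\<Sum>p\<in>odd_primes_le N. I l p)) \<longlonglongrightarrow> D l" for l
    using D[of l] unfolding prime_mean_def R_def .
  have I0: "I l p \<ge> 0" for l p by (simp add: I_def)
  have D0: "D l \<ge> 0" for l
    by (rule LIMSEQ_le_const[OF Dlim]) (auto intro!: exI mult_nonneg_nonneg R0 sum_nonneg I0)
  obtain p0 where p0: "\<And>p. p \<ge> p0 \<Longrightarrow> prime p \<Longrightarrow> p > 2 \<Longrightarrow> \<exists>m\<ge>1. jac_sum m p < \<epsilon> * real m"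
    using f_eps_bound[OF \<epsilon>] by blast
  have "prime_mean (I 0) 1"
  proof (rule prime_mean_cong[OF prime_mean_one])
    fix p assume p: "prime p" "p > p0" "p > 2"
    have ex: "\<exists>m. m \<ge> 1 \<and> jac_sum m p < \<epsilon> * real m" using p0[of p] p by auto
    have "f_eps \<epsilon> p \<ge> 1 \<and> jac_sum (f_eps \<epsilon> p) p < \<epsilon> * real (f_eps \<epsilon> p)"
      unfolding f_eps_alt[OF p(1,3)] by (rule LeastI_ex[OF ex])
    thus "1 = I 0 p" by (simp add: I_def)
  qed
  hence "D 0 = 1" using D[of 0] unfolding prime_mean_def by (metis LIMSEQ_unique)
  obtain C where C: "C > 0" "\<And>l M. l \<ge> 1 \<Longrightarrow> M \<ge> 3 \<Longrightarrow> l ^ 24 \<le> M \<Longrightarrow>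
    real (card (large_sum_primes \<epsilon> l M)) * ln (real M) / real M \<le> C * real l powr (-3/2)"
    using card_large_sum_primes_le[OF \<epsilon>] by blast
  \<comment> \<open>The majorant is available for l^24 <= N. Cutting off all other l changes no
    limit at fixed l; the part removed is estimated separately.\<close>
  define a where "a = (\<lambda>l N. if l ^ 24 \<le> N then R N * (\<Sum>p\<in>odd_primes_le N. I l p) else 0)"
  have alim: "a l \<longlonglongrightarrow> D l" for l
  proof (rule Lim_transform_eventually[OF Dlim])
    show "eventually (\<lambda>N. R N * (\<Sum>p\<in>odd_primes_le N. I l p) = a l N) sequentially"
      using eventually_ge_at_top[of "l ^ 24"] by eventually_elim (simp add: a_def)
  qed
  have abd: "norm (a l N) \<le> C * real l powr (-3/2)" if l: "l \<ge> 1" and N: "N \<ge> 3" for l N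
  proof (cases "l ^ 24 \<le> N")
    case True
    have sub: "{p \<in> odd_primes_le N. f_eps \<epsilon> p > l} \<subseteq> large_sum_primes \<epsilon> l N"
    proof
      fix p assume "p \<in> {p \<in> odd_primes_le N. f_eps \<epsilon> p > l}"
      hence p: "p \<in> odd_primes_le N" "f_eps \<epsilon> p > l" by auto
      hence "prime p" "odd p" by (auto simp: odd_primes_le_def)
      hence "p > 2" using prime_ge_2_nat[of p] by (cases "p = 2") auto
      from f_eps_greater[OF \<open>prime p\<close> this l p(2)] p(1) show "p \<in> large_sum_primes \<epsilon> l N"
        by (simp add: large_sum_primes_def)
    qed
    have "(\<Sum>p\<in>odd_primes_le N. I l p) = real (card {p \<in> odd_primes_le N. f_eps \<epsilon> p > l})"
      by (simp add: I_def sum.If_cases Int_def)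
    also have "\<dots> \<le> real (card (large_sum_primes \<epsilon> l N))"
      using card_mono[OF finite_large_sum_primes sub] by (simp only: of_nat_le_iff)
    finally have "R N * (\<Sum>p\<in>odd_primes_le N. I l p) \<le> R N * real (card (large_sum_primes \<epsilon> l N))"
      using R0 by (intro mult_left_mono)
    also have "\<dots> = real (card (large_sum_primes \<epsilon> l N)) * ln (real N) / real N" by (simp add: R_def)
    also have "\<dots> \<le> C * real l powr (-3/2)" by (rule C(2)[OF l N True])
    finally have le: "R N * (\<Sum>p\<in>odd_primes_le N. I l p) \<le> C * real l powr (-3/2)" .
    have "R N * (\<Sum>p\<in>odd_primes_le N. I l p) \<ge> 0" by (intro mult_nonneg_nonneg R0 sum_nonneg I0)
    with le True show ?thesis by (simp add: a_def)
  next
    case False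
    thus ?thesis using C(1) by (simp add: a_def)
  qed
  have ev: "\<forall>\<^sub>F (l, N) in sequentially \<times>\<^sub>F sequentially. norm (a l N) \<le> C * real l powr (-3/2)"
    unfolding eventually_prod_filter
    by (intro exI[of _ "\<lambda>l. l \<ge> 1"] exI[of _ "\<lambda>N. N \<ge> 3"]) (use abd eventually_ge_at_top in auto)
  have sumM: "summable (\<lambda>l. C * real l powr (-3/2))"
    by (intro summable_mult) (simp add: summable_real_powr_iff)
  note T = tannerys_theorem[OF alim ev sumM sequentially_bot]
  have sumD: "summable D" using T D0 by simp
  have limS: "(\<lambda>N. \<Sum>l. a l N) \<longlonglongrightarrow> suminf D" using T by blast
  have "suminf D > 0" by (rule suminf_pos2[OF sumD D0, of 0]) (simp add: \<open>D 0 = 1\<close>)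
  obtain C' N0 where C': "C' > 0" "\<And>N l. N \<ge> N0 \<Longrightarrow> l \<ge> 1 \<Longrightarrow> l ^ 24 \<le> N \<Longrightarrow> N \<le> (2 * l) ^ 24 \<Longrightarrow>
      (\<Sum>p\<in>{p \<in> odd_primes_le N. f_eps \<epsilon> p > l}. real (f_eps \<epsilon> p)) \<le> C' * real N powr (1/48 + 3/4)"
    using f_eps_tail_sum_bound[OF \<epsilon>] by blast
  have diff: "(\<lambda>N. R N * (\<Sum>p\<in>odd_primes_le N. real (f_eps \<epsilon> p)) - (\<Sum>l. a l N)) \<longlonglongrightarrow> 0"
  proof (rule Lim_null_comparison)
    show "(\<lambda>N. R N * (C' * real N powr (1/48 + 3/4))) \<longlonglongrightarrow> 0"
    proof -
      have "(\<lambda>N. ln (real N) / real N * real N powr (1/48 + 3/4)) \<longlonglongrightarrow> 0" by real_asymp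
      from tendsto_mult_left[OF this, of C'] show ?thesis by (simp add: R_def mult_ac)
    qed
    show "eventually (\<lambda>N. norm (R N * (\<Sum>p\<in>odd_primes_le N. real (f_eps \<epsilon> p)) - (\<Sum>l. a l N))
        \<le> R N * (C' * real N powr (1/48 + 3/4))) sequentially"
      using eventually_ge_at_top[of "max N0 1"]
    proof eventually_elim
      case (elim N)
      \<comment> \<open>The cutoff index: l^24 <= N is equivalent to l <= l0, and r < l0 + 1 <= 2 l0
        gives the upper bound for N that the tail estimate asks for.\<close>
      define r where "r = root 24 (real N)"
      define l0 where "l0 = nat \<lfloor>r\<rfloor>"
      have r: "r \<ge> 1" "r ^ 24 = real N" using elim by (simp_all add: r_def)
      have l0r: "real l0 \<le> r" unfolding l0_def using r by (intro of_nat_floor) simp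
      have rl0: "r < real l0 + 1" unfolding l0_def by linarith
      have l01: "l0 \<ge> 1" using r by (simp add: l0_def le_nat_floor)
      have iff: "l ^ 24 \<le> N \<longleftrightarrow> l \<le> l0" for l
      proof
        assume "l ^ 24 \<le> N"
        hence "real (l ^ 24) \<le> real N" by (simp only: of_nat_le_iff)
        hence "real l ^ 24 \<le> r ^ 24" by (simp add: r)
        hence "real l \<le> r" by (rule power_le_imp_le_base[of _ 23, simplified]) (use r in auto)
        thus "l \<le> l0" by (simp add: l0_def le_nat_floor)
      next
        assume "l \<le> l0"
        hence "real l \<le> r" using l0r by simp
        hence "real l ^ 24 \<le> r ^ 24" by (intro power_mono) auto
        hence "real (l ^ 24) \<le> real N" by (simp add: r)
        thus "l ^ 24 \<le> N" by (simp only: of_nat_le_iff)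
      qed
      have up: "N \<le> (2 * l0) ^ 24"
      proof -
        have "r \<le> real (2 * l0)" using rl0 l01 by simp
        hence "r ^ 24 \<le> real (2 * l0) ^ 24" using r by (intro power_mono) auto
        hence "real N \<le> real ((2 * l0) ^ 24)" by (simp add: r)
        thus ?thesis by (simp only: of_nat_le_iff)
      qed
      have "(\<Sum>l. a l N) = (\<Sum>l\<in>{..l0}. a l N)"
        by (rule suminf_finite) (auto simp: a_def iff)
      also have "\<dots> = R N * (\<Sum>l\<in>{..l0}. \<Sum>p\<in>odd_primes_le N. I l p)"
        unfolding sum_distrib_left[of "R N" "\<lambda>l. \<Sum>p\<in>odd_primes_le N. I l p"]
        by (intro sum.cong refl) (simp add: a_def iff)
      also have "(\<Sum>l\<in>{..l0}. \<Sum>p\<in>odd_primes_le N. I l p) = (\<Sum>p\<in>odd_primes_le N. \<Sum>l\<in>{..l0}. I l p)"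
        by (rule sum.swap)
      finally have S: "(\<Sum>l. a l N) = R N * (\<Sum>p\<in>odd_primes_le N. \<Sum>l\<in>{..l0}. I l p)" .
      \<comment> \<open>l runs from 0 to l0, which are l0 + 1 values; hence f is truncated at l0 +
        1.\<close>
      have cnt: "(\<Sum>l\<in>{..l0}. I l p) = real (min (f_eps \<epsilon> p) (l0 + 1))" for p
      proof -
        have "(\<Sum>l\<in>{..l0}. I l p) = real (card ({..l0} \<inter> {l. l < f_eps \<epsilon> p}))"
          by (simp add: I_def sum.If_cases)
        also have "{..l0} \<inter> {l. l < f_eps \<epsilon> p} = {..<min (f_eps \<epsilon> p) (l0 + 1)}" by auto
        finally show ?thesis by simp
      qed
      have d: "R N * (\<Sum>p\<in>odd_primes_le N. real (f_eps \<epsilon> p)) - (\<Sum>l. a l N) =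
          R N * (\<Sum>p\<in>odd_primes_le N. real (f_eps \<epsilon> p) - real (min (f_eps \<epsilon> p) (l0 + 1)))"
        unfolding S cnt sum_subtractf right_diff_distrib ..
      have "0 \<le> (\<Sum>p\<in>odd_primes_le N. real (f_eps \<epsilon> p) - real (min (f_eps \<epsilon> p) (l0 + 1)))"
        by (intro sum_nonneg) simp
      moreover have "(\<Sum>p\<in>odd_primes_le N. real (f_eps \<epsilon> p) - real (min (f_eps \<epsilon> p) (l0 + 1)))
          \<le> C' * real N powr (1/48 + 3/4)"
      proof -
        have "(\<Sum>p\<in>odd_primes_le N. real (f_eps \<epsilon> p) - real (min (f_eps \<epsilon> p) (l0 + 1)))
          \<le> (\<Sum>p\<in>odd_primes_le N. if f_eps \<epsilon> p > l0 then real (f_eps \<epsilon> p) else 0)"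
          by (intro sum_mono) auto
        also have "\<dots> = (\<Sum>p\<in>{p \<in> odd_primes_le N. f_eps \<epsilon> p > l0}. real (f_eps \<epsilon> p))"
          by (simp add: sum.inter_filter)
        also have "\<dots> \<le> C' * real N powr (1/48 + 3/4)"
          by (rule C'(2)) (use elim l01 up iff in auto)
        finally show ?thesis .
      qed
      ultimately show ?case unfolding d real_norm_def abs_mult[of "R N"] abs_of_nonneg[OF R0]
        using R0[of N] by (intro mult_left_mono) simp_all
    qed
  qed
  from tendsto_add[OF diff limS]
  have "prime_mean (\<lambda>p. real (f_eps \<epsilon> p)) (suminf D)" by (simp add: prime_mean_def R_def)
  thus ?thesis using \<open>suminf D > 0\<close> by blast
qed

theorem theorem1p2:
  fixes \<epsilon> :: real
  assumes "\<epsilon> > 0"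
  shows "\<exists>c::real. c > 0 \<and>
    (\<lambda>x::real. \<Sum>p\<in>{p::nat. prime p \<and> odd p \<and> real p \<le> x}. real (f_eps \<epsilon> p))
      \<sim>[at_top] (\<lambda>x. c * x / ln x)"
proof -
  obtain c where c: "c > 0" "prime_mean (\<lambda>p. real (f_eps \<epsilon> p)) c"
    using prime_mean_f_eps[OF assms] by blast
  define G where "G = (\<lambda>N. \<Sum>p\<in>odd_primes_le N. real (f_eps \<epsilon> p))"
  define F where "F = (\<lambda>x::real. \<Sum>p\<in>{p::nat. prime p \<and> odd p \<and> real p \<le> x}. real (f_eps \<epsilon> p))"
  have FG: "F x = G (nat \<lfloor>x\<rfloor>)" if "x \<ge> 0" for x
  proof -
    have "real p \<le> x \<longleftrightarrow> p \<le> nat \<lfloor>x\<rfloor>" for p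
    proof
      assume "p \<le> nat \<lfloor>x\<rfloor>"
      hence "real p \<le> real (nat \<lfloor>x\<rfloor>)" by (simp only: of_nat_le_iff)
      also have "\<dots> \<le> x" by (rule of_nat_floor[OF that])
      finally show "real p \<le> x" .
    qed (rule le_nat_floor)
    hence "{p::nat. prime p \<and> odd p \<and> real p \<le> x} = odd_primes_le (nat \<lfloor>x\<rfloor>)"
      by (simp add: odd_primes_le_def)
    thus ?thesis by (simp add: F_def G_def)
  qed
  have fl: "filterlim (\<lambda>x::real. nat \<lfloor>x\<rfloor>) sequentially at_top"
    by (rule filterlim_compose[OF filterlim_nat_sequentially filterlim_floor_sequentially])
  have 1: "((\<lambda>x::real. ln (real (nat \<lfloor>x\<rfloor>)) / real (nat \<lfloor>x\<rfloor>) * G (nat \<lfloor>x\<rfloor>)) \<longlongrightarrow> c) at_top"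
    using filterlim_compose[OF c(2)[unfolded prime_mean_def] fl] by (simp add: G_def)
  \<comment> \<open>Replacing the floor of x by x does not change the normalising factor
    asymptotically.\<close>
  have 2: "((\<lambda>x::real. (ln x / x) / (ln (real (nat \<lfloor>x\<rfloor>)) / real (nat \<lfloor>x\<rfloor>))) \<longlongrightarrow> 1) at_top"
    by real_asymp
  have "((\<lambda>x. F x / (c * x / ln x)) \<longlongrightarrow> 1) at_top"
  proof (rule Lim_transform_eventually)
    show "((\<lambda>x::real. (ln x / x) / (ln (real (nat \<lfloor>x\<rfloor>)) / real (nat \<lfloor>x\<rfloor>)) *
        (ln (real (nat \<lfloor>x\<rfloor>)) / real (nat \<lfloor>x\<rfloor>) * G (nat \<lfloor>x\<rfloor>)) / c) \<longlongrightarrow> 1) at_top"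
      using tendsto_divide[OF tendsto_mult[OF 2 1] tendsto_const[of c]] c(1) by simp
    show "eventually (\<lambda>x::real. (ln x / x) / (ln (real (nat \<lfloor>x\<rfloor>)) / real (nat \<lfloor>x\<rfloor>)) *
        (ln (real (nat \<lfloor>x\<rfloor>)) / real (nat \<lfloor>x\<rfloor>) * G (nat \<lfloor>x\<rfloor>)) / c = F x / (c * x / ln x)) at_top"
      using eventually_ge_at_top[of 3]
    proof eventually_elim
      case (elim x)
      define N where "N = nat \<lfloor>x\<rfloor>"
      have "N \<ge> 3" using elim by (simp add: N_def le_nat_floor)
      hence "ln (real N) / real N \<noteq> 0" by simp
      moreover have "F x = G N" using FG[of x] elim by (simp add: N_def)
      ultimately show ?case using elim by (simp add: N_def [symmetric] mult_ac)
    qed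
  qed
  hence "F \<sim>[at_top] (\<lambda>x. c * x / ln x)" by (rule asymp_equivI')
  thus ?thesis using c(1) unfolding F_def by blast
qed

end
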